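(* (1) If there exists an SKS proof from $u$ to $v$, then there exists a proof from $\Phi^X(u)$ to $\Phi^X(v)$ in $\Sigma^K$, for every $1$-arrow $X$ such that $\sharp X\geq\sharp u$ and $\sharp X\geq\sharp v$. In particular, if there exists a complete SKS proof of $u$, then there exists a complete proof of $\Phi^X(u)$ for every $X$ such that $\sharp X\geq\sharp u$. (2) Conversely, if $f$ and $g$ are $2$-arrows of $\langle\Sigma^F\rangle$ with target $F$ or $A$ such that there exists a proof from $f$ to $g$ in $\Sigma^K$, then there exists an SKS proof from $\pi(f)$ to $\pi(g)$. In particular, if there exists a complete proof of $f$, where $f$ has target $A$ or $F$, then there exists a complete SKS proof of $\pi(f)$.
   Context: **SKS terms.** Two-sorted terms (sorts $A$ of atoms, $F$ of formulas) over variables $a_1,a_2,\dots$ of sort $A$ and $x_1,x_2,\dots$ of sort $F$, with constructors $\nu:A\to A$, $\iota:A\to F$, $\top,\bot:F$ (constants), $\wedge,\vee:F\times F\to F$. For a rule $\alpha:s(\alpha)\to t(\alpha)$ between terms of the same sort (no condition on variables), $u\to_\alpha v$ means $u=C[s(\alpha)\cdot\sigma]$, $v=C[t(\alpha)\cdot\sigma]$ for a one-hole context $C$ and a (sorted) substitution $\sigma$; on finite families of terms, the rule is applied in one of the components. **Structural rules $S$:** $(x_1\wedge x_2)\wedge x_3\to x_1\wedge(x_2\wedge x_3)$; $(x_1\vee x_2)\vee x_3\to x_1\vee(x_2\vee x_3)$; $x_1\wedge x_2\to x_2\wedge x_1$; $x_1\vee x_2\to x_2\vee x_1$; $\top\wedge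 x_1\to x_1$; $\bot\vee x_1\to x_1$; $\bot\wedge\bot\to\bot$; $\top\vee\top\to\top$; $\nu(\nu(a_1))\to a_1$. $\overline S$ is the union of $S$ and of the reversed rules. **Inference rules $R$:** $\top\to\iota(a_1)\vee\iota(\nu(a_1))$; $\iota(a_1)\wedge\iota(\nu(a_1))\to\bot$; $(x_1\vee x_2)\wedge x_3\to x_1\vee(x_2\wedge x_3)$; $(x_1\wedge x_2)\vee(x_3\wedge x_4)\to(x_1\vee x_3)\wedge(x_2\vee x_4)$; $\bot\to\iota(a_1)$; $\iota(a_1)\to\top$; $\iota(a_1)\vee\iota(a_1)\to\iota(a_1)$; $\iota(a_1)\to\iota(a_1)\wedge\iota(a_1)$. An SKS proof from $u$ to $v$ (families of terms) is a finite (possibly empty) sequence of steps $\to_\alpha$, $\alpha\in R\cup\overline S$, from $u$ to $v$. A complete SKS proof of $u$ is an SKS proof from $\top$ to $u$. **Circuits.** $\Sigma^F$ is the $2$-polygraph with one $0$-cell, two $1$-cells $A$, $F$ and fourteen $2$-cells: $\wedge,\vee:F\otimes F\to F$; $\top,\bot:\ast\to F$; $\iota:A\to F$; $\nu:A\to A$; and, for $X,Y\in\{A,F\}$, $\delta_X:X\to X\otimes X$, $\epsilon_X:X\to\ast$, $\tau_{XY}:X\otimes Y\to Y\otimes X$ ($\ast$ is the empty word). $\langle\Sigma^F\rangle$ is the free strict $2$-category (free strict monoidal category) it generates: $1$-arrows are words on $\{A,F\}$; $2$-arrows are string diagrams, with $\otimes$ juxtaposition and $g\circ f$ meaning $f$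 followed by $g$. The identity of a $1$-arrow $X$ is also written $X$; $s_1,t_1$ denote source and target words. Shorthands: $\delta_\ast=\epsilon_\ast=\ast$, $\delta_{FF}=(F\otimes\tau_{FF}\otimes F)\circ(\delta_F\otimes\delta_F)$, $\tau_{\ast,X}=\tau_{X,\ast}=X$, $\tau_{FF,X}=(\tau_{FX}\otimes F)\circ(F\otimes\tau_{FX})$, $\tau_{X,FF}=(F\otimes\tau_{XF})\circ(\tau_{XF}\otimes F)$, and $\epsilon_W$ is the juxtaposition of the erasers of the letters of a word $W$. **Projection $\pi$.** The $2$-category $\mathbb T$ has one $0$-cell; its $1$-arrows are words on $\{A,F\}$; for a word $X$, $\sharp X=(\text{number of }A,\text{number of }F)$; for a family $u$ of terms, $\sharp u=(\sharp_Au,\sharp_Fu)$, where $\sharp_Au$ (resp. $\sharp_Fu$) is the greatest $k$ such that $a_k$ (resp. $x_k$) occurs in $u$ ($0$ if none); pairs are compared by the product order. A $2$-arrow $X\to Y_1\otimes\dots\otimes Y_n$ is a family $(u_1,\dots,u_n)$ of terms, $u_i$ of sort $Y_i$, with $\sharp u\leq\sharp X$. For $u:X\to Y$, $v:X'\to Y'$, $u\otimes v$ is the concatenation of $u$ and of $v$ with indices of atom variables shifted by the number of $A$ in $X$ and those of formula variables by the number of $F$ in $X$; for $u:X\to Y$ and $v:Y\to Z$, $v\circ u$ is $v$ where $a_k$ (resp. $x_k$) is replaced by the $k$-th element of sort $A$ (resp. $F$) of $u$. $\pi:\langle\Sigma^F\rangle\to\mathbb T$ is the $2$-functor, identity on $1$-arrows,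 with $\pi(\delta_A)=(a_1,a_1)$, $\pi(\delta_F)=(x_1,x_1)$, $\pi(\epsilon_X)=()$, $\pi(\tau_{AA})=(a_2,a_1)$, $\pi(\tau_{AF})=(x_1,a_1)$, $\pi(\tau_{FA})=(a_1,x_1)$, $\pi(\tau_{FF})=(x_2,x_1)$, $\pi(\wedge)=x_1\wedge x_2$, $\pi(\vee)=x_1\vee x_2$, $\pi(\top)=\top$, $\pi(\bot)=\bot$, $\pi(\iota)=\iota(a_1)$, $\pi(\nu)=\nu(a_1)$. **Resource relations $E_\Delta$** (50 equations), for all $X,Y,Z\in\{A,F\}$: $(X\otimes\delta_X)\circ\delta_X=(\delta_X\otimes X)\circ\delta_X$; $\tau_{XX}\circ\delta_X=\delta_X$; $(\epsilon_X\otimes X)\circ\delta_X=X$; $\tau_{YX}\circ\tau_{XY}=X\otimes Y$; $(Y\otimes\delta_X)\circ\tau_{XY}=(\tau_{XY}\otimes X)\circ(X\otimes\tau_{XY})\circ(\delta_X\otimes Y)$; $(Y\otimes\epsilon_X)\circ\tau_{XY}=\epsilon_X\otimes Y$; $(Z\otimes\tau_{XY})\circ(\tau_{XZ}\otimes Y)\circ(X\otimes\tau_{YZ})=(\tau_{YZ}\otimes X)\circ(Y\otimes\tau_{XZ})\circ(\tau_{XY}\otimes Z)$; and, for $\varphi:W\to S$ among $\wedge,\vee,\top,\bot,\iota,\nu$: $\tau_{SX}\circ(\varphi\otimes X)=(X\otimes\varphi)\circ\tau_{W,X}$, $\delta_S\circ\varphi=(\varphi\otimes\varphi)\circ\delta_W$,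 $\epsilon_S\circ\varphi=\epsilon_W$. **Convergent rules $R_\Delta$.** The rewriting rules consisting of the equations of $E_\Delta$ oriented from left to right together with: $(X\otimes\tau_{XX})\circ(\delta_X\otimes X)\circ\delta_X\to(\delta_X\otimes X)\circ\delta_X$; $(X\otimes\epsilon_X)\circ\delta_X\to X$; $(Y\otimes\tau_{XY})\circ(\tau_{XY}\otimes Y)\circ(X\otimes\delta_Y)\to(\delta_Y\otimes X)\circ\tau_{XY}$; $(Y\otimes\tau_{YX})\circ(\delta_Y\otimes X)\circ\tau_{XY}\to(\tau_{XY}\otimes Y)\circ(X\otimes\delta_Y)$; $(\epsilon_Y\otimes X)\circ\tau_{XY}\to X\otimes\epsilon_Y$; $\tau_{XS}\circ(X\otimes\varphi)\to(\varphi\otimes X)\circ\tau_{X,W}$. It is a convergent presentation of the congruence generated by $E_\Delta$, and two parallel $2$-arrows are congruent iff they have the same image by $\pi$. For a family $u=(u_1,\dots,u_n)$ of terms with $u_i$ of sort $Y_i$, and a word $X$ with $\sharp X\geq\sharp u$, $\Phi^X(u)$ is the unique $2$-arrow $X\to Y_1\otimes\dots\otimes Y_n$ of $\langle\Sigma^F\rangle$ in normal form for $R_\Delta$ with $\pi(\Phi^X(u))=u$. For a rule $\alpha:s\to t$ on terms, let $(p,q)=\sup(\sharp s,\sharp t)$; then $\Phi(\alpha)$ is the rule ($3$-cell) $\Phi^{A^p\otimes F^q}(s)\to\Phi^{A^p\otimes F^q}(t)$. **The 3-polygraph $\Sigma^K$** is $\Sigma^F$ extended with the following $3$-cells: each equation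 of $E_\Delta$ in both directions, and $\Phi(\alpha)$ for every $\alpha\in\overline S\cup R$. A proof from $f$ to $g$ in $\Sigma^K$ is a path in its reduction graph, i.e. a finite (possibly empty) sequence of steps of the form $k\circ(Y\otimes s_2(\alpha)\otimes Z)\circ h\to k\circ(Y\otimes t_2(\alpha)\otimes Z)\circ h$, where $\alpha:s_2(\alpha)\to t_2(\alpha)$ is a $3$-cell of $\Sigma^K$, $Y,Z$ are $1$-arrows and $h,k$ are $2$-arrows. A complete proof of $f:X\to Y$ is a proof from $\top\circ\epsilon_X$ to $f$. *)

theory Defs
  imports Main "HOL-Library.Product_Order"
begin

section \<open>Two-sorted terms and SKS proofs\<close>

datatype tsort = At | Fm

text \<open>
  Variable indices start at 0: \<open>AVar k\<close> and \<open>FVar k\<close> stand for the variables written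
  \<open>a\<close> and \<open>x\<close> with index \<open>k + 1\<close>.
\<close>

datatype aterm = AVar nat | ANu aterm

datatype fterm =
    FVar nat
  | FIota aterm
  | FTop
  | FBot
  | FAnd fterm fterm (infixr \<open>\<^bold>\<and>\<close> 70)
  | FOr fterm fterm (infixr \<open>\<^bold>\<or>\<close> 65)

datatype trm = TA aterm | TF fterm

type_synonym family = "trm list"

fun sort_of :: "trm \<Rightarrow> tsort" where
  "sort_of (TA a) = At"
| "sort_of (TF x) = Fm"

text \<open>A sorted substitution is a pair of functions, one for each sort of variables.\<close>

fun asubst :: "(nat \<Rightarrow> aterm) \<Rightarrow> aterm \<Rightarrow> aterm" where
  "asubst \<sigma> (AVar k) = \<sigma> k"
| "asubst \<sigma> (ANu a) = ANu (asubst \<sigma> a)"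

fun fsubst :: "(nat \<Rightarrow> aterm) \<Rightarrow> (nat \<Rightarrow> fterm) \<Rightarrow> fterm \<Rightarrow> fterm" where
  "fsubst \<sigma> \<rho> (FVar k) = \<rho> k"
| "fsubst \<sigma> \<rho> (FIota a) = FIota (asubst \<sigma> a)"
| "fsubst \<sigma> \<rho> FTop = FTop"
| "fsubst \<sigma> \<rho> FBot = FBot"
| "fsubst \<sigma> \<rho> (x \<^bold>\<and> y) = fsubst \<sigma> \<rho> x \<^bold>\<and> fsubst \<sigma> \<rho> y"
| "fsubst \<sigma> \<rho> (x \<^bold>\<or> y) = fsubst \<sigma> \<rho> x \<^bold>\<or> fsubst \<sigma> \<rho> y"

fun tsubst :: "(nat \<Rightarrow> aterm) \<Rightarrow> (nat \<Rightarrow> fterm) \<Rightarrow> trm \<Rightarrow> trm" where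
  "tsubst \<sigma> \<rho> (TA a) = TA (asubst \<sigma> a)"
| "tsubst \<sigma> \<rho> (TF x) = TF (fsubst \<sigma> \<rho> x)"

type_synonym rule = "trm \<times> trm"

definition S_rules :: "rule set" where
  "S_rules =
    {(TF ((FVar 0 \<^bold>\<and> FVar 1) \<^bold>\<and> FVar 2), TF (FVar 0 \<^bold>\<and> (FVar 1 \<^bold>\<and> FVar 2))),
     (TF ((FVar 0 \<^bold>\<or> FVar 1) \<^bold>\<or> FVar 2), TF (FVar 0 \<^bold>\<or> (FVar 1 \<^bold>\<or> FVar 2))),
     (TF (FVar 0 \<^bold>\<and> FVar 1), TF (FVar 1 \<^bold>\<and> FVar 0)),
     (TF (FVar 0 \<^bold>\<or> FVar 1), TF (FVar 1 \<^bold>\<or> FVar 0)),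
     (TF (FTop \<^bold>\<and> FVar 0), TF (FVar 0)),
     (TF (FBot \<^bold>\<or> FVar 0), TF (FVar 0)),
     (TF (FBot \<^bold>\<and> FBot), TF FBot),
     (TF (FTop \<^bold>\<or> FTop), TF FTop),
     (TA (ANu (ANu (AVar 0))), TA (AVar 0))}"

definition S_bar_rules :: "rule set" where
  "S_bar_rules = S_rules \<union> S_rules\<inverse>"

definition R_rules :: "rule set" where
  "R_rules =
    {(TF FTop, TF (FIota (AVar 0) \<^bold>\<or> FIota (ANu (AVar 0)))),
     (TF (FIota (AVar 0) \<^bold>\<and> FIota (ANu (AVar 0))), TF FBot),
     (TF ((FVar 0 \<^bold>\<or> FVar 1) \<^bold>\<and> FVar 2), TF (FVar 0 \<^bold>\<or> (FVar 1 \<^bold>\<and> FVar 2))),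
     (TF ((FVar 0 \<^bold>\<and> FVar 1) \<^bold>\<or> (FVar 2 \<^bold>\<and> FVar 3)),
        TF ((FVar 0 \<^bold>\<or> FVar 2) \<^bold>\<and> (FVar 1 \<^bold>\<or> FVar 3))),
     (TF FBot, TF (FIota (AVar 0))),
     (TF (FIota (AVar 0)), TF FTop),
     (TF (FIota (AVar 0) \<^bold>\<or> FIota (AVar 0)), TF (FIota (AVar 0))),
     (TF (FIota (AVar 0)), TF (FIota (AVar 0) \<^bold>\<and> FIota (AVar 0)))}"

definition SKS_rules :: "rule set" where
  "SKS_rules = R_rules \<union> S_bar_rules"

text \<open>
  One application of a rule under a one-hole context; the last six clauses build the context,
  one constructor at a time, with the hole in either argument of a binary constructor.
\<close>

inductive term_step :: "rule \<Rightarrow> trm \<Rightarrow> trm \<Rightarrow> bool" for \<alpha> :: rule where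
  root: "term_step \<alpha> (tsubst \<sigma> \<rho> (fst \<alpha>)) (tsubst \<sigma> \<rho> (snd \<alpha>))"
| nu: "term_step \<alpha> (TA a) (TA b) \<Longrightarrow> term_step \<alpha> (TA (ANu a)) (TA (ANu b))"
| iota: "term_step \<alpha> (TA a) (TA b) \<Longrightarrow> term_step \<alpha> (TF (FIota a)) (TF (FIota b))"
| and_left: "term_step \<alpha> (TF x) (TF y) \<Longrightarrow> term_step \<alpha> (TF (x \<^bold>\<and> z)) (TF (y \<^bold>\<and> z))"
| and_right: "term_step \<alpha> (TF x) (TF y) \<Longrightarrow> term_step \<alpha> (TF (z \<^bold>\<and> x)) (TF (z \<^bold>\<and> y))"
| or_left: "term_step \<alpha> (TF x) (TF y) \<Longrightarrow> term_step \<alpha> (TF (x \<^bold>\<or> z)) (TF (y \<^bold>\<or> z))"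
| or_right: "term_step \<alpha> (TF x) (TF y) \<Longrightarrow> term_step \<alpha> (TF (z \<^bold>\<or> x)) (TF (z \<^bold>\<or> y))"

definition family_step :: "rule \<Rightarrow> family \<Rightarrow> family \<Rightarrow> bool" where
  "family_step \<alpha> u v \<longleftrightarrow>
    (\<exists>p q s t. u = p @ [s] @ q \<and> v = p @ [t] @ q \<and> term_step \<alpha> s t)"

definition sks_proof :: "family \<Rightarrow> family \<Rightarrow> bool" where
  "sks_proof = (\<lambda>u v. \<exists>\<alpha>\<in>SKS_rules. family_step \<alpha> u v)\<^sup>*\<^sup>*"

definition complete_sks_proof :: "family \<Rightarrow> bool" where
  "complete_sks_proof u \<longleftrightarrow> sks_proof [TF FTop] u"


section \<open>The 2-category of families of terms\<close>

type_synonym word = "tsort list"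

text \<open>Pairs of natural numbers carry the product order.\<close>

definition word_sharp :: "word \<Rightarrow> nat \<times> nat" where
  "word_sharp X = (count_list X At, count_list X Fm)"

fun avars_a :: "aterm \<Rightarrow> nat set" where
  "avars_a (AVar k) = {k}"
| "avars_a (ANu a) = avars_a a"

fun avars_f :: "fterm \<Rightarrow> nat set" where
  "avars_f (FVar k) = {}"
| "avars_f (FIota a) = avars_a a"
| "avars_f FTop = {}"
| "avars_f FBot = {}"
| "avars_f (x \<^bold>\<and> y) = avars_f x \<union> avars_f y"
| "avars_f (x \<^bold>\<or> y) = avars_f x \<union> avars_f y"

fun fvars_f :: "fterm \<Rightarrow> nat set" where
  "fvars_f (FVar k) = {k}"
| "fvars_f (FIota a) = {}"
| "fvars_f FTop = {}"
| "fvars_f FBot = {}"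
| "fvars_f (x \<^bold>\<and> y) = fvars_f x \<union> fvars_f y"
| "fvars_f (x \<^bold>\<or> y) = fvars_f x \<union> fvars_f y"

fun avars :: "trm \<Rightarrow> nat set" where
  "avars (TA a) = avars_a a"
| "avars (TF x) = avars_f x"

fun fvars :: "trm \<Rightarrow> nat set" where
  "fvars (TA a) = {}"
| "fvars (TF x) = fvars_f x"

text \<open>The successor makes up for indices starting at 0.\<close>

definition sharp :: "family \<Rightarrow> nat \<times> nat" where
  "sharp u =
    (Max (insert 0 (\<Union>t\<in>set u. Suc ` avars t)), Max (insert 0 (\<Union>t\<in>set u. Suc ` fvars t)))"

definition is_T_arrow :: "word \<Rightarrow> family \<Rightarrow> word \<Rightarrow> bool" where
  "is_T_arrow X u Y \<longleftrightarrow> map sort_of u = Y \<and> sharp u \<le> word_sharp X"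

fun atoms_of :: "family \<Rightarrow> aterm list" where
  "atoms_of [] = []"
| "atoms_of (TA a # u) = a # atoms_of u"
| "atoms_of (TF x # u) = atoms_of u"

fun formulas_of :: "family \<Rightarrow> fterm list" where
  "formulas_of [] = []"
| "formulas_of (TA a # u) = formulas_of u"
| "formulas_of (TF x # u) = x # formulas_of u"

text \<open>The identity of a word: its variables, numbered from left to right within each sort.\<close>

fun T_id_from :: "nat \<Rightarrow> nat \<Rightarrow> word \<Rightarrow> family" where
  "T_id_from m n [] = []"
| "T_id_from m n (At # X) = TA (AVar m) # T_id_from (Suc m) n X"
| "T_id_from m n (Fm # X) = TF (FVar n) # T_id_from m (Suc n) X"

definition T_id :: "word \<Rightarrow> family" where
  "T_id X = T_id_from 0 0 X"

text \<open>Composition, in the order of function composition.\<close>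

definition T_comp :: "family \<Rightarrow> family \<Rightarrow> family" where
  "T_comp v u = map (tsubst ((!) (atoms_of u)) ((!) (formulas_of u))) v"

definition T_shift :: "word \<Rightarrow> family \<Rightarrow> family" where
  "T_shift X = map (tsubst (\<lambda>k. AVar (count_list X At + k)) (\<lambda>k. FVar (count_list X Fm + k)))"

text \<open>The first argument is the source of the left factor.\<close>

definition T_tensor :: "word \<Rightarrow> family \<Rightarrow> family \<Rightarrow> family" where
  "T_tensor X u v = u @ T_shift X v"


section \<open>The free strict monoidal category of circuits\<close>

datatype opr = OAnd | OOr | OTop | OBot | OIota | ONu

fun opr_src :: "opr \<Rightarrow> word" where
  "opr_src OAnd = [Fm, Fm]"
| "opr_src OOr = [Fm, Fm]"
| "opr_src OTop = []"
| "opr_src OBot = []"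
| "opr_src OIota = [At]"
| "opr_src ONu = [At]"

fun opr_tgt :: "opr \<Rightarrow> tsort" where
  "opr_tgt OAnd = Fm"
| "opr_tgt OOr = Fm"
| "opr_tgt OTop = Fm"
| "opr_tgt OBot = Fm"
| "opr_tgt OIota = Fm"
| "opr_tgt ONu = At"

datatype gen = Opr opr | Delta tsort | Eps tsort | Tau tsort tsort

fun gen_src :: "gen \<Rightarrow> word" where
  "gen_src (Opr \<phi>) = opr_src \<phi>"
| "gen_src (Delta X) = [X]"
| "gen_src (Eps X) = [X]"
| "gen_src (Tau X Y) = [X, Y]"

fun gen_tgt :: "gen \<Rightarrow> word" where
  "gen_tgt (Opr \<phi>) = [opr_tgt \<phi>]"
| "gen_tgt (Delta X) = [X, X]"
| "gen_tgt (Eps X) = []"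
| "gen_tgt (Tau X Y) = [Y, X]"

text \<open>
  A 2-arrow is a class of composable expressions modulo the axioms of strict monoidal categories.
  \<open>DComp g f\<close> is \<open>f\<close> followed by \<open>g\<close>.
\<close>

datatype diag = DId word | DGen gen | DComp diag diag | DTensor diag diag

fun dsrc :: "diag \<Rightarrow> word" where
  "dsrc (DId X) = X"
| "dsrc (DGen c) = gen_src c"
| "dsrc (DComp g f) = dsrc f"
| "dsrc (DTensor f g) = dsrc f @ dsrc g"

fun dtgt :: "diag \<Rightarrow> word" where
  "dtgt (DId X) = X"
| "dtgt (DGen c) = gen_tgt c"
| "dtgt (DComp g f) = dtgt g"
| "dtgt (DTensor f g) = dtgt f @ dtgt g"

fun wf_diag :: "diag \<Rightarrow> bool" where
  "wf_diag (DId X) \<longleftrightarrow> True"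
| "wf_diag (DGen c) \<longleftrightarrow> True"
| "wf_diag (DComp g f) \<longleftrightarrow> wf_diag g \<and> wf_diag f \<and> dtgt f = dsrc g"
| "wf_diag (DTensor f g) \<longleftrightarrow> wf_diag f \<and> wf_diag g"

inductive deq :: "diag \<Rightarrow> diag \<Rightarrow> bool" where
  deq_refl: "wf_diag f \<Longrightarrow> deq f f"
| deq_sym: "deq f g \<Longrightarrow> deq g f"
| deq_trans: "deq f g \<Longrightarrow> deq g h \<Longrightarrow> deq f h"
| deq_comp: "deq g g' \<Longrightarrow> deq f f' \<Longrightarrow> dtgt f = dsrc g \<Longrightarrow> deq (DComp g f) (DComp g' f')"
| deq_tensor: "deq f f' \<Longrightarrow> deq g g' \<Longrightarrow> deq (DTensor f g) (DTensor f' g')"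
| deq_comp_assoc: "wf_diag (DComp h (DComp g f)) \<Longrightarrow>
    deq (DComp h (DComp g f)) (DComp (DComp h g) f)"
| deq_id_right: "wf_diag f \<Longrightarrow> deq (DComp f (DId (dsrc f))) f"
| deq_id_left: "wf_diag f \<Longrightarrow> deq (DComp (DId (dtgt f)) f) f"
| deq_tensor_assoc: "wf_diag (DTensor f (DTensor g h)) \<Longrightarrow>
    deq (DTensor f (DTensor g h)) (DTensor (DTensor f g) h)"
| deq_unit_right: "wf_diag f \<Longrightarrow> deq (DTensor f (DId [])) f"
| deq_unit_left: "wf_diag f \<Longrightarrow> deq (DTensor (DId []) f) f"
| deq_tensor_id: "deq (DTensor (DId X) (DId Y)) (DId (X @ Y))"
| deq_interchange: "wf_diag (DComp g f) \<Longrightarrow> wf_diag (DComp g' f') \<Longrightarrow>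
    deq (DComp (DTensor g g') (DTensor f f')) (DTensor (DComp g f) (DComp g' f'))"

lemma deq_wf: "deq f g \<Longrightarrow> wf_diag f \<and> wf_diag g \<and> dsrc f = dsrc g \<and> dtgt f = dtgt g"
  by (induction rule: deq.induct) auto

quotient_type circuit = diag / partial: deq
proof (rule part_equivpI)
  show "\<exists>f. deq f f"
    by (rule exI[of _ "DId []"]) (simp add: deq_refl)
  show "symp deq"
    by (simp add: sympI deq_sym)
  show "transp deq"
    by (blast intro: transpI deq_trans)
qed

lift_definition csrc :: "circuit \<Rightarrow> word" is dsrc
  by (simp add: deq_wf)

lift_definition ctgt :: "circuit \<Rightarrow> word" is dtgt
  by (simp add: deq_wf)

lift_definition ide :: "word \<Rightarrow> circuit" is DId
  by (simp add: deq_refl)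

lift_definition cgen :: "gen \<Rightarrow> circuit" is DGen
  by (simp add: deq_refl)

text \<open>Composition is total; its value is irrelevant when \<open>g\<close> and \<open>f\<close> are not composable.\<close>

lift_definition ccomp :: "circuit \<Rightarrow> circuit \<Rightarrow> circuit" (infixr \<open>\<odot>\<close> 55)
  is "\<lambda>g f. if dtgt f = dsrc g then DComp g f else DId []"
  by (auto simp: deq_wf intro: deq_comp deq_refl)

lift_definition ctensor :: "circuit \<Rightarrow> circuit \<Rightarrow> circuit" (infixr \<open>\<otimes>\<close> 70) is DTensor
  by (rule deq_tensor)


section \<open>The projection\<close>

fun gen_proj :: "gen \<Rightarrow> family" where
  "gen_proj (Opr OAnd) = [TF (FVar 0 \<^bold>\<and> FVar 1)]"
| "gen_proj (Opr OOr) = [TF (FVar 0 \<^bold>\<or> FVar 1)]"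
| "gen_proj (Opr OTop) = [TF FTop]"
| "gen_proj (Opr OBot) = [TF FBot]"
| "gen_proj (Opr OIota) = [TF (FIota (AVar 0))]"
| "gen_proj (Opr ONu) = [TA (ANu (AVar 0))]"
| "gen_proj (Delta At) = [TA (AVar 0), TA (AVar 0)]"
| "gen_proj (Delta Fm) = [TF (FVar 0), TF (FVar 0)]"
| "gen_proj (Eps X) = []"
| "gen_proj (Tau At At) = [TA (AVar 1), TA (AVar 0)]"
| "gen_proj (Tau At Fm) = [TF (FVar 0), TA (AVar 0)]"
| "gen_proj (Tau Fm At) = [TA (AVar 0), TF (FVar 0)]"
| "gen_proj (Tau Fm Fm) = [TF (FVar 1), TF (FVar 0)]"

fun diag_proj :: "diag \<Rightarrow> family" where
  "diag_proj (DId X) = T_id X"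
| "diag_proj (DGen c) = gen_proj c"
| "diag_proj (DComp g f) = T_comp (diag_proj g) (diag_proj f)"
| "diag_proj (DTensor f g) = T_tensor (dsrc f) (diag_proj f) (diag_proj g)"

subsection \<open>Functoriality\<close>

lemma asubst_cong: "(\<And>k. k \<in> avars_a a \<Longrightarrow> \<sigma> k = \<sigma>' k) \<Longrightarrow> asubst \<sigma> a = asubst \<sigma>' a"
  by (induction a) auto

lemma fsubst_cong:
  "(\<And>k. k \<in> avars_f x \<Longrightarrow> \<sigma> k = \<sigma>' k) \<Longrightarrow> (\<And>k. k \<in> fvars_f x \<Longrightarrow> \<rho> k = \<rho>' k) \<Longrightarrow>
    fsubst \<sigma> \<rho> x = fsubst \<sigma>' \<rho>' x"
  by (induction x) (auto intro: asubst_cong)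

lemma tsubst_cong:
  "(\<And>k. k \<in> avars t \<Longrightarrow> \<sigma> k = \<sigma>' k) \<Longrightarrow> (\<And>k. k \<in> fvars t \<Longrightarrow> \<rho> k = \<rho>' k) \<Longrightarrow>
    tsubst \<sigma> \<rho> t = tsubst \<sigma>' \<rho>' t"
  by (cases t) (auto intro: asubst_cong fsubst_cong)

lemma asubst_asubst: "asubst \<sigma> (asubst \<tau> a) = asubst (\<lambda>k. asubst \<sigma> (\<tau> k)) a"
  by (induction a) auto

lemma fsubst_fsubst:
  "fsubst \<sigma> \<rho> (fsubst \<tau> \<mu> x) = fsubst (\<lambda>k. asubst \<sigma> (\<tau> k)) (\<lambda>k. fsubst \<sigma> \<rho> (\<mu> k)) x"
  by (induction x) (auto simp: asubst_asubst)

lemma tsubst_tsubst: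
  "tsubst \<sigma> \<rho> (tsubst \<tau> \<mu> t) = tsubst (\<lambda>k. asubst \<sigma> (\<tau> k)) (\<lambda>k. fsubst \<sigma> \<rho> (\<mu> k)) t"
  by (cases t) (auto simp: asubst_asubst fsubst_fsubst)

lemma asubst_AVar [simp]: "asubst AVar a = a"
  by (induction a) auto

lemma fsubst_Var [simp]: "fsubst AVar FVar x = x"
  by (induction x) auto

lemma tsubst_Var [simp]: "tsubst AVar FVar t = t"
  by (cases t) auto

lemma sort_of_tsubst [simp]: "sort_of (tsubst \<sigma> \<rho> t) = sort_of t"
  by (cases t) auto

lemma avars_a_asubst: "avars_a (asubst \<sigma> a) = (\<Union>k\<in>avars_a a. avars_a (\<sigma> k))"
  by (induction a) auto

lemma vars_fsubst:
  "avars_f (fsubst \<sigma> \<rho> x) = (\<Union>k\<in>avars_f x. avars_a (\<sigma> k)) \<union> (\<Union>k\<in>fvars_f x. avars_f (\<rho> k))"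
  "fvars_f (fsubst \<sigma> \<rho> x) = (\<Union>k\<in>fvars_f x. fvars_f (\<rho> k))"
  by (induction x) (auto simp: avars_a_asubst)

lemma vars_tsubst:
  "avars (tsubst \<sigma> \<rho> t) = (\<Union>k\<in>avars t. avars_a (\<sigma> k)) \<union> (\<Union>k\<in>fvars t. avars_f (\<rho> k))"
  "fvars (tsubst \<sigma> \<rho> t) = (\<Union>k\<in>fvars t. fvars_f (\<rho> k))"
  by (cases t; simp add: avars_a_asubst vars_fsubst)+

lemma finite_vars: "finite (avars t)" "finite (fvars t)"
proof -
  have a: "finite (avars_a a)" for a
    by (induction a) auto
  have "finite (avars_f x)" "finite (fvars_f x)" for x
    by (induction x) (auto simp: a)
  then show "finite (avars t)" "finite (fvars t)"
    by (cases t; simp add: a)+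
qed

lemma sharp_le_iff:
  "sharp u \<le> (m, n) \<longleftrightarrow> (\<forall>t\<in>set u. (\<forall>k\<in>avars t. k < m) \<and> (\<forall>k\<in>fvars t. k < n))"
  by (auto simp: sharp_def finite_vars Suc_le_eq)

lemma is_T_arrow_iff:
  "is_T_arrow X u Y \<longleftrightarrow> map sort_of u = Y \<and>
    (\<forall>t\<in>set u. (\<forall>k\<in>avars t. k < count_list X At) \<and> (\<forall>k\<in>fvars t. k < count_list X Fm))"
  by (simp add: is_T_arrow_def word_sharp_def sharp_le_iff)

lemma set_atoms_of: "a \<in> set (atoms_of u) \<longleftrightarrow> TA a \<in> set u"
  by (induction u rule: atoms_of.induct) auto

lemma set_formulas_of: "x \<in> set (formulas_of u) \<longleftrightarrow> TF x \<in> set u"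
  by (induction u rule: formulas_of.induct) auto

lemma length_atoms_of: "length (atoms_of u) = count_list (map sort_of u) At"
  by (induction u rule: atoms_of.induct) auto

lemma length_formulas_of: "length (formulas_of u) = count_list (map sort_of u) Fm"
  by (induction u rule: formulas_of.induct) auto

lemma atoms_of_append [simp]: "atoms_of (u @ v) = atoms_of u @ atoms_of v"
  by (induction u rule: atoms_of.induct) auto

lemma formulas_of_append [simp]: "formulas_of (u @ v) = formulas_of u @ formulas_of v"
  by (induction u rule: formulas_of.induct) auto

lemma atoms_of_map: "atoms_of (map (tsubst \<sigma> \<rho>) u) = map (asubst \<sigma>) (atoms_of u)"
  by (induction u rule: atoms_of.induct) auto

lemma formulas_of_map: "formulas_of (map (tsubst \<sigma> \<rho>) u) = map (fsubst \<sigma> \<rho>) (formulas_of u)"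
  by (induction u rule: formulas_of.induct) auto

lemma atoms_of_T_id: "atoms_of (T_id_from m n X) = map AVar [m..<m + count_list X At]"
  by (induction m n X rule: T_id_from.induct) (auto simp: upt_conv_Cons simp del: upt_Suc)

lemma formulas_of_T_id: "formulas_of (T_id_from m n X) = map FVar [n..<n + count_list X Fm]"
  by (induction m n X rule: T_id_from.induct) (auto simp: upt_conv_Cons simp del: upt_Suc)

lemma sorts_T_id: "map sort_of (T_id_from m n X) = X"
  by (induction m n X rule: T_id_from.induct) auto

lemma vars_T_id:
  "t \<in> set (T_id_from m n X) \<Longrightarrow>
    (\<forall>k\<in>avars t. k < m + count_list X At) \<and> (\<forall>k\<in>fvars t. k < n + count_list X Fm)"
  by (induction m n X rule: T_id_from.induct) fastforce+

lemma T_id_append: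
  "T_id_from m n (X @ Y) =
    T_id_from m n X @ T_id_from (m + count_list X At) (n + count_list X Fm) Y"
  by (induction m n X rule: T_id_from.induct) auto

lemma T_id_shift:
  "map (tsubst (\<lambda>k. AVar (i + k)) (\<lambda>k. FVar (j + k))) (T_id_from m n X) =
    T_id_from (i + m) (j + n) X"
  by (induction m n X rule: T_id_from.induct) auto

lemma T_id_subst:
  "map (tsubst ((!) (as @ atoms_of u)) ((!) (xs @ formulas_of u)))
     (T_id_from (length as) (length xs) (map sort_of u)) = u"
proof (induction u arbitrary: as xs)
  case Nil
  then show ?case by simp
next
  case (Cons t u)
  show ?case
  proof (cases t)
    case (TA a)
    then show ?thesis using Cons[of "as @ [a]" xs] by (simp add: nth_append)
  next
    case (TF x)
    then show ?thesis using Cons[of as "xs @ [x]"] by (simp add: nth_append)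
  qed
qed

lemma T_comp_id_left: "map sort_of u = Y \<Longrightarrow> T_comp (T_id Y) u = u"
  using T_id_subst[of "[]" u "[]"] by (simp add: T_comp_def T_id_def)

lemma T_comp_id_right:
  assumes "is_T_arrow X u Y"
  shows "T_comp u (T_id X) = u"
proof -
  have "tsubst ((!) (map AVar [0..<count_list X At])) ((!) (map FVar [0..<count_list X Fm])) t
      = tsubst AVar FVar t" if "t \<in> set u" for t
    using assms that by (intro tsubst_cong) (auto simp: is_T_arrow_iff)
  then show ?thesis
    by (simp add: T_comp_def T_id_def atoms_of_T_id formulas_of_T_id map_idI)
qed

lemma T_comp_assoc:
  assumes "is_T_arrow X u Y" "is_T_arrow Y v Z" "is_T_arrow Z w W"
  shows "T_comp w (T_comp v u) = T_comp (T_comp w v) u"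
  using assms
  by (auto simp: T_comp_def atoms_of_map formulas_of_map tsubst_tsubst is_T_arrow_iff
      length_atoms_of length_formulas_of intro!: tsubst_cong)

lemma is_T_arrow_comp:
  assumes u: "is_T_arrow X u Y" and v: "is_T_arrow Y v Z"
  shows "is_T_arrow X (T_comp v u) Z"
proof -
  have "TA (atoms_of u ! k) \<in> set u" if "k < count_list Y At" for k
    using that u by (metis is_T_arrow_def length_atoms_of nth_mem set_atoms_of)
  then have a: "\<forall>j\<in>avars_a (atoms_of u ! k). j < count_list X At" if "k < count_list Y At" for k
    using that u by (fastforce simp: is_T_arrow_iff)
  have "TF (formulas_of u ! k) \<in> set u" if "k < count_list Y Fm" for k
    using that u by (metis is_T_arrow_def length_formulas_of nth_mem set_formulas_of)
  then have f: "(\<forall>j\<in>avars_f (formulas_of u ! k). j < count_list X At) \<and>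
      (\<forall>j\<in>fvars_f (formulas_of u ! k). j < count_list X Fm)" if "k < count_list Y Fm" for k
    using that u by (fastforce simp: is_T_arrow_iff)
  show ?thesis
    using v a f by (fastforce simp: is_T_arrow_iff T_comp_def vars_tsubst comp_def)
qed

lemma is_T_arrow_tensor:
  assumes "is_T_arrow X u Y" "is_T_arrow X' v Y'"
  shows "is_T_arrow (X @ X') (T_tensor X u v) (Y @ Y')"
  using assms by (fastforce simp: is_T_arrow_iff T_tensor_def T_shift_def vars_tsubst comp_def)

lemma is_T_arrow_id: "is_T_arrow X (T_id X) X"
  using vars_T_id[of _ 0 0 X] by (auto simp: is_T_arrow_iff T_id_def sorts_T_id)

lemma is_T_arrow_gen: "is_T_arrow (gen_src c) (gen_proj c) (gen_tgt c)"
  by (cases c rule: gen_proj.cases) (auto simp: is_T_arrow_iff)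

lemma is_T_arrow_diag: "wf_diag f \<Longrightarrow> is_T_arrow (dsrc f) (diag_proj f) (dtgt f)"
  by (induction f)
    (auto simp: is_T_arrow_id is_T_arrow_gen intro: is_T_arrow_comp is_T_arrow_tensor)

lemma T_tensor_interchange:
  assumes u: "is_T_arrow X u Y" and v: "is_T_arrow Y v Z"
    and u': "is_T_arrow X' u' Y'" and v': "is_T_arrow Y' v' Z'"
  shows "T_comp (T_tensor Y v v') (T_tensor X u u') = T_tensor X (T_comp v u) (T_comp v' u')"
  using assms
  by (auto simp: T_comp_def T_tensor_def T_shift_def atoms_of_map formulas_of_map tsubst_tsubst
      is_T_arrow_iff length_atoms_of length_formulas_of nth_append intro!: tsubst_cong)

lemma T_tensor_assoc:
  "T_tensor X u (T_tensor Y v w) = T_tensor (X @ Y) (T_tensor X u v) w"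
  by (simp add: T_tensor_def T_shift_def tsubst_tsubst add.assoc)

lemma T_tensor_id: "T_tensor X (T_id X) (T_id Y) = T_id (X @ Y)"
  by (simp add: T_tensor_def T_shift_def T_id_def T_id_append T_id_shift)

lemma diag_proj_deq: "deq f g \<Longrightarrow> diag_proj f = diag_proj g"
proof (induction rule: deq.induct)
  case (deq_comp_assoc h g f)
  then show ?case
    using is_T_arrow_diag[of f] is_T_arrow_diag[of g] is_T_arrow_diag[of h]
    by (auto intro: T_comp_assoc)
next
  case (deq_id_right f)
  then show ?case using is_T_arrow_diag[of f] by (auto intro: T_comp_id_right)
next
  case (deq_id_left f)
  then show ?case using is_T_arrow_diag[of f] by (auto simp: is_T_arrow_def T_comp_id_left)
next
  case (deq_unit_left f)
  then show ?case by (simp add: T_tensor_def T_shift_def T_id_def map_idI)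
next
  case (deq_unit_right f)
  then show ?case by (simp add: T_tensor_def T_shift_def T_id_def)
next
  case (deq_interchange g f g' f')
  then show ?case
    using is_T_arrow_diag[of f] is_T_arrow_diag[of g] is_T_arrow_diag[of f'] is_T_arrow_diag[of g']
    by (auto intro: T_tensor_interchange)
qed (auto simp: T_tensor_assoc T_tensor_id deq_wf)

lift_definition proj :: "circuit \<Rightarrow> family" is diag_proj
  by (rule diag_proj_deq)


section \<open>Resource relations and the convergent rules\<close>

abbreviation \<delta> :: "tsort \<Rightarrow> circuit" where
  "\<delta> X \<equiv> cgen (Delta X)"

abbreviation \<epsilon> :: "tsort \<Rightarrow> circuit" where
  "\<epsilon> X \<equiv> cgen (Eps X)"

abbreviation \<tau> :: "tsort \<Rightarrow> tsort \<Rightarrow> circuit" where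
  "\<tau> X Y \<equiv> cgen (Tau X Y)"

abbreviation opc :: "opr \<Rightarrow> circuit" where
  "opc \<phi> \<equiv> cgen (Opr \<phi>)"

abbreviation ide1 :: "tsort \<Rightarrow> circuit" where
  "ide1 X \<equiv> ide [X]"

text \<open>
  The shorthands for \<open>\<tau>\<close>, \<open>\<delta>\<close> and \<open>\<epsilon>\<close> on words; \<open>\<tau>\<close> and \<open>\<delta>\<close> are only used below on the source
  words of operators, that is on the empty word, single letters and \<open>[Fm, Fm]\<close>.
\<close>

fun tau_left :: "word \<Rightarrow> tsort \<Rightarrow> circuit" where
  "tau_left [] X = ide [X]"
| "tau_left [Y] X = \<tau> Y X"
| "tau_left (Y # Z # W) X = (\<tau> Y X \<otimes> ide (Z # W)) \<odot> (ide1 Y \<otimes> tau_left (Z # W) X)"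

fun tau_right :: "tsort \<Rightarrow> word \<Rightarrow> circuit" where
  "tau_right X [] = ide [X]"
| "tau_right X [Y] = \<tau> X Y"
| "tau_right X (Y # Z # W) = (ide1 Y \<otimes> tau_right X (Z # W)) \<odot> (\<tau> X Y \<otimes> ide (Z # W))"

fun delta_word :: "word \<Rightarrow> circuit" where
  "delta_word [] = ide []"
| "delta_word [X] = \<delta> X"
| "delta_word (X # Y # W) =
    (ide1 X \<otimes> tau_right X (Y # W) \<otimes> ide (Y # W)) \<odot> (\<delta> X \<otimes> delta_word (Y # W))"

fun eps_word :: "word \<Rightarrow> circuit" where
  "eps_word [] = ide []"
| "eps_word (X # W) = \<epsilon> X \<otimes> eps_word W"

inductive E_Delta :: "circuit \<Rightarrow> circuit \<Rightarrow> bool" where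
  E_coassoc: "E_Delta ((ide1 X \<otimes> \<delta> X) \<odot> \<delta> X) ((\<delta> X \<otimes> ide1 X) \<odot> \<delta> X)"
| E_cocomm: "E_Delta (\<tau> X X \<odot> \<delta> X) (\<delta> X)"
| E_counit: "E_Delta ((\<epsilon> X \<otimes> ide1 X) \<odot> \<delta> X) (ide1 X)"
| E_tau_tau: "E_Delta (\<tau> Y X \<odot> \<tau> X Y) (ide1 X \<otimes> ide1 Y)"
| E_delta_tau: "E_Delta ((ide1 Y \<otimes> \<delta> X) \<odot> \<tau> X Y)
    ((\<tau> X Y \<otimes> ide1 X) \<odot> (ide1 X \<otimes> \<tau> X Y) \<odot> (\<delta> X \<otimes> ide1 Y))"
| E_eps_tau: "E_Delta ((ide1 Y \<otimes> \<epsilon> X) \<odot> \<tau> X Y) (\<epsilon> X \<otimes> ide1 Y)"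
| E_Yang_Baxter: "E_Delta
    ((ide1 Z \<otimes> \<tau> X Y) \<odot> (\<tau> X Z \<otimes> ide1 Y) \<odot> (ide1 X \<otimes> \<tau> Y Z))
    ((\<tau> Y Z \<otimes> ide1 X) \<odot> (ide1 Y \<otimes> \<tau> X Z) \<odot> (\<tau> X Y \<otimes> ide1 Z))"
| E_tau_opr: "E_Delta (\<tau> (opr_tgt \<phi>) X \<odot> (opc \<phi> \<otimes> ide1 X))
    ((ide1 X \<otimes> opc \<phi>) \<odot> tau_left (opr_src \<phi>) X)"
| E_delta_opr: "E_Delta (\<delta> (opr_tgt \<phi>) \<odot> opc \<phi>) ((opc \<phi> \<otimes> opc \<phi>) \<odot> delta_word (opr_src \<phi>))"
| E_eps_opr: "E_Delta (\<epsilon> (opr_tgt \<phi>) \<odot> opc \<phi>) (eps_word (opr_src \<phi>))"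

inductive R_Delta :: "circuit \<Rightarrow> circuit \<Rightarrow> bool" where
  R_E: "E_Delta f g \<Longrightarrow> R_Delta f g"
| R_cocomm: "R_Delta ((ide1 X \<otimes> \<tau> X X) \<odot> (\<delta> X \<otimes> ide1 X) \<odot> \<delta> X) ((\<delta> X \<otimes> ide1 X) \<odot> \<delta> X)"
| R_counit: "R_Delta ((ide1 X \<otimes> \<epsilon> X) \<odot> \<delta> X) (ide1 X)"
| R_delta_tau: "R_Delta ((ide1 Y \<otimes> \<tau> X Y) \<odot> (\<tau> X Y \<otimes> ide1 Y) \<odot> (ide1 X \<otimes> \<delta> Y))
    ((\<delta> Y \<otimes> ide1 X) \<odot> \<tau> X Y)"
| R_tau_delta_tau: "R_Delta ((ide1 Y \<otimes> \<tau> Y X) \<odot> (\<delta> Y \<otimes> ide1 X) \<odot> \<tau> X Y)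
    ((\<tau> X Y \<otimes> ide1 Y) \<odot> (ide1 X \<otimes> \<delta> Y))"
| R_eps_tau: "R_Delta ((\<epsilon> Y \<otimes> ide1 X) \<odot> \<tau> X Y) (ide1 X \<otimes> \<epsilon> Y)"
| R_tau_opr: "R_Delta (\<tau> X (opr_tgt \<phi>) \<odot> (ide1 X \<otimes> opc \<phi>))
    ((opc \<phi> \<otimes> ide1 X) \<odot> tau_right X (opr_src \<phi>))"

definition circuit_step :: "(circuit \<Rightarrow> circuit \<Rightarrow> bool) \<Rightarrow> circuit \<Rightarrow> circuit \<Rightarrow> bool" where
  "circuit_step P f g \<longleftrightarrow>
    (\<exists>s t h k Y Z. P s t \<and>
      ctgt h = Y @ csrc s @ Z \<and> csrc k = Y @ ctgt s @ Z \<and>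
      f = k \<odot> (ide Y \<otimes> s \<otimes> ide Z) \<odot> h \<and>
      g = k \<odot> (ide Y \<otimes> t \<otimes> ide Z) \<odot> h)"

definition normal_form :: "circuit \<Rightarrow> bool" where
  "normal_form f \<longleftrightarrow> \<not> (\<exists>g. circuit_step R_Delta f g)"

text \<open>
  \<open>R_Delta\<close> is a convergent presentation and two parallel circuits are congruent iff they have the
  same projection, so for \<open>sharp u \<le> word_sharp X\<close> there is exactly one such circuit.
\<close>

definition Phi :: "word \<Rightarrow> family \<Rightarrow> circuit" where
  "Phi X u = (THE f. csrc f = X \<and> ctgt f = map sort_of u \<and> normal_form f \<and> proj f = u)"


section \<open>Proofs in the 3-polygraph\<close>

definition rule_word :: "rule \<Rightarrow> word" where
  "rule_word \<alpha> =
    (let (p, q) = sup (sharp [fst \<alpha>]) (sharp [snd \<alpha>]) in replicate p At @ replicate q Fm)"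

inductive K_cell :: "circuit \<Rightarrow> circuit \<Rightarrow> bool" where
  K_E: "E_Delta f g \<Longrightarrow> K_cell f g"
| K_E_inv: "E_Delta f g \<Longrightarrow> K_cell g f"
| K_rule: "\<alpha> \<in> S_bar_rules \<union> R_rules \<Longrightarrow>
    K_cell (Phi (rule_word \<alpha>) [fst \<alpha>]) (Phi (rule_word \<alpha>) [snd \<alpha>])"

definition K_proof :: "circuit \<Rightarrow> circuit \<Rightarrow> bool" where
  "K_proof = (circuit_step K_cell)\<^sup>*\<^sup>*"

definition complete_K_proof :: "circuit \<Rightarrow> bool" where
  "complete_K_proof f \<longleftrightarrow> K_proof (opc OTop \<odot> eps_word (csrc f)) f"

end

theory Submission
  imports Defs
begin

text \<open>
  Both directions rest on coherence: a circuit \<open>f\<close> from \<open>X\<close> is congruent to \<open>\<Phi>\<^sup>X(\<pi>(f))\<close>. Confluence of the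
  resource rules is not checked on critical pairs. Instead, a canonical circuit is attached to every
  family: erase the inputs that are not used, then produce the leaves of the terms from right to left,
  each one by moving an input, or a copy of it if it is needed again, to the right, and finally apply
  the operators. A generator placed below a canonical circuit gives a canonical circuit or a redex, so
  every normal form is canonical; a measure decreasing under rewriting provides normal forms.

  An SKS step is then replayed inside a circuit that computes the substitution of the step, applies the
  rule once and copies the result into the context. Conversely, a step in a circuit rewrites all copies
  of one subterm of the projection.
\<close>

section \<open>Algebra of circuits\<close>

text \<open>The shape of the canonical circuits is read off from the orientation of the rules.
  \<open>E_coassoc\<close> leaves left combs of copies, whose first duplication yields the rightmost
  copy, and \<open>E_Yang_Baxter\<close> lets the wire that ends rightmost cross first: hence the
  order from right to left. Erasers, copies and crossings rise through operators, and erasers also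
  through crossings: hence erasers come first and operators last. Canonical circuits are determined
  by their family, so normal forms are unique without comparing two reductions; termination serves
  only to reach one.

  For SKS proofs the obstacle is that \<open>Phi X\<close> sees only the variables of
  \<open>X\<close>, while a proof between families over \<open>X\<close> may introduce other
  variables and remove them again, for instance by \<top> \<rightarrow> \<iota>(a) \<or>
  \<iota>(\<nu>(a)). Such a proof must first be rewritten as one whose terms are all over
  \<open>X\<close>.\<close>

lemma deq_self [simp]: "deq f f \<longleftrightarrow> wf_diag f"
  using deq_wf deq_refl by blast

lemma csrc_simps [simp]: "csrc (ide X) = X" "csrc (cgen c) = gen_src c" "csrc (f \<otimes> g) = csrc f @ csrc g"
  by (transfer, simp)+

lemma ctgt_simps [simp]: "ctgt (ide X) = X" "ctgt (cgen c) = gen_tgt c" "ctgt (f \<otimes> g) = ctgt f @ ctgt g"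
  by (transfer, simp)+

lemma csrc_comp [simp]: "ctgt f = csrc g \<Longrightarrow> csrc (g \<odot> f) = csrc f"
  by transfer simp

lemma ctgt_comp [simp]: "ctgt f = csrc g \<Longrightarrow> ctgt (g \<odot> f) = ctgt g"
  by transfer simp

lemma comp_assoc: "ctgt f = csrc g \<Longrightarrow> ctgt g = csrc h \<Longrightarrow> (h \<odot> g) \<odot> f = h \<odot> g \<odot> f"
  by transfer (auto intro!: deq_sym[OF deq_comp_assoc])

lemma comp_ide_right [simp]: "csrc f = X \<Longrightarrow> f \<odot> ide X = f"
  by transfer (auto intro!: deq_id_right)

lemma comp_ide_left [simp]: "ctgt f = X \<Longrightarrow> ide X \<odot> f = f"
  by transfer (auto intro!: deq_id_left)

lemma tensor_assoc [simp]: "(f \<otimes> g) \<otimes> h = f \<otimes> g \<otimes> h"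
  by transfer (auto intro!: deq_sym[OF deq_tensor_assoc])

lemma tensor_unit [simp]: "f \<otimes> ide [] = f" "ide [] \<otimes> f = f"
  by (transfer, auto intro!: deq_unit_left deq_unit_right)+

lemma tensor_ide: "ide X \<otimes> ide Y = ide (X @ Y)"
  by transfer (rule deq_tensor_id)

lemma interchange:
  "ctgt f = csrc g \<Longrightarrow> ctgt f' = csrc g' \<Longrightarrow> (g \<otimes> g') \<odot> (f \<otimes> f') = (g \<odot> f) \<otimes> (g' \<odot> f')"
  by transfer (auto intro!: deq_interchange)

section \<open>Whiskered circuits and induction on generators\<close>

definition whisk :: "word \<Rightarrow> circuit \<Rightarrow> word \<Rightarrow> circuit" where
  "whisk Y f Z = ide Y \<otimes> f \<otimes> ide Z"

lemma csrc_whisk [simp]: "csrc (whisk Y f Z) = Y @ csrc f @ Z"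
  by (simp add: whisk_def)

lemma ctgt_whisk [simp]: "ctgt (whisk Y f Z) = Y @ ctgt f @ Z"
  by (simp add: whisk_def)

lemma whisk_Nil [simp]: "whisk [] f [] = f"
  by (simp add: whisk_def)

lemma whisk_ide [simp]: "whisk Y (ide X) Z = ide (Y @ X @ Z)"
  by (simp add: whisk_def tensor_ide)

lemma whisk_whisk [simp]: "whisk Y (whisk Y' f Z') Z = whisk (Y @ Y') f (Z' @ Z)"
  by (simp add: whisk_def flip: tensor_ide)

lemma whisk_comp: "ctgt f = csrc g \<Longrightarrow> whisk Y (g \<odot> f) Z = whisk Y g Z \<odot> whisk Y f Z"
  by (simp add: whisk_def interchange)

lemma tensor_ide_whisk: "f \<otimes> ide Z = whisk [] f Z" "ide Y \<otimes> f = whisk Y f []"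
  "ide Y \<otimes> f \<otimes> ide Z = whisk Y f Z"
  by (simp_all add: whisk_def)

lemma tensor_whisk_left: "f \<otimes> g = whisk [] f (ctgt g) \<odot> whisk (csrc f) g []"
  by (simp add: whisk_def interchange)

lemma tensor_whisk_right: "f \<otimes> g = whisk (ctgt f) g [] \<odot> whisk [] f (csrc g)"
  by (simp add: whisk_def interchange)

text \<open>Both sides are \<open>whisk Y (f \<otimes> ide Z \<otimes> g) V\<close>: circuits on
  disjoint wires may be applied in either order.\<close>

lemma whisk_exchange:
  "whisk Y f (Z @ ctgt g @ V) \<odot> whisk (Y @ csrc f @ Z) g V =
    whisk (Y @ ctgt f @ Z) g V \<odot> whisk Y f (Z @ csrc g @ V)"
proof -
  have "f \<otimes> ide Z \<otimes> g = whisk [] f (Z @ ctgt g) \<odot> whisk (csrc f @ Z) g []"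
    by (subst tensor_whisk_left) (simp add: whisk_def flip: tensor_ide)
  moreover have "f \<otimes> ide Z \<otimes> g = whisk (ctgt f @ Z) g [] \<odot> whisk [] f (Z @ csrc g)"
    by (subst tensor_whisk_right) (simp add: whisk_def flip: tensor_ide)
  ultimately have "whisk Y (whisk [] f (Z @ ctgt g) \<odot> whisk (csrc f @ Z) g []) V =
      whisk Y (whisk (ctgt f @ Z) g [] \<odot> whisk [] f (Z @ csrc g)) V"
    by simp
  then show ?thesis by (simp add: whisk_comp)
qed

lemma comp_assoc_ex: "ctgt f = csrc g \<Longrightarrow> ctgt g = csrc h \<Longrightarrow> h \<odot> (g \<odot> f) = (h \<odot> g) \<odot> f"
  by (simp add: comp_assoc)

text \<open>In a free strict monoidal category every 2-arrow is a sequence of single generators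
  acting beside identities. This replaces the tree structure of \<open>diag\<close>, which
  \<open>deq\<close> does not respect, by an induction that adds one generator at the
  target.\<close>

inductive sliced :: "circuit \<Rightarrow> bool" where
  sliced_ide: "sliced (ide X)"
| sliced_gen: "sliced f \<Longrightarrow> ctgt f = Y @ gen_src c @ Z \<Longrightarrow> sliced (whisk Y (cgen c) Z \<odot> f)"

lemma sliced_comp: "sliced g \<Longrightarrow> sliced f \<Longrightarrow> ctgt f = csrc g \<Longrightarrow> sliced (g \<odot> f)"
proof (induction arbitrary: f rule: sliced.induct)
  case (sliced_gen g Y c Z)
  then show ?case by (simp add: comp_assoc sliced.sliced_gen)
qed auto

lemma sliced_whisk: "sliced f \<Longrightarrow> sliced (whisk Y f Z)"
proof (induction rule: sliced.induct)
  case (sliced_gen f Y' c Z')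
  then show ?case
    using sliced.sliced_gen[of "whisk Y f Z" "Y @ Y'" c "Z' @ Z"]
    by (simp add: whisk_comp)
qed (simp add: sliced_ide)

lemma sliced: "sliced f"
proof (induction f rule: circuit.abs_induct)
  case (1 d)
  then have "wf_diag d" by (simp add: deq_wf)
  then show ?case
  proof (induction d)
    case (DId X)
    then show ?case using sliced_ide[of X] by (simp add: ide.abs_eq)
  next
    case (DGen c)
    have "sliced (whisk [] (cgen c) [] \<odot> ide (gen_src c))"
      by (rule sliced_gen) (simp_all add: sliced_ide)
    then show ?case by (simp flip: cgen.abs_eq)
  next
    case (DComp g f)
    then have "sliced (abs_circuit g \<odot> abs_circuit f)"
      by (intro sliced_comp) (auto simp: ctgt.abs_eq csrc.abs_eq deq_self)
    then show ?case using DComp by (simp add: ccomp.abs_eq deq_self)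
  next
    case (DTensor f g)
    then have "sliced (abs_circuit f \<otimes> abs_circuit g)"
      by (subst tensor_whisk_left) (auto intro!: sliced_comp sliced_whisk)
    then show ?case using DTensor by (simp add: ctensor.abs_eq deq_self)
  qed
qed

lemma circuit_induct [case_names ide gen]:
  assumes "\<And>X. P (ide X)"
    and "\<And>f Y c Z. P f \<Longrightarrow> ctgt f = Y @ gen_src c @ Z \<Longrightarrow> P (whisk Y (cgen c) Z \<odot> f)"
  shows "P f"
  using sliced[of f] by (induction rule: sliced.induct) (auto intro: assms)

section \<open>Termination\<close>

text \<open>
  A circuit is read as a network: a number flows down each wire (\<open>td\<close>, in two versions), another
  one flows up (\<open>bu\<close>), and each generator produces heat depending on the numbers at its ports.
  All numbers stand for their successors. In stage \<open>True\<close> the downward number is the size of the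
  term computed so far and all rules but \<open>E_coassoc\<close>, \<open>E_delta_tau\<close>, \<open>E_Yang_Baxter\<close> and
  \<open>R_delta_tau\<close> decrease the heat; those preserve it, and decrease the heat of stage \<open>False\<close>,
  where the downward number counts the crossings taken from left to right.
\<close>

fun gen_td :: "bool \<Rightarrow> gen \<Rightarrow> nat list \<Rightarrow> nat list" where
  "gen_td s (Opr \<phi>) x = [if s then sum_list x + length x else 0]"
| "gen_td s (Delta X) x = [x ! 0, x ! 0]"
| "gen_td s (Eps X) x = []"
| "gen_td s (Tau X Y) x = [x ! 1, if s then x ! 0 else Suc (x ! 0)]"

fun gen_bu :: "gen \<Rightarrow> nat list \<Rightarrow> nat list" where
  "gen_bu (Opr \<phi>) p = map (\<lambda>_. p ! 0) (opr_src \<phi>)"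
| "gen_bu (Delta X) p = [Suc (p ! 0 + p ! 1)]"
| "gen_bu (Eps X) p = [0]"
| "gen_bu (Tau X Y) p = [p ! 1, p ! 0]"

text \<open>In successors, the upward number of a copied wire is the sum over its copies, so
  products of port numbers do not see how copies are associated, nor whether a wire is copied before
  or after a crossing. In stage \<open>False\<close> the summand \<open>Suc (p ! 1)\<close> makes
  right combs hotter than left combs, the factor 2 pays for the second crossing created by
  \<open>E_delta_tau\<close>, and the constant 1 of a crossing is what \<open>R_delta_tau\<close>
  gains by merging two crossings. The factor \<open>x ! 1\<close> weights a crossing by what its
  right wire has crossed before, which drops under \<open>E_Yang_Baxter\<close>.\<close>

fun gen_heat :: "bool \<Rightarrow> gen \<Rightarrow> nat list \<Rightarrow> nat list \<Rightarrow> nat" where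
  "gen_heat s (Opr \<phi>) x p = 0"
| "gen_heat s (Delta X) x p =
    (if s then Suc (x ! 0) * Suc (x ! 0) * Suc (p ! 0) * Suc (p ! 1)
     else 2 * x ! 0 * Suc (p ! 0) * Suc (p ! 1) + Suc (p ! 1))"
| "gen_heat s (Eps X) x p = (if s then Suc (x ! 0) else 0)"
| "gen_heat s (Tau X Y) x p =
    (if s then Suc (x ! 0) * Suc (x ! 1) * Suc (p ! 0) * Suc (p ! 1)
     else Suc (x ! 1 * Suc (p ! 0) * Suc (p ! 1)))"

fun diag_td :: "bool \<Rightarrow> diag \<Rightarrow> nat list \<Rightarrow> nat list" where
  "diag_td s (DId X) x = x"
| "diag_td s (DGen c) x = gen_td s c x"
| "diag_td s (DComp g f) x = diag_td s g (diag_td s f x)"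
| "diag_td s (DTensor f g) x =
    diag_td s f (take (length (dsrc f)) x) @ diag_td s g (drop (length (dsrc f)) x)"

fun diag_bu :: "diag \<Rightarrow> nat list \<Rightarrow> nat list" where
  "diag_bu (DId X) p = p"
| "diag_bu (DGen c) p = gen_bu c p"
| "diag_bu (DComp g f) p = diag_bu f (diag_bu g p)"
| "diag_bu (DTensor f g) p =
    diag_bu f (take (length (dtgt f)) p) @ diag_bu g (drop (length (dtgt f)) p)"

fun diag_heat :: "bool \<Rightarrow> diag \<Rightarrow> nat list \<Rightarrow> nat list \<Rightarrow> nat" where
  "diag_heat s (DId X) x p = 0"
| "diag_heat s (DGen c) x p = gen_heat s c x p"
| "diag_heat s (DComp g f) x p =
    diag_heat s f x (diag_bu g p) + diag_heat s g (diag_td s f x) p"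
| "diag_heat s (DTensor f g) x p =
    diag_heat s f (take (length (dsrc f)) x) (take (length (dtgt f)) p) +
    diag_heat s g (drop (length (dsrc f)) x) (drop (length (dtgt f)) p)"

lemma length_diag_td:
  "wf_diag f \<Longrightarrow> length x = length (dsrc f) \<Longrightarrow> length (diag_td s f x) = length (dtgt f)"
proof (induction f arbitrary: x)
  case (DGen c)
  then show ?case by (cases c) auto
qed auto

lemma length_diag_bu:
  "wf_diag f \<Longrightarrow> length p = length (dtgt f) \<Longrightarrow> length (diag_bu f p) = length (dsrc f)"
proof (induction f arbitrary: p)
  case (DGen c)
  then show ?case by (cases c) auto
qed auto

lemma diag_td_deq:
  "deq f g \<Longrightarrow> length x = length (dsrc f) \<Longrightarrow> diag_td s f x = diag_td s g x"
proof (induction arbitrary: x rule: deq.induct)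
  case (deq_comp g g' f f')
  then have "length (diag_td s f' x) = length (dsrc g)"
    using length_diag_td[of f' x s] deq_wf[of f f'] by auto
  then show ?case using deq_comp deq_wf[of f f'] by auto
next
  case (deq_tensor f f' g g')
  then show ?case by (auto simp: deq_wf)
next
  case (deq_sym f g)
  then show ?case by (metis deq_wf)
next
  case (deq_trans f g h)
  then show ?case by (metis deq_wf)
next
  case (deq_interchange g f g' f')
  then show ?case by (auto simp: length_diag_td)
qed (auto simp: drop_take add.commute)

lemma diag_bu_deq:
  "deq f g \<Longrightarrow> length p = length (dtgt f) \<Longrightarrow> diag_bu f p = diag_bu g p"
proof (induction arbitrary: p rule: deq.induct)
  case (deq_comp g g' f f')
  then have "length (diag_bu g' p) = length (dtgt f)"
    using length_diag_bu[of g' p] deq_wf[of g g'] by auto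
  then show ?case using deq_comp deq_wf[of g g'] by auto
next
  case (deq_tensor f f' g g')
  then show ?case by (auto simp: deq_wf)
next
  case (deq_sym f g)
  then show ?case by (metis deq_wf)
next
  case (deq_trans f g h)
  then show ?case by (metis deq_wf)
next
  case (deq_interchange g f g' f')
  then show ?case by (auto simp: length_diag_bu)
qed (auto simp: drop_take add.commute)

lemma diag_heat_deq:
  "deq f g \<Longrightarrow> length x = length (dsrc f) \<Longrightarrow> length p = length (dtgt f) \<Longrightarrow>
    diag_heat s f x p = diag_heat s g x p"
proof (induction arbitrary: x p rule: deq.induct)
  case (deq_comp g g' f f')
  moreover have "diag_td s f x = diag_td s f' x" "diag_bu g p = diag_bu g' p"
    using deq_comp diag_td_deq diag_bu_deq by auto
  moreover have "length (diag_bu g' p) = length (dtgt f)" "length (diag_td s f' x) = length (dsrc g)"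
    using deq_comp length_diag_bu[of g' p] length_diag_td[of f' x s] deq_wf[of g g'] deq_wf[of f f']
    by auto
  ultimately show ?case by simp
next
  case (deq_tensor f f' g g')
  then show ?case by (auto simp: deq_wf)
next
  case (deq_sym f g)
  then show ?case by (metis deq_wf)
next
  case (deq_trans f g h)
  then show ?case by (metis deq_wf)
next
  case (deq_interchange g f g' f')
  then show ?case by (auto simp: length_diag_td length_diag_bu)
qed (auto simp: drop_take add.commute)

text \<open>\<open>deq\<close> preserves the flow only on lists that match the ports; the value
  \<open>[]\<close> elsewhere makes equivalent expressions give the same function.\<close>

lift_definition td :: "bool \<Rightarrow> circuit \<Rightarrow> nat list \<Rightarrow> nat list"
  is "\<lambda>s f x. if length x = length (dsrc f) then diag_td s f x else []"
  by (auto simp: deq_wf intro!: ext diag_td_deq)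

lift_definition bu :: "circuit \<Rightarrow> nat list \<Rightarrow> nat list"
  is "\<lambda>f p. if length p = length (dtgt f) then diag_bu f p else []"
  by (auto simp: deq_wf intro!: ext diag_bu_deq)

lift_definition heat :: "bool \<Rightarrow> circuit \<Rightarrow> nat list \<Rightarrow> nat list \<Rightarrow> nat"
  is "\<lambda>s f x p. if length x = length (dsrc f) \<and> length p = length (dtgt f)
      then diag_heat s f x p else 0"
  by (auto simp: deq_wf intro!: ext diag_heat_deq)

lemma td_simps [simp]:
  "length x = length X \<Longrightarrow> td s (ide X) x = x"
  "length x = length (gen_src c) \<Longrightarrow> td s (cgen c) x = gen_td s c x"
  "ctgt f = csrc g \<Longrightarrow> length x = length (csrc f) \<Longrightarrow> td s (g \<odot> f) x = td s g (td s f x)"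
  "length x = length (csrc f @ csrc g) \<Longrightarrow> td s (f \<otimes> g) x =
    td s f (take (length (csrc f)) x) @ td s g (drop (length (csrc f)) x)"
  by (transfer, auto simp: length_diag_td)+

lemma bu_simps [simp]:
  "length p = length X \<Longrightarrow> bu (ide X) p = p"
  "length p = length (gen_tgt c) \<Longrightarrow> bu (cgen c) p = gen_bu c p"
  "ctgt f = csrc g \<Longrightarrow> length p = length (ctgt g) \<Longrightarrow> bu (g \<odot> f) p = bu f (bu g p)"
  "length p = length (ctgt f @ ctgt g) \<Longrightarrow> bu (f \<otimes> g) p =
    bu f (take (length (ctgt f)) p) @ bu g (drop (length (ctgt f)) p)"
  by (transfer, auto simp: length_diag_bu)+

lemma heat_simps [simp]:
  "heat s (ide X) x p = 0"
  "length x = length (gen_src c) \<Longrightarrow> length p = length (gen_tgt c) \<Longrightarrow>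
    heat s (cgen c) x p = gen_heat s c x p"
  "ctgt f = csrc g \<Longrightarrow> length x = length (csrc f) \<Longrightarrow> length p = length (ctgt g) \<Longrightarrow>
    heat s (g \<odot> f) x p = heat s f x (bu g p) + heat s g (td s f x) p"
  "length x = length (csrc f @ csrc g) \<Longrightarrow> length p = length (ctgt f @ ctgt g) \<Longrightarrow>
    heat s (f \<otimes> g) x p =
      heat s f (take (length (csrc f)) x) (take (length (ctgt f)) p) +
      heat s g (drop (length (csrc f)) x) (drop (length (ctgt f)) p)"
  by (transfer, auto simp: length_diag_td length_diag_bu)+

lemma length_td [simp]: "length x = length (csrc f) \<Longrightarrow> length (td s f x) = length (ctgt f)"
  by transfer (auto simp: length_diag_td)

lemma length_bu [simp]: "length p = length (ctgt f) \<Longrightarrow> length (bu f p) = length (csrc f)"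
  by transfer (auto simp: length_diag_bu)

section \<open>Monotonicity of the flows and of the heat\<close>

abbreviation le_list :: "nat list \<Rightarrow> nat list \<Rightarrow> bool" where
  "le_list \<equiv> list_all2 (\<le>)"

lemma sum_list_le: "le_list x y \<Longrightarrow> sum_list x \<le> sum_list y"
  by (induction rule: list_all2_induct) auto

lemma le_list_refl: "le_list x x"
  by (simp add: list_all2_refl)

lemma le_list_take_drop: "le_list x y \<Longrightarrow> le_list (take n x) (take n y)"
  "le_list x y \<Longrightarrow> le_list (drop n x) (drop n y)"
  by (simp_all add: list_all2_takeI list_all2_dropI)

lemma diag_td_mono:
  "wf_diag f \<Longrightarrow> length x = length (dsrc f) \<Longrightarrow> le_list x y \<Longrightarrow> le_list (diag_td s f x) (diag_td s f y)"
proof (induction f arbitrary: x y)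
  case (DGen c)
  then show ?case
    by (cases c) (auto simp: sum_list_le list_all2_lengthD list_all2_nthD intro: add_mono)
next
  case (DComp g f)
  then show ?case by (auto simp: length_diag_td)
next
  case (DTensor f g)
  then show ?case by (auto intro!: list_all2_appendI DTensor.IH le_list_take_drop)
qed auto

lemma diag_bu_mono:
  "wf_diag f \<Longrightarrow> length p = length (dtgt f) \<Longrightarrow> le_list p q \<Longrightarrow> le_list (diag_bu f p) (diag_bu f q)"
proof (induction f arbitrary: p q)
  case (DGen c)
  then show ?case
    by (cases c) (auto simp: list_all2_map1 list_all2_map2 list_all2_same list_all2_nthD intro: add_mono)
next
  case (DComp g f)
  then show ?case by (auto simp: length_diag_bu)
next
  case (DTensor f g)
  then show ?case by (auto intro!: list_all2_appendI DTensor.IH le_list_take_drop)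
qed auto

lemma diag_heat_mono:
  "wf_diag f \<Longrightarrow> length x = length (dsrc f) \<Longrightarrow> length p = length (dtgt f) \<Longrightarrow>
    le_list x y \<Longrightarrow> le_list p q \<Longrightarrow> diag_heat s f x p \<le> diag_heat s f y q"
proof (induction f arbitrary: x y p q)
  case (DGen c)
  then have "x ! i \<le> y ! i" if "i < length (gen_src c)" for i
    using that by (simp add: list_all2_nthD)
  moreover from DGen have "p ! i \<le> q ! i" if "i < length (gen_tgt c)" for i
    using that by (simp add: list_all2_nthD)
  ultimately show ?case
    by (cases c) (auto intro!: mult_le_mono add_le_mono simp del: mult_Suc mult_Suc_right)
next
  case (DComp g f)
  then have "le_list (diag_td s f x) (diag_td s f y)" "le_list (diag_bu g p) (diag_bu g q)"
    by (auto intro: diag_td_mono diag_bu_mono)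
  then show ?case
    using DComp by (auto intro!: add_le_mono DComp.IH simp: length_diag_td length_diag_bu)
next
  case (DTensor f g)
  then show ?case by (auto intro!: add_le_mono DTensor.IH le_list_take_drop)
qed auto

lemma td_mono:
  "length x = length (csrc f) \<Longrightarrow> le_list x y \<Longrightarrow> le_list (td s f x) (td s f y)"
  by transfer (auto dest: list_all2_lengthD intro: diag_td_mono)

lemma bu_mono:
  "length p = length (ctgt f) \<Longrightarrow> le_list p q \<Longrightarrow> le_list (bu f p) (bu f q)"
  by transfer (auto dest: list_all2_lengthD intro: diag_bu_mono)

lemma heat_mono:
  "length x = length (csrc f) \<Longrightarrow> length p = length (ctgt f) \<Longrightarrow>
    le_list x y \<Longrightarrow> le_list p q \<Longrightarrow> heat s f x p \<le> heat s f y q"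
  by transfer (auto dest: list_all2_lengthD intro: diag_heat_mono)

lemma R_Delta_parallel: "R_Delta f g \<Longrightarrow> csrc f = csrc g \<and> ctgt f = ctgt g"
proof (induction rule: R_Delta.induct)
  case (R_E f g)
  then show ?case
  proof (induction rule: E_Delta.induct)
    case (E_tau_opr \<phi> X)
    then show ?case by (cases \<phi>) auto
  next
    case (E_delta_opr \<phi>)
    then show ?case by (cases \<phi>) auto
  next
    case (E_eps_opr \<phi>)
    then show ?case by (cases \<phi>) auto
  qed auto
next
  case (R_tau_opr X \<phi>)
  then show ?case by (cases \<phi>) auto
qed auto

text \<open>The form of decrease that survives in any context. The flow of stage \<open>True\<close>
  has to be the same below the step, while the upward flow may drop, as it does for the counit
  rules; by monotonicity this cannot heat the rest. The numbers \<open>y\<close> of stage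
  \<open>False\<close> are independent of \<open>x\<close>, and their flow is controlled only where
  stage \<open>True\<close> does not decrease strictly: \<open>R_tau_opr\<close> with a binary
  operator raises it.\<close>

definition cooler :: "circuit \<Rightarrow> circuit \<Rightarrow> bool" where
  "cooler f g \<longleftrightarrow>
    (\<forall>x p. length x = length (csrc f) \<longrightarrow> length p = length (ctgt f) \<longrightarrow>
      td True g x = td True f x \<and> le_list (bu g p) (bu f p) \<and>
      heat True g x p \<le> heat True f x p) \<and>
    (\<forall>x y p. length x = length (csrc f) \<longrightarrow> length y = length (csrc f) \<longrightarrow>
      length p = length (ctgt f) \<longrightarrow>
      heat True g x p < heat True f x p \<or>
      heat False g y p < heat False f y p \<and> le_list (td False g y) (td False f y))"

lemma E_Delta_cooler: "E_Delta f g \<Longrightarrow> cooler f g"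
proof (induction rule: E_Delta.induct)
  case (E_tau_opr \<phi> X)
  then show ?case
    by (cases \<phi>) (auto simp: cooler_def length_Suc_conv algebra_simps)
next
  case (E_delta_opr \<phi>)
  then show ?case
    by (cases \<phi>) (auto simp: cooler_def length_Suc_conv algebra_simps)
next
  case (E_eps_opr \<phi>)
  then show ?case
    by (cases \<phi>) (auto simp: cooler_def length_Suc_conv algebra_simps)
qed (auto simp: cooler_def length_Suc_conv algebra_simps)

lemma R_Delta_cooler: "R_Delta f g \<Longrightarrow> cooler f g"
proof (induction rule: R_Delta.induct)
  case (R_E f g)
  then show ?case by (rule E_Delta_cooler)
next
  case (R_tau_opr X \<phi>)
  then show ?case
    by (cases \<phi>) (auto simp: cooler_def length_Suc_conv algebra_simps)
qed (auto simp: cooler_def length_Suc_conv algebra_simps)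

lemma coolerD:
  assumes "cooler f g" "length x = length (csrc f)" "length p = length (ctgt f)"
  shows "td True g x = td True f x" "le_list (bu g p) (bu f p)" "heat True g x p \<le> heat True f x p"
    "length y = length (csrc f) \<Longrightarrow> heat True g x p < heat True f x p \<or>
      heat False g y p < heat False f y p \<and> le_list (td False g y) (td False f y)"
  using assms unfolding cooler_def by blast+

lemma coolerI:
  assumes "\<And>x p. length x = length (csrc f) \<Longrightarrow> length p = length (ctgt f) \<Longrightarrow>
      td True g x = td True f x \<and> le_list (bu g p) (bu f p) \<and> heat True g x p \<le> heat True f x p"
    and "\<And>x y p. length x = length (csrc f) \<Longrightarrow> length y = length (csrc f) \<Longrightarrow>
      length p = length (ctgt f) \<Longrightarrow> heat True g x p < heat True f x p \<or>
      heat False g y p < heat False f y p \<and> le_list (td False g y) (td False f y)"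
  shows "cooler f g"
  using assms unfolding cooler_def by blast

lemma cooler_comp_left:
  assumes c: "cooler f g" and s: "csrc f = csrc g" "ctgt f = ctgt g" "csrc k = ctgt f"
  shows "cooler (k \<odot> f) (k \<odot> g)"
proof (rule coolerI, goal_cases)
  case (1 x p)
  then show ?case
    using s coolerD(1-3)[OF c, of x "bu k p"] by simp
next
  case (2 x y p)
  show ?case
  proof (cases "heat True g x (bu k p) < heat True f x (bu k p)")
    case True
    then show ?thesis using 2 s coolerD(1)[OF c, of x "bu k p"] by simp
  next
    case False
    then have *: "heat False g y (bu k p) < heat False f y (bu k p)"
        "le_list (td False g y) (td False f y)"
      using 2 s coolerD(4)[OF c, of x "bu k p" y] by auto
    moreover have "heat False k (td False g y) p \<le> heat False k (td False f y) p"
      using * 2 s by (intro heat_mono) (auto intro: le_list_refl)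
    moreover have "le_list (td False k (td False g y)) (td False k (td False f y))"
      using * 2 s by (intro td_mono) auto
    ultimately show ?thesis using 2 s by simp
  qed
qed

lemma cooler_comp_right:
  assumes c: "cooler f g" and s: "csrc f = csrc g" "ctgt f = ctgt g" "ctgt h = csrc f"
  shows "cooler (f \<odot> h) (g \<odot> h)"
proof -
  have le: "heat s h x (bu g p) \<le> heat s h x (bu f p)"
    if "length x = length (csrc h)" "length p = length (ctgt f)" for s x p
    using that s coolerD(2)[OF c, of "td True h x" p] by (intro heat_mono) (auto intro: le_list_refl)
  show ?thesis
  proof (rule coolerI, goal_cases)
    case (1 x p)
    then show ?case
      using s coolerD(1-3)[OF c, of "td True h x" p] le[of x p True]
      by (auto intro!: add_mono bu_mono)
  next
    case (2 x y p)
    then show ?case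
      using s coolerD(4)[OF c, of "td True h x" p "td False h y"] le[of x p True] le[of y p False]
      by auto
  qed
qed

lemma cooler_whisk:
  assumes "cooler f g" "csrc f = csrc g" "ctgt f = ctgt g"
  shows "cooler (whisk Y f Z) (whisk Y g Z)"
proof (rule coolerI, goal_cases)
  case (1 x p)
  then show ?case
    using assms coolerD(1-3)[of f g "take (length (csrc f)) (drop (length Y) x)"
        "take (length (ctgt f)) (drop (length Y) p)"]
    by (auto simp: whisk_def intro!: list_all2_appendI le_list_refl)
next
  case (2 x y p)
  then show ?case
    using assms coolerD(4)[of f g "take (length (csrc f)) (drop (length Y) x)"
        "take (length (ctgt f)) (drop (length Y) p)" "take (length (csrc f)) (drop (length Y) y)"]
    by (auto simp: whisk_def intro!: list_all2_appendI le_list_refl)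
qed

lemma circuit_step_whisk:
  "circuit_step P f g \<longleftrightarrow>
    (\<exists>s t h k Y Z. P s t \<and> ctgt h = Y @ csrc s @ Z \<and> csrc k = Y @ ctgt s @ Z \<and>
      f = k \<odot> whisk Y s Z \<odot> h \<and> g = k \<odot> whisk Y t Z \<odot> h)"
  by (simp add: circuit_step_def whisk_def)

lemma R_step_cooler:
  assumes "circuit_step R_Delta f g"
  shows "cooler f g \<and> csrc f = csrc g \<and> ctgt f = ctgt g"
proof -
  obtain s t h k Y Z where *: "R_Delta s t" "ctgt h = Y @ csrc s @ Z" "csrc k = Y @ ctgt s @ Z"
      "f = k \<odot> whisk Y s Z \<odot> h" "g = k \<odot> whisk Y t Z \<odot> h"
    using assms circuit_step_whisk by auto
  moreover have "csrc s = csrc t" "ctgt s = ctgt t"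
    using R_Delta_parallel[OF *(1)] by auto
  moreover have "cooler (k \<odot> whisk Y s Z \<odot> h) (k \<odot> whisk Y t Z \<odot> h)"
    using calculation R_Delta_cooler[OF *(1)]
    by (intro cooler_comp_left cooler_comp_right cooler_whisk) auto
  ultimately show ?thesis by auto
qed

lemma wf_R_step: "wfP (\<lambda>g f. circuit_step R_Delta f g)"
proof -
  \<comment> \<open>The decrease holds for all numbers at the ports, so any fixed choice gives a
    measure.\<close>
  define zero where "zero X = replicate (length X) (0::nat)" for X :: word
  define m where "m f = (heat True f (zero (csrc f)) (zero (ctgt f)),
    heat False f (zero (csrc f)) (zero (ctgt f)))" for f
  have "wf (inv_image (less_than <*lex*> less_than) m)"
    by auto
  moreover have "{(g, f). circuit_step R_Delta f g} \<subseteq> inv_image (less_than <*lex*> less_than) m"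
  proof clarify
    fix f g
    assume "circuit_step R_Delta f g"
    then have c: "cooler f g" "csrc f = csrc g" "ctgt f = ctgt g"
      using R_step_cooler by auto
    show "(g, f) \<in> inv_image (less_than <*lex*> less_than) m"
      using coolerD(3,4)[OF c(1), of "zero (csrc f)" "zero (ctgt f)"] c(2,3)
      by (auto simp: m_def zero_def le_less)
  qed
  ultimately show ?thesis
    unfolding wfp_def by (rule wf_subset)
qed

lemma normal_form_exists: "\<exists>g. (circuit_step R_Delta)\<^sup>*\<^sup>* f g \<and> normal_form g"
proof (induction f rule: wfp_induct_rule[OF wf_R_step])
  case (1 f)
  then show ?case
    unfolding normal_form_def by (meson converse_rtranclp_into_rtranclp rtranclp.rtrancl_refl)
qed

section \<open>Canonical resource circuits\<close>

text \<open>Composites are kept associated to the right, where the pair \<open>a \<odot> b\<close>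
  is hidden; this lets an equation act on it.\<close>

lemma comp_slide:
  "a \<odot> b = c \<odot> d \<Longrightarrow> ctgt b = csrc a \<Longrightarrow> ctgt d = csrc c \<Longrightarrow> csrc d = csrc b \<Longrightarrow>
    ctgt h = csrc b \<Longrightarrow> a \<odot> b \<odot> h = c \<odot> d \<odot> h"
  by (simp add: comp_assoc_ex)

section \<open>Redexes in context\<close>

definition reducible :: "circuit \<Rightarrow> bool" where
  "reducible f \<longleftrightarrow> (\<exists>g. circuit_step R_Delta f g)"

lemma reducible_comp_left:
  assumes "reducible f" "csrc k = ctgt f"
  shows "reducible (k \<odot> f)"
proof -
  obtain s t h k' Y Z where *: "R_Delta s t" "ctgt h = Y @ csrc s @ Z" "csrc k' = Y @ ctgt s @ Z"
      "f = k' \<odot> whisk Y s Z \<odot> h"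
    using assms(1) unfolding reducible_def circuit_step_whisk by blast
  then have "k \<odot> f = (k \<odot> k') \<odot> whisk Y s Z \<odot> h" "csrc (k \<odot> k') = Y @ ctgt s @ Z"
    using assms(2) by (simp_all add: comp_assoc)
  then show ?thesis
    using * unfolding reducible_def circuit_step_whisk by blast
qed

lemma reducible_comp_right:
  assumes "reducible f" "ctgt h = csrc f"
  shows "reducible (f \<odot> h)"
proof -
  obtain s t h' k Y Z where *: "R_Delta s t" "ctgt h' = Y @ csrc s @ Z" "csrc k = Y @ ctgt s @ Z"
      "f = k \<odot> whisk Y s Z \<odot> h'"
    using assms(1) unfolding reducible_def circuit_step_whisk by blast
  then have "f \<odot> h = k \<odot> whisk Y s Z \<odot> h' \<odot> h" "ctgt (h' \<odot> h) = Y @ csrc s @ Z"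
    using assms(2) by (simp_all add: comp_assoc)
  then show ?thesis
    using * unfolding reducible_def circuit_step_whisk by blast
qed

lemma reducible_whisk:
  assumes "reducible f"
  shows "reducible (whisk A f B)"
proof -
  obtain s t h k Y Z where *: "R_Delta s t" "ctgt h = Y @ csrc s @ Z" "csrc k = Y @ ctgt s @ Z"
      "f = k \<odot> whisk Y s Z \<odot> h"
    using assms(1) unfolding reducible_def circuit_step_whisk by blast
  then have "whisk A f B = whisk A k B \<odot> whisk (A @ Y) s (Z @ B) \<odot> whisk A h B"
      "ctgt (whisk A h B) = (A @ Y) @ csrc s @ Z @ B" "csrc (whisk A k B) = (A @ Y) @ ctgt s @ Z @ B"
    by (simp_all add: whisk_comp)
  then show ?thesis
    using * unfolding reducible_def circuit_step_whisk by blast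
qed

lemma redex:
  assumes "R_Delta s t"
  shows "reducible s"
proof -
  have "s = ide (ctgt s) \<odot> whisk [] s [] \<odot> ide (csrc s)" "t = ide (ctgt s) \<odot> whisk [] t [] \<odot> ide (csrc s)"
    using R_Delta_parallel[OF assms] by simp_all
  then show ?thesis
    using assms unfolding reducible_def circuit_step_whisk
    by (metis append_Nil append_Nil2 csrc_simps(1) ctgt_simps(1))
qed

lemma redex_in_context:
  assumes "reducible s" "csrc k = Y @ ctgt s @ Z" "ctgt h = Y @ csrc s @ Z"
  shows "reducible (k \<odot> whisk Y s Z \<odot> h)"
  using assms by (intro reducible_comp_left reducible_comp_right reducible_whisk) auto

text \<open>The left-hand sides of the sixteen rule schemes, in the whiskered form in which they are
  recognised below.\<close>

lemma redexes:
  "reducible (whisk [X] (\<delta> X) [] \<odot> \<delta> X)"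
  "reducible (\<tau> X X \<odot> \<delta> X)"
  "reducible (whisk [] (\<epsilon> X) [X] \<odot> \<delta> X)"
  "reducible (\<tau> Y X \<odot> \<tau> X Y)"
  "reducible (whisk [Y] (\<delta> X) [] \<odot> \<tau> X Y)"
  "reducible (whisk [Y] (\<epsilon> X) [] \<odot> \<tau> X Y)"
  "reducible (whisk [Z] (\<tau> X Y) [] \<odot> whisk [] (\<tau> X Z) [Y] \<odot> whisk [X] (\<tau> Y Z) [])"
  "reducible (\<tau> (opr_tgt \<phi>) X \<odot> whisk [] (opc \<phi>) [X])"
  "reducible (\<delta> (opr_tgt \<phi>) \<odot> opc \<phi>)"
  "reducible (\<epsilon> (opr_tgt \<phi>) \<odot> opc \<phi>)"
  "reducible (whisk [X] (\<tau> X X) [] \<odot> whisk [] (\<delta> X) [X] \<odot> \<delta> X)"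
  "reducible (whisk [X] (\<epsilon> X) [] \<odot> \<delta> X)"
  "reducible (whisk [Y] (\<tau> X Y) [] \<odot> whisk [] (\<tau> X Y) [Y] \<odot> whisk [X] (\<delta> Y) [])"
  "reducible (whisk [Y] (\<tau> Y X) [] \<odot> whisk [] (\<delta> Y) [X] \<odot> \<tau> X Y)"
  "reducible (whisk [] (\<epsilon> Y) [X] \<odot> \<tau> X Y)"
  "reducible (\<tau> X (opr_tgt \<phi>) \<odot> whisk [X] (opc \<phi>) [])"
  unfolding whisk_def tensor_unit
  by (rule redex, rule R_E E_Delta.intros R_Delta.intros, (rule E_Delta.intros)?)+

fun mv :: "tsort \<Rightarrow> word \<Rightarrow> circuit" where
  "mv X [] = ide [X]"
| "mv X (Y # W) = whisk [Y] (mv X W) [] \<odot> whisk [] (\<tau> X Y) W"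

lemma mv_types [simp]: "csrc (mv X W) = X # W \<and> ctgt (mv X W) = W @ [X]"
  by (induction W) auto

lemma mv_append: "mv X (U @ V) = whisk U (mv X V) [] \<odot> whisk [] (mv X U) V"
  by (induction U) (auto simp: whisk_comp comp_assoc)

abbreviation sorts :: "family \<Rightarrow> word" where
  "sorts \<equiv> map sort_of"

text \<open>
  The words of sorts are labelled by variables. \<open>emit\<close> produces the last output \<open>i\<close>: the input
  \<open>i\<close> is moved to the far right, after being duplicated if it is needed again.
\<close>

inductive emit :: "family \<Rightarrow> trm \<Rightarrow> family \<Rightarrow> circuit \<Rightarrow> bool" where
  emit_move: "i \<notin> set (P @ Q) \<Longrightarrow>
    emit (P @ i # Q) i (P @ Q) (whisk (sorts P) (mv (sort_of i) (sorts Q)) [])"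
| emit_dup: "emit (P @ i # Q) i (P @ i # Q)
    (whisk (sorts P @ [sort_of i]) (mv (sort_of i) (sorts Q)) [] \<odot>
     whisk (sorts P) (\<delta> (sort_of i)) (sorts Q))"

inductive res :: "family \<Rightarrow> family \<Rightarrow> circuit \<Rightarrow> bool" where
  res_Nil: "res [] [] (ide [])"
| res_snoc: "res L' v c \<Longrightarrow> emit L i L' m \<Longrightarrow> res L (v @ [i]) (whisk [] c [sort_of i] \<odot> m)"

lemma emit_types: "emit L i L' m \<Longrightarrow> csrc m = sorts L \<and> ctgt m = sorts L' @ [sort_of i]"
  by (induction rule: emit.induct) auto

lemma emit_set: "emit L i L' m \<Longrightarrow> set L = insert i (set L') \<and> (distinct L' \<longrightarrow> distinct L)"
  by (induction rule: emit.induct) auto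

lemma res_types:
  "res L v c \<Longrightarrow> distinct L \<and> set L = set v \<and> csrc c = sorts L \<and> ctgt c = sorts v"
  by (induction rule: res.induct) (auto dest: emit_types emit_set)

lemma res_snocE:
  assumes "res L (v @ [i]) c"
  obtains L' c' m where "res L' v c'" "emit L i L' m" "c = whisk [] c' [sort_of i] \<odot> m"
  using assms by (cases rule: res.cases) auto

lemma emit_unique:
  assumes "emit L i L' m" "emit L i L'' n" "i \<in> set L' \<longleftrightarrow> i \<in> set L''" "distinct L"
  shows "L' = L'' \<and> m = n"
proof -
  have split: "P = P' \<and> Q = Q'" if "L = P @ i # Q" "L = P' @ i # Q'" for P Q P' Q'
    using that assms(4) append_Cons_eq_iff[of i P Q P' Q'] by auto
  from assms(1) show ?thesis
  proof (cases rule: emit.cases)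
    case 1: (emit_move P Q)
    from assms(2) show ?thesis
    proof (cases rule: emit.cases)
      case (emit_move P' Q')
      then show ?thesis using 1 split[of P Q P' Q'] by auto
    qed (use 1 assms(3) in auto)
  next
    case 1: (emit_dup P Q)
    from assms(2) show ?thesis
    proof (cases rule: emit.cases)
      case (emit_dup P' Q')
      then show ?thesis using 1 split[of P Q P' Q'] by auto
    qed (use 1 assms(3) in auto)
  qed
qed

text \<open>The labels determine the circuit: by \<open>res_types\<close>, \<open>i\<close> survives
  its emission iff it occurs in \<open>v\<close>, which decides between moving and copying, and
  distinctness of \<open>L\<close> locates it.\<close>

lemma res_unique: "res L v c \<Longrightarrow> res L v d \<Longrightarrow> c = d"
proof (induction arbitrary: d rule: res.induct)
  case res_Nil
  then show ?case by (auto elim: res.cases)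
next
  case (res_snoc L' v c L i m)
  from res_snoc.prems obtain L'' c' m' where *: "res L'' v c'" "emit L i L'' m'"
      "d = whisk [] c' [sort_of i] \<odot> m'"
    by (rule res_snocE)
  have "distinct L" "set L' = set L''"
    using res_snoc * res_types emit_set by (metis, metis)
  then have "L' = L'' \<and> m = m'"
    using emit_unique[OF res_snoc.hyps(2) *(2)] by simp
  then show ?case using res_snoc.IH * by blast
qed

section \<open>Generators placed under a resource circuit\<close>

lemma emit_extend:
  "emit L i L' m \<Longrightarrow> j \<notin> set L \<Longrightarrow>
    emit (L @ [j]) i (L' @ [j])
      (whisk (sorts L') (\<tau> (sort_of i) (sort_of j)) [] \<odot> whisk [] m [sort_of j])"
proof (induction rule: emit.induct)
  case (emit_move i P Q)
  then show ?case
    using emit.emit_move[of i P "Q @ [j]"] by (auto simp: mv_append whisk_comp)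
next
  case (emit_dup P i Q)
  then show ?case
    using emit.emit_dup[of P i "Q @ [j]"] by (simp add: mv_append whisk_comp comp_assoc)
qed

text \<open>Exposes the generator of \<open>m\<close> nearest to its target, the first one met by a
  generator placed under the emitted wire; in the case \<open>direct\<close> there is none.\<close>

lemma emit_cases:
  assumes "emit L i L' m"
  obtains (direct) "L = L' @ [i]" "i \<notin> set L'" "m = ide (sorts L)"
    | (fork) P where "L = P @ [i]" "L' = P @ [i]" "m = whisk (sorts P) (\<delta> (sort_of i)) []"
    | (cross) z L0 L0' m0 where "L = L0 @ [z]" "L' = L0' @ [z]" "emit L0 i L0' m0"
        "m = whisk (sorts L0') (\<tau> (sort_of i) (sort_of z)) [] \<odot> whisk [] m0 [sort_of z]"
  using assms
proof (cases rule: emit.cases)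
  case (emit_move P Q)
  show ?thesis
  proof (cases Q rule: rev_cases)
    case Nil
    then show ?thesis using emit_move direct by simp
  next
    case (snoc Q0 z)
    then show ?thesis
      using emit_move cross[of "P @ i # Q0" z "P @ Q0"] emit.emit_move[of i P Q0]
      by (simp add: mv_append whisk_comp)
  qed
next
  case (emit_dup P Q)
  show ?thesis
  proof (cases Q rule: rev_cases)
    case Nil
    then show ?thesis using emit_dup fork by simp
  next
    case (snoc Q0 z)
    then show ?thesis
      using emit_dup cross[of "P @ i # Q0" z "P @ i # Q0"] emit.emit_dup[of P i Q0]
      by (simp add: mv_append whisk_comp comp_assoc)
  qed
qed

text \<open>Induction strips off the outputs to the right of \<open>i\<close>. When \<open>i\<close>
  is last, \<delta> meets its emission: under a copy it completes a right comb, under a crossing the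
  redex of \<open>E_delta_tau\<close>, and under neither it turns the move of \<open>i\<close> into
  a duplication.\<close>

lemma res_delta:
  assumes "res L (v @ i # w) c"
  shows "reducible (whisk (sorts v) (\<delta> (sort_of i)) (sorts w) \<odot> c) \<or>
    res L (v @ i # i # w) (whisk (sorts v) (\<delta> (sort_of i)) (sorts w) \<odot> c)"
  using assms
proof (induction w arbitrary: L c rule: rev_induct)
  case Nil
  then obtain L' c' m where c: "res L' v c'" "emit L i L' m" "c = whisk [] c' [sort_of i] \<odot> m"
    by (auto elim: res_snocE)
  note t = res_types[OF c(1)] emit_types[OF c(2)]
  \<comment> \<open>The new copy acts on the wire emitted by \<open>m\<close>, beside
    \<open>c'\<close>, and slides up to \<open>m\<close>.\<close>
  have eq: "whisk (sorts v) (\<delta> (sort_of i)) [] \<odot> c =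
      whisk [] c' [sort_of i, sort_of i] \<odot> whisk (sorts L') (\<delta> (sort_of i)) [] \<odot> m"
    unfolding c(3) using t whisk_exchange[of "[]" c' "[]" "\<delta> (sort_of i)" "[]"]
    by (simp add: comp_assoc_ex)
  from c(2) show ?case
  proof (cases rule: emit_cases)
    case direct
    have "res L (v @ [i]) (whisk [] c' [sort_of i])"
      using res_snoc[OF c(1,2)] direct t by simp
    from res_snoc[OF this, of L i] emit_dup[of L' i "[]"] show ?thesis
      using direct t eq by (simp add: whisk_comp)
  next
    case (fork P)
    have "reducible (whisk [] c' [sort_of i, sort_of i] \<odot>
        whisk (sorts P) (whisk [sort_of i] (\<delta> (sort_of i)) [] \<odot> \<delta> (sort_of i)) [])"
      by (rule reducible_comp_left, rule reducible_whisk, rule redexes) (use t fork in auto)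
    then show ?thesis using eq fork by (simp add: whisk_comp)
  next
    case (cross z L0 L0' m0)
    note t0 = emit_types[OF cross(3)]
    have "reducible (whisk [] c' [sort_of i, sort_of i] \<odot>
        whisk (sorts L0') (whisk [sort_of z] (\<delta> (sort_of i)) [] \<odot> \<tau> (sort_of i) (sort_of z)) [] \<odot>
        whisk [] m0 [sort_of z])"
      by (rule redex_in_context, rule redexes) (use t t0 cross in auto)
    then show ?thesis using eq cross t0 by (simp add: whisk_comp comp_assoc)
  qed
next
  case (snoc k w)
  then have "res L ((v @ i # w) @ [k]) c" by simp
  then obtain L' c' m where c: "res L' (v @ i # w) c'" "emit L k L' m"
      "c = whisk [] c' [sort_of k] \<odot> m"
    by (rule res_snocE)
  note t = res_types[OF c(1)] emit_types[OF c(2)]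
  let ?s = "whisk (sorts v) (\<delta> (sort_of i)) (sorts w) \<odot> c'"
  have eq: "whisk (sorts v) (\<delta> (sort_of i)) (sorts (w @ [k])) \<odot> c = whisk [] ?s [sort_of k] \<odot> m"
    unfolding c(3) using t by (simp add: whisk_comp comp_assoc)
  from snoc.IH[OF c(1)] show ?case
  proof
    assume red: "reducible ?s"
    show ?thesis
      unfolding eq by (rule disjI1, rule reducible_comp_right, rule reducible_whisk) (use t red in auto)
  next
    assume "res L' (v @ i # i # w) ?s"
    then show ?thesis
      unfolding eq using res_snoc[OF _ c(2)] by fastforce
  qed
qed

text \<open>For \<open>i\<close>, \<open>j\<close> last, \<open>m\<close> emits \<open>j\<close> and
  then \<open>n\<close> emits \<open>i\<close>. If \<open>m\<close> is trivial, the swap prolongs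
  the emission of \<open>i\<close>. Otherwise the swap completes a redex with the last generators of
  \<open>m\<close> and \<open>n\<close>. If \<open>m\<close> ends in a copy, the cases
  \<open>direct\<close>, \<open>fork\<close>, \<open>cross\<close> for \<open>n\<close> give
  \<open>E_cocomm\<close>, \<open>R_cocomm\<close>, \<open>R_delta_tau\<close>; if \<open>m\<close>
  ends in a crossing, they give \<open>E_tau_tau\<close>, \<open>R_tau_delta_tau\<close>,
  \<open>E_Yang_Baxter\<close>.\<close>

lemma res_tau:
  assumes "res L (v @ i # j # w) c"
  shows "reducible (whisk (sorts v) (\<tau> (sort_of i) (sort_of j)) (sorts w) \<odot> c) \<or>
    res L (v @ j # i # w) (whisk (sorts v) (\<tau> (sort_of i) (sort_of j)) (sorts w) \<odot> c)"
  using assms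
proof (induction w arbitrary: L c rule: rev_induct)
  case Nil
  define I J where "I = sort_of i" and "J = sort_of j"
  have "res L ((v @ [i]) @ [j]) c" using Nil by simp
  then obtain L1 c1 m where c1: "res L1 (v @ [i]) c1" and m: "emit L j L1 m"
      and c: "c = whisk [] c1 [J] \<odot> m"
    unfolding J_def by (rule res_snocE)
  from c1 obtain L2 c2 n where c2: "res L2 v c2" and n: "emit L1 i L2 n"
      and c1': "c1 = whisk [] c2 [I] \<odot> n"
    unfolding I_def by (rule res_snocE)
  note t = res_types[OF c1] res_types[OF c2] emit_types[OF m] emit_types[OF n]
  have t': "ctgt m = sorts L1 @ [J]" "ctgt n = sorts L2 @ [I]"
    using t by (auto simp: I_def J_def)
  define k where "k = whisk [] c2 [J, I]"
  have k: "csrc k = sorts L2 @ [J, I]" "ctgt k = sorts v @ [J, I]"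
    using t by (simp_all add: k_def)
  have "whisk (sorts v) (\<tau> I J) [] \<odot> whisk [] c2 [I, J] = k \<odot> whisk (sorts L2) (\<tau> I J) []"
    using whisk_exchange[of "[]" c2 "[]" "\<tau> I J" "[]"] t by (simp add: k_def)
  then have "whisk (sorts v) (\<tau> I J) [] \<odot> whisk [] c2 [I, J] \<odot> whisk [] n [J] \<odot> m =
      k \<odot> whisk (sorts L2) (\<tau> I J) [] \<odot> whisk [] n [J] \<odot> m"
    by (rule comp_slide) (use t t' k in auto)
  then have eq: "whisk (sorts v) (\<tau> I J) [] \<odot> c =
      k \<odot> whisk (sorts L2) (\<tau> I J) [] \<odot> whisk [] n [J] \<odot> m"
    unfolding c c1' using t t' k by (simp add: whisk_comp comp_assoc)
  have "reducible (whisk (sorts v) (\<tau> I J) [] \<odot> c) \<or>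
    res L (v @ [j, i]) (whisk (sorts v) (\<tau> I J) [] \<odot> c)"
    using m
  proof (cases rule: emit_cases)
    case direct
    have "j \<notin> set L2" using direct emit_set[OF n] by auto
    then have "emit (L2 @ [j]) j L2 (ide (sorts (L2 @ [j])))"
      using emit_move[of j L2 "[]"] by simp
    from res_snoc[OF res_snoc[OF c2 this] emit_extend[OF n direct(2)]] show ?thesis
      unfolding eq using t direct by (simp add: k_def I_def J_def)
  next
    case m_fork: (fork P)
    from n show ?thesis
    proof (cases rule: emit_cases)
      case direct
      have "reducible (k \<odot> whisk (sorts L2) (\<tau> I I \<odot> \<delta> I) [])"
        by (rule reducible_comp_left, rule reducible_whisk, rule redexes) (use k direct m_fork in \<open>auto simp: I_def J_def\<close>)
      then show ?thesis using eq direct m_fork by (simp add: whisk_comp I_def J_def)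
    next
      case (fork P2)
      have "reducible (k \<odot> whisk (sorts P)
          (whisk [I] (\<tau> I I) [] \<odot> whisk [] (\<delta> I) [I] \<odot> \<delta> I) [])"
        by (rule reducible_comp_left, rule reducible_whisk, rule redexes) (use k fork m_fork in \<open>auto simp: I_def J_def\<close>)
      then show ?thesis using eq fork m_fork by (simp add: whisk_comp I_def J_def)
    next
      case (cross z A B m0)
      note t0 = emit_types[OF cross(3)]
      \<comment> \<open>The copy of \<open>j\<close> is made beside \<open>m0\<close>; moved below
        it, it stands next to the two crossings.\<close>
      have slide: "whisk [] m0 [J, J] \<odot> whisk (sorts A) (\<delta> J) [] =
          whisk (sorts B @ [I]) (\<delta> J) [] \<odot> whisk [] m0 [J]"
        using t0 whisk_exchange[of "[]" m0 "[]" "\<delta> J" "[]"] by (simp add: I_def)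
      have "reducible (k \<odot> whisk (sorts B) (whisk [J] (\<tau> I J) [] \<odot> whisk [] (\<tau> I J) [J] \<odot>
          whisk [I] (\<delta> J) []) [] \<odot> whisk [] m0 [J])"
        by (rule redex_in_context, rule redexes) (use k cross m_fork t0 in \<open>auto simp: I_def J_def\<close>)
      then show ?thesis
        using eq cross m_fork t0 slide by (simp add: whisk_comp comp_assoc I_def J_def)
    qed
  next
    case m_cross: (cross z A B m0)
    note t0 = emit_types[OF m_cross(3)]
    from n show ?thesis
    proof (cases rule: emit_cases)
      case direct
      have "reducible (k \<odot> whisk (sorts L2) (\<tau> I J \<odot> \<tau> J I) [] \<odot> whisk [] m0 [I])"
        by (rule redex_in_context, rule redexes) (use k t0 direct m_cross in \<open>auto simp: I_def J_def\<close>)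
      then show ?thesis using eq direct m_cross t0 by (simp add: whisk_comp comp_assoc I_def J_def)
    next
      case (fork P)
      have "reducible (k \<odot> whisk (sorts B)
          (whisk [I] (\<tau> I J) [] \<odot> whisk [] (\<delta> I) [J] \<odot> \<tau> J I) [] \<odot> whisk [] m0 [I])"
        by (rule redex_in_context, rule redexes) (use k t0 fork m_cross in \<open>auto simp: I_def J_def\<close>)
      then show ?thesis using eq fork m_cross t0 by (simp add: whisk_comp comp_assoc I_def J_def)
    next
      case (cross z' A' B' n0)
      note t1 = emit_types[OF cross(3)]
      define Z where "Z = sort_of z"
      \<comment> \<open>\<open>n0\<close> acts beside the crossing of \<open>j\<close> over
        \<open>z\<close>; exchanging them brings the three crossings together.\<close>
      have slide: "whisk [] n0 [Z, J] \<odot> whisk (sorts B) (\<tau> J Z) [] \<odot> whisk [] m0 [Z] =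
          whisk (sorts B' @ [I]) (\<tau> J Z) [] \<odot> whisk [] n0 [J, Z] \<odot> whisk [] m0 [Z]"
        using t0 t1 cross m_cross whisk_exchange[of "[]" n0 "[]" "\<tau> J Z" "[]"]
        by (simp add: I_def J_def Z_def comp_assoc_ex)
      have "reducible (k \<odot> whisk (sorts B') (whisk [Z] (\<tau> I J) [] \<odot> whisk [] (\<tau> I Z) [J] \<odot>
          whisk [I] (\<tau> J Z) []) [] \<odot> whisk [] n0 [J, Z] \<odot> whisk [] m0 [Z])"
        by (rule redex_in_context, rule redexes) (use k cross m_cross t0 t1 in \<open>auto simp: I_def J_def Z_def\<close>)
      then show ?thesis
        using eq cross m_cross t0 t1 slide
        by (simp add: whisk_comp comp_assoc I_def J_def Z_def)
    qed
  qed
  then show ?case by (simp add: I_def J_def)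
next
  case (snoc k w)
  then have "res L ((v @ i # j # w) @ [k]) c" by simp
  then obtain L' c' m where c: "res L' (v @ i # j # w) c'" "emit L k L' m"
      "c = whisk [] c' [sort_of k] \<odot> m"
    by (rule res_snocE)
  note t = res_types[OF c(1)] emit_types[OF c(2)]
  let ?s = "whisk (sorts v) (\<tau> (sort_of i) (sort_of j)) (sorts w) \<odot> c'"
  have eq: "whisk (sorts v) (\<tau> (sort_of i) (sort_of j)) (sorts (w @ [k])) \<odot> c =
      whisk [] ?s [sort_of k] \<odot> m"
    unfolding c(3) using t by (simp add: whisk_comp comp_assoc)
  from snoc.IH[OF c(1)] show ?case
  proof
    assume red: "reducible ?s"
    show ?thesis
      unfolding eq by (rule disjI1, rule reducible_comp_right, rule reducible_whisk) (use t red in auto)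
  next
    assume "res L' (v @ j # i # w) ?s"
    then show ?thesis
      unfolding eq using res_snoc[OF _ c(2)] by fastforce
  qed
qed

text \<open>An eraser on an input that survives the emission of \<open>k\<close> rises through it,
  unless it meets the copying of its own wire or a crossing over it; both are redexes.\<close>

lemma emit_eps:
  assumes "emit L k (P @ i # Q) m" "distinct L"
  shows "reducible (whisk (sorts P) (\<epsilon> (sort_of i)) (sorts (Q @ [k])) \<odot> m) \<or>
    (\<exists>P0 Q0 n. L = P0 @ i # Q0 \<and> emit (P0 @ Q0) k (P @ Q) n \<and>
      whisk (sorts P) (\<epsilon> (sort_of i)) (sorts (Q @ [k])) \<odot> m =
      n \<odot> whisk (sorts P0) (\<epsilon> (sort_of i)) (sorts Q0))"
  using assms
proof (induction Q arbitrary: L m rule: rev_induct)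
  case Nil
  from Nil.prems(1) show ?case
  proof (cases rule: emit_cases)
    case direct
    then show ?thesis
      using emit_move[of k P "[]"] by (intro disjI2 exI[of _ P] exI[of _ "[k]"]) auto
  next
    case (fork P')
    have "reducible (whisk (sorts P) (whisk [] (\<epsilon> (sort_of k)) [sort_of k] \<odot> \<delta> (sort_of k)) [])"
      by (rule reducible_whisk, rule redexes)
    then show ?thesis using fork by (simp add: whisk_comp)
  next
    case (cross z L0 L0' m0)
    have "reducible (whisk (sorts P) (whisk [] (\<epsilon> (sort_of z)) [sort_of k] \<odot>
        \<tau> (sort_of k) (sort_of z)) [] \<odot> whisk [] m0 [sort_of z])"
      by (rule reducible_comp_right, rule reducible_whisk, rule redexes) (use cross emit_types[OF cross(3)] in auto)
    then show ?thesis
      using cross emit_types[OF cross(3)] by (simp add: whisk_comp comp_assoc)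
  qed
next
  case (snoc z Q)
  from snoc.prems(1) show ?case
  proof (cases rule: emit_cases)
    case direct
    then show ?thesis
      using emit_move[of k "P @ Q @ [z]" "[]"]
      by (intro disjI2 exI[of _ P] exI[of _ "Q @ [z, k]"]) auto
  next
    case (fork P')
    then have "P' = P @ i # Q" "z = k" by auto
    then show ?thesis
      using fork emit_dup[of "P @ Q" k "[]"]
        whisk_exchange[of "sorts P" "\<epsilon> (sort_of i)" "sorts Q" "\<delta> (sort_of k)" "[]"]
      by (intro disjI2 exI[of _ P] exI[of _ "Q @ [z]"]) auto
  next
    case (cross z' L0 L0' m0)
    then have z: "z' = z" "L0' = P @ i # Q" "z \<notin> set L0" "distinct L0"
      using snoc.prems(2) by auto
    note t0 = emit_types[OF cross(3)]
    let ?s = "whisk (sorts P) (\<epsilon> (sort_of i)) (sorts (Q @ [k])) \<odot> m0"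
    have "whisk (sorts P) (\<epsilon> (sort_of i)) (sorts Q @ [sort_of z, sort_of k]) \<odot>
        whisk (sorts (P @ i # Q)) (\<tau> (sort_of k) (sort_of z)) [] =
        whisk (sorts (P @ Q)) (\<tau> (sort_of k) (sort_of z)) [] \<odot>
        whisk (sorts P) (\<epsilon> (sort_of i)) (sorts Q @ [sort_of k, sort_of z])"
      using whisk_exchange[of "sorts P" "\<epsilon> (sort_of i)" "sorts Q" "\<tau> (sort_of k) (sort_of z)" "[]"]
      by simp
    then have "whisk (sorts P) (\<epsilon> (sort_of i)) (sorts Q @ [sort_of z, sort_of k]) \<odot>
        whisk (sorts (P @ i # Q)) (\<tau> (sort_of k) (sort_of z)) [] \<odot> whisk [] m0 [sort_of z] =
        whisk (sorts (P @ Q)) (\<tau> (sort_of k) (sort_of z)) [] \<odot>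
        whisk (sorts P) (\<epsilon> (sort_of i)) (sorts Q @ [sort_of k, sort_of z]) \<odot>
        whisk [] m0 [sort_of z]"
      by (rule comp_slide) (use t0 z in auto)
    then have eq: "whisk (sorts P) (\<epsilon> (sort_of i)) (sorts ((Q @ [z]) @ [k])) \<odot> m =
        whisk (sorts (P @ Q)) (\<tau> (sort_of k) (sort_of z)) [] \<odot> whisk [] ?s [sort_of z]"
      using cross z t0 by (simp add: whisk_comp comp_assoc)
    have "emit L0 k (P @ i # Q) m0" using cross z by simp
    from snoc.IH[OF this z(4)] show ?thesis
    proof (elim disjE exE conjE)
      assume red: "reducible ?s"
      show ?thesis
        unfolding eq by (rule disjI1, rule reducible_comp_left, rule reducible_whisk) (use red t0 z in auto)
    next
      fix P0 Q0 n
      assume h: "L0 = P0 @ i # Q0" "emit (P0 @ Q0) k (P @ Q) n"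
        "?s = n \<odot> whisk (sorts P0) (\<epsilon> (sort_of i)) (sorts Q0)"
      note tn = emit_types[OF h(2)]
      have "whisk (sorts P) (\<epsilon> (sort_of i)) (sorts ((Q @ [z]) @ [k])) \<odot> m =
          (whisk (sorts (P @ Q)) (\<tau> (sort_of k) (sort_of z)) [] \<odot> whisk [] n [sort_of z]) \<odot>
          whisk (sorts P0) (\<epsilon> (sort_of i)) (sorts (Q0 @ [z]))"
        unfolding eq h(3) using tn by (simp add: whisk_comp comp_assoc)
      moreover have "emit ((P0 @ Q0) @ [z]) k ((P @ Q) @ [z])
          (whisk (sorts (P @ Q)) (\<tau> (sort_of k) (sort_of z)) [] \<odot> whisk [] n [sort_of z])"
        using h z by (intro emit_extend) auto
      ultimately show ?thesis
        using h(1) cross z by (intro disjI2 exI[of _ P0] exI[of _ "Q0 @ [z]"]) auto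
    qed
  qed
qed

text \<open>Without a redex the eraser rises to an input, where it joins the erasers of a canonical
  circuit. For \<open>i\<close> last it must find the emission of \<open>i\<close> trivial;
  \<open>emit_eps\<close> carries it through the emissions of the outputs to the right of
  \<open>i\<close>.\<close>

lemma res_eps:
  assumes "res L (v @ i # w) c"
  shows "reducible (whisk (sorts v) (\<epsilon> (sort_of i)) (sorts w) \<odot> c) \<or>
    (\<exists>P Q d. L = P @ i # Q \<and> res (P @ Q) (v @ w) d \<and>
      whisk (sorts v) (\<epsilon> (sort_of i)) (sorts w) \<odot> c = d \<odot> whisk (sorts P) (\<epsilon> (sort_of i)) (sorts Q))"
  using assms
proof (induction w arbitrary: L c rule: rev_induct)
  case Nil
  then obtain L' c' m where c: "res L' v c'" "emit L i L' m" "c = whisk [] c' [sort_of i] \<odot> m"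
    by (auto elim: res_snocE)
  note t = res_types[OF c(1)] emit_types[OF c(2)]
  have eq: "whisk (sorts v) (\<epsilon> (sort_of i)) [] \<odot> c = c' \<odot> whisk (sorts L') (\<epsilon> (sort_of i)) [] \<odot> m"
    unfolding c(3) using t whisk_exchange[of "[]" c' "[]" "\<epsilon> (sort_of i)" "[]"]
    by (simp add: comp_assoc_ex)
  from c(2) show ?case
  proof (cases rule: emit_cases)
    case direct
    then show ?thesis using c eq by (intro disjI2 exI[of _ L'] exI[of _ "[]"]) auto
  next
    case (fork P)
    have "reducible (c' \<odot>
        whisk (sorts P) (whisk [sort_of i] (\<epsilon> (sort_of i)) [] \<odot> \<delta> (sort_of i)) [])"
      by (rule reducible_comp_left, rule reducible_whisk, rule redexes) (use t fork in auto)
    then show ?thesis using eq fork by (simp add: whisk_comp)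
  next
    case (cross z L0 L0' m0)
    note t0 = emit_types[OF cross(3)]
    have "reducible (c' \<odot>
        whisk (sorts L0') (whisk [sort_of z] (\<epsilon> (sort_of i)) [] \<odot> \<tau> (sort_of i) (sort_of z)) [] \<odot>
        whisk [] m0 [sort_of z])"
      by (rule redex_in_context, rule redexes) (use t t0 cross in auto)
    then show ?thesis using eq cross t0 by (simp add: whisk_comp comp_assoc)
  qed
next
  case (snoc k w)
  then have r: "res L ((v @ i # w) @ [k]) c" by simp
  then obtain L' c' m where c: "res L' (v @ i # w) c'" "emit L k L' m"
      "c = whisk [] c' [sort_of k] \<odot> m"
    by (rule res_snocE)
  note t = res_types[OF r] res_types[OF c(1)] emit_types[OF c(2)]
  let ?s = "whisk (sorts v) (\<epsilon> (sort_of i)) (sorts w) \<odot> c'"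
  have eq: "whisk (sorts v) (\<epsilon> (sort_of i)) (sorts (w @ [k])) \<odot> c = whisk [] ?s [sort_of k] \<odot> m"
    unfolding c(3) using t by (simp add: whisk_comp comp_assoc)
  from snoc.IH[OF c(1)] show ?case
  proof (elim disjE exE conjE)
    assume red: "reducible ?s"
    show ?thesis
      unfolding eq by (rule disjI1, rule reducible_comp_right, rule reducible_whisk) (use t red in auto)
  next
    fix P Q d
    assume a: "L' = P @ i # Q" "res (P @ Q) (v @ w) d"
      "?s = d \<odot> whisk (sorts P) (\<epsilon> (sort_of i)) (sorts Q)"
    note td = res_types[OF a(2)]
    have eq2: "whisk (sorts v) (\<epsilon> (sort_of i)) (sorts (w @ [k])) \<odot> c =
        whisk [] d [sort_of k] \<odot> whisk (sorts P) (\<epsilon> (sort_of i)) (sorts (Q @ [k])) \<odot> m"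
      unfolding eq a(3) using t td a(1) by (simp add: whisk_comp comp_assoc)
    have "distinct L" using t by simp
    from emit_eps[OF c(2)[unfolded a(1)] this] show ?thesis
    proof (elim disjE exE conjE)
      assume red: "reducible (whisk (sorts P) (\<epsilon> (sort_of i)) (sorts (Q @ [k])) \<odot> m)"
      show ?thesis
        unfolding eq2 by (rule disjI1, rule reducible_comp_left) (use red t td a(1) in auto)
    next
      fix P0 Q0 n
      assume h: "L = P0 @ i # Q0" "emit (P0 @ Q0) k (P @ Q) n"
        "whisk (sorts P) (\<epsilon> (sort_of i)) (sorts (Q @ [k])) \<odot> m =
          n \<odot> whisk (sorts P0) (\<epsilon> (sort_of i)) (sorts Q0)"
      show ?thesis
        using res_snoc[OF a(2) h(2)] h(1) eq2[unfolded h(3)] td emit_types[OF h(2)]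
        by (intro disjI2 exI[of _ P0] exI[of _ Q0] exI[of _ "whisk [] d [sort_of k] \<odot> n"])
          (auto simp: comp_assoc)
    qed
  qed
qed

section \<open>Canonical circuits\<close>

lemma proj_simps [simp]:
  "proj (ide X) = T_id X"
  "proj (cgen c) = gen_proj c"
  "ctgt f = csrc g \<Longrightarrow> proj (g \<odot> f) = T_comp (proj g) (proj f)"
  "proj (f \<otimes> g) = T_tensor (csrc f) (proj f) (proj g)"
  by (transfer, simp)+

lemma is_T_arrow_proj: "is_T_arrow (csrc f) (proj f) (ctgt f)"
  by transfer (simp add: is_T_arrow_diag)

lemma sorts_proj [simp]: "sorts (proj f) = ctgt f"
  using is_T_arrow_proj[of f] by (simp add: is_T_arrow_def)

lemma proj_whisk:
  assumes "ctgt h = Y @ csrc f @ Z" and h: "proj h = p @ q @ r"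
    and s: "sorts p = Y" "sorts q = csrc f"
  shows "proj (whisk Y f Z \<odot> h) = p @ T_comp (proj f) q @ r"
proof -
  have r: "sorts r = Z"
    using sorts_proj[of h] assms by (simp del: sorts_proj)
  define A where "A = atoms_of p @ atoms_of q @ atoms_of r"
  define F where "F = formulas_of p @ formulas_of q @ formulas_of r"
  note len = length_atoms_of length_formulas_of
  have "map (tsubst ((!) A) ((!) F)) (T_id Y) =
      map (tsubst ((!) (atoms_of p)) ((!) (formulas_of p))) (T_id Y)"
    using s vars_T_id[of _ 0 0 Y]
    by (auto simp: T_id_def A_def F_def len nth_append intro!: tsubst_cong)
  also have "\<dots> = p"
    using T_id_subst[of "[]" p "[]"] s by (simp add: T_id_def)
  finally have 1: "map (tsubst ((!) A) ((!) F)) (T_id Y) = p" .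
  \<comment> \<open>The shift by \<open>Y\<close> makes the indices of \<open>proj f\<close> point
    at the entries of \<open>q\<close> inside \<open>p @ q @ r\<close>.\<close>
  have 2: "map (tsubst ((!) A) ((!) F)) (T_shift Y (proj f)) = T_comp (proj f) q"
    using s is_T_arrow_proj[of f]
    by (auto simp: T_shift_def T_comp_def A_def F_def len nth_append tsubst_tsubst is_T_arrow_iff
        intro!: tsubst_cong)
  have 3: "map (tsubst ((!) A) ((!) F)) (T_shift Y (T_shift (csrc f) (T_id Z))) = r"
    using T_id_subst[of "atoms_of p @ atoms_of q" r "formulas_of p @ formulas_of q"] s r
    by (simp add: T_shift_def T_id_def T_id_shift A_def F_def len flip: map_map)
  have "proj (whisk Y f Z) = T_id Y @ T_shift Y (proj f) @ T_shift Y (T_shift (csrc f) (T_id Z))"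
    by (simp add: whisk_def T_tensor_def T_shift_def)
  then show ?thesis
    using assms(1) h 1 2 3 by (simp add: T_comp_def A_def F_def)
qed

section \<open>Terms as forests of operators over their variables\<close>

fun app :: "opr \<Rightarrow> family \<Rightarrow> trm" where
  "app OAnd [TF x, TF y] = TF (x \<^bold>\<and> y)"
| "app OOr [TF x, TF y] = TF (x \<^bold>\<or> y)"
| "app OTop [] = TF FTop"
| "app OBot [] = TF FBot"
| "app OIota [TA a] = TF (FIota a)"
| "app ONu [TA a] = TA (ANu a)"
| "app \<phi> u = TF FTop"

definition is_var :: "trm \<Rightarrow> bool" where
  "is_var t \<longleftrightarrow> (\<exists>k. t = TA (AVar k) \<or> t = TF (FVar k))"

lemma sort_cases:
  "sorts u = [] \<longleftrightarrow> u = []"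
  "sorts u = At # X \<longleftrightarrow> (\<exists>a v. u = TA a # v \<and> sorts v = X)"
  "sorts u = Fm # X \<longleftrightarrow> (\<exists>x v. u = TF x # v \<and> sorts v = X)"
  by (cases u; cases "hd u"; auto)+

lemma sort_of_iff:
  "sort_of t = At \<longleftrightarrow> (\<exists>a. t = TA a)" "sort_of t = Fm \<longleftrightarrow> (\<exists>x. t = TF x)"
  by (cases t; simp)+

lemma sort_of_app [simp]: "sorts u = opr_src \<phi> \<Longrightarrow> sort_of (app \<phi> u) = opr_tgt \<phi>"
  by (cases \<phi>) (auto simp: sort_cases)

lemma T_comp_gen:
  "sorts u = opr_src \<phi> \<Longrightarrow> T_comp (gen_proj (Opr \<phi>)) u = [app \<phi> u]"
  "sort_of t = X \<Longrightarrow> T_comp (gen_proj (Delta X)) [t] = [t, t]"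
  "T_comp (gen_proj (Eps X)) v = []"
  "sort_of t = X \<Longrightarrow> sort_of t' = Y \<Longrightarrow> T_comp (gen_proj (Tau X Y)) [t, t'] = [t', t]"
proof -
  show "sorts u = opr_src \<phi> \<Longrightarrow> T_comp (gen_proj (Opr \<phi>)) u = [app \<phi> u]"
    by (cases \<phi>) (auto simp: sort_cases T_comp_def)
  show "sort_of t = X \<Longrightarrow> T_comp (gen_proj (Delta X)) [t] = [t, t]"
    by (cases t) (auto simp: T_comp_def)
  show "sort_of t = X \<Longrightarrow> sort_of t' = Y \<Longrightarrow> T_comp (gen_proj (Tau X Y)) [t, t'] = [t', t]"
    by (cases t; cases t') (auto simp: T_comp_def)
qed (simp add: T_comp_def)

lemma trm_cases:
  obtains (var) "is_var t" | (app) \<phi> u where "sorts u = opr_src \<phi>" "t = app \<phi> u"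
proof (cases t)
  case (TA a)
  show ?thesis
  proof (cases a)
    case (AVar k)
    then show ?thesis using TA var by (auto simp: is_var_def)
  next
    case (ANu b)
    then show ?thesis using TA app[of "[TA b]" ONu] by simp
  qed
next
  case (TF x)
  show ?thesis
  proof (cases x)
    case (FVar k)
    then show ?thesis using TF var by (auto simp: is_var_def)
  next
    case (FIota a)
    then show ?thesis using TF app[of "[TA a]" OIota] by simp
  next
    case FTop
    then show ?thesis using TF app[of "[]" OTop] by simp
  next
    case FBot
    then show ?thesis using TF app[of "[]" OBot] by simp
  next
    case (FAnd y z)
    then show ?thesis using TF app[of "[TF y, TF z]" OAnd] by simp
  next
    case (FOr y z)
    then show ?thesis using TF app[of "[TF y, TF z]" OOr] by simp
  qed
qed

fun aleaf :: "aterm \<Rightarrow> trm" where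
  "aleaf (AVar k) = TA (AVar k)"
| "aleaf (ANu a) = aleaf a"

fun fleaves :: "fterm \<Rightarrow> family" where
  "fleaves (FVar k) = [TF (FVar k)]"
| "fleaves (FIota a) = [aleaf a]"
| "fleaves FTop = []"
| "fleaves FBot = []"
| "fleaves (x \<^bold>\<and> y) = fleaves x @ fleaves y"
| "fleaves (x \<^bold>\<or> y) = fleaves x @ fleaves y"

fun leaves :: "family \<Rightarrow> family" where
  "leaves [] = []"
| "leaves (TA a # u) = aleaf a # leaves u"
| "leaves (TF x # u) = fleaves x @ leaves u"

fun acirc :: "aterm \<Rightarrow> circuit" where
  "acirc (AVar k) = ide [At]"
| "acirc (ANu a) = opc ONu \<odot> acirc a"

fun fcirc :: "fterm \<Rightarrow> circuit" where
  "fcirc (FVar k) = ide [Fm]"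
| "fcirc (FIota a) = opc OIota \<odot> acirc a"
| "fcirc FTop = opc OTop"
| "fcirc FBot = opc OBot"
| "fcirc (x \<^bold>\<and> y) = opc OAnd \<odot> (fcirc x \<otimes> fcirc y)"
| "fcirc (x \<^bold>\<or> y) = opc OOr \<odot> (fcirc x \<otimes> fcirc y)"

fun trees :: "family \<Rightarrow> circuit" where
  "trees [] = ide []"
| "trees (TA a # u) = acirc a \<otimes> trees u"
| "trees (TF x # u) = fcirc x \<otimes> trees u"

lemma leaves_append [simp]: "leaves (u @ v) = leaves u @ leaves v"
  by (induction u rule: leaves.induct) auto

lemma trees_append: "trees (u @ v) = trees u \<otimes> trees v"
  by (induction u rule: leaves.induct) auto

lemma acirc_types [simp]: "csrc (acirc a) = [At]" "ctgt (acirc a) = [At]" "sort_of (aleaf a) = At"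
  by (induction a) auto

lemma fcirc_types [simp]: "csrc (fcirc x) = sorts (fleaves x) \<and> ctgt (fcirc x) = [Fm]"
  by (induction x) auto

lemma trees_types [simp]: "csrc (trees u) = sorts (leaves u)" "ctgt (trees u) = sorts u"
  by (induction u rule: leaves.induct) auto

lemma leaves_vars: "is_var t \<Longrightarrow> leaves [t] = [t]" "is_var t \<Longrightarrow> trees [t] = ide [sort_of t]"
  by (auto simp: is_var_def)

lemma leaves_Cons: "leaves (t # u) = leaves [t] @ leaves u"
  by (cases t) auto

lemma leaves_app: "sorts u = opr_src \<phi> \<Longrightarrow> leaves [app \<phi> u] = leaves u"
  by (cases \<phi>) (auto simp: sort_cases)

lemma trees_app: "sorts u = opr_src \<phi> \<Longrightarrow> trees [app \<phi> u] = opc \<phi> \<odot> trees u"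
  by (cases \<phi>) (auto simp: sort_cases)

lemma trees_app_context:
  assumes "sorts u = opr_src \<phi>"
  shows "trees (p @ app \<phi> u # r) = whisk (sorts p) (opc \<phi>) (sorts r) \<odot> trees (p @ u @ r)"
proof -
  have "trees (p @ app \<phi> u # r) = trees p \<otimes> (opc \<phi> \<odot> trees u) \<otimes> trees r"
    using trees_append[of p "[app \<phi> u] @ r"] trees_append[of "[app \<phi> u]" r] trees_app[OF assms]
    by simp
  then show ?thesis
    using assms by (simp add: whisk_def interchange trees_append)
qed

lemma trees_slide:
  assumes "csrc f = X" "ctgt f = Y"
  shows "whisk (sorts p) f (sorts r) \<odot> (trees p \<otimes> ide X \<otimes> trees r) =
    (trees p \<otimes> ide Y \<otimes> trees r) \<odot> whisk (sorts (leaves p)) f (sorts (leaves r))"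
  using assms by (simp add: whisk_def interchange)

section \<open>Canonical circuits: erasers, resources, forest\<close>

fun era :: "trm set \<Rightarrow> family \<Rightarrow> circuit" where
  "era S [] = ide []"
| "era S (t # T) = (if t \<in> S then ide [sort_of t] else \<epsilon> (sort_of t)) \<otimes> era S T"

lemma era_types [simp]: "csrc (era S T) = sorts T \<and> ctgt (era S T) = sorts (filter (\<lambda>t. t \<in> S) T)"
  by (induction T) auto

lemma era_append: "era S (T @ T') = era S T \<otimes> era S T'"
  by (induction T) auto

lemma era_cong: "(\<And>t. t \<in> set T \<Longrightarrow> t \<in> S \<longleftrightarrow> t \<in> S') \<Longrightarrow> era S T = era S' T"
  by (induction T) auto

lemma era_remove:
  assumes "filter (\<lambda>t. t \<in> S) T = P @ i # Q" "distinct T"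
  shows "whisk (sorts P) (\<epsilon> (sort_of i)) (sorts Q) \<odot> era S T = era (S - {i}) T"
    and "filter (\<lambda>t. t \<in> S - {i}) T = P @ Q"
proof -
  have i: "i \<in> set (filter (\<lambda>t. t \<in> S) T)" using assms(1) by simp
  then have iS: "i \<in> S" and "i \<in> set T" by auto
  then obtain T1 T2 where T': "T = T1 @ i # T2" by (auto dest: split_list)
  then have "filter (\<lambda>t. t \<in> S) T1 @ i # filter (\<lambda>t. t \<in> S) T2 = P @ i # Q"
    using iS assms(1) by simp
  moreover have "i \<notin> set T1" "i \<notin> set T2" using assms(2) T' by auto
  ultimately have T: "T = T1 @ i # T2" "filter (\<lambda>t. t \<in> S) T1 = P"
      "filter (\<lambda>t. t \<in> S) T2 = Q" "i \<in> S"
    using T' iS append_Cons_eq_iff[of i "filter (\<lambda>t. t \<in> S) T1" "filter (\<lambda>t. t \<in> S) T2" P Q] by auto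
  have "era (S - {i}) T1 = era S T1" "era (S - {i}) T2 = era S T2"
    using assms(2) T(1) by (auto intro!: era_cong)
  then show "whisk (sorts P) (\<epsilon> (sort_of i)) (sorts Q) \<odot> era S T = era (S - {i}) T"
    using T by (simp add: era_append whisk_def interchange)
  have "filter (\<lambda>t. t \<in> S - {i}) T1 = P" "filter (\<lambda>t. t \<in> S - {i}) T2 = Q"
    using assms(2) T by (auto intro!: filter_cong)
  then show "filter (\<lambda>t. t \<in> S - {i}) T = P @ Q"
    using T by simp
qed

definition canonical :: "word \<Rightarrow> family \<Rightarrow> circuit \<Rightarrow> bool" where
  "canonical X u f \<longleftrightarrow> (\<exists>d. res (filter (\<lambda>t. t \<in> set (leaves u)) (T_id X)) (leaves u) d \<and>
    f = trees u \<odot> d \<odot> era (set (leaves u)) (T_id X))"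

text \<open>The family fixes the erasers and the forest, and \<open>res_unique\<close> the layer
  between them.\<close>

lemma canonical_unique: "canonical X u f \<Longrightarrow> canonical X u g \<Longrightarrow> f = g"
  unfolding canonical_def using res_unique by blast

lemma sorts_T_id' [simp]: "sorts (T_id X) = X"
  by (simp add: T_id_def sorts_T_id)

lemma T_id_vars: "t \<in> set (T_id_from m n X) \<Longrightarrow>
    (\<exists>k\<ge>m. t = TA (AVar k)) \<or> (\<exists>k\<ge>n. t = TF (FVar k))"
  by (induction m n X rule: T_id_from.induct) (auto dest: Suc_leD)

lemma distinct_T_id [simp]: "distinct (T_id X)"
proof -
  have "distinct (T_id_from m n X)" for m n
    by (induction m n X rule: T_id_from.induct) (auto dest: T_id_vars)
  then show ?thesis by (simp add: T_id_def)
qed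

lemma leaves_T_id [simp]: "leaves (T_id X) = T_id X" "trees (T_id X) = ide X"
proof -
  have "leaves (T_id_from m n X) = T_id_from m n X" "trees (T_id_from m n X) = ide X" for m n
    by (induction m n X rule: T_id_from.induct) (auto simp: tensor_ide)
  then show "leaves (T_id X) = T_id X" "trees (T_id X) = ide X" by (simp_all add: T_id_def)
qed

lemma res_ide: "distinct L \<Longrightarrow> res L L (ide (sorts L))"
proof (induction L rule: rev_induct)
  case (snoc i L)
  then show ?case
    using res_snoc[of L L "ide (sorts L)" "L @ [i]" i "ide (sorts (L @ [i]))"] emit_move[of i L "[]"]
    by simp
qed (simp add: res_Nil)

lemma canonical_ide: "canonical X (T_id X) (ide X)"
proof -
  have "era S T = ide (sorts T)" if "set T \<subseteq> S" for S T
    using that by (induction T) (auto simp: tensor_ide)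
  then show ?thesis
    unfolding canonical_def
    by (intro exI[of _ "ide X"]) (use res_ide[of "T_id X"] in \<open>simp add: filter_True\<close>)
qed

lemma canonical_opr:
  assumes "canonical X (p @ q @ r) f" "sorts q = opr_src \<phi>"
  shows "canonical X (p @ app \<phi> q # r) (whisk (sorts p) (opc \<phi>) (sorts r) \<odot> f)"
proof -
  have l: "leaves (p @ app \<phi> q # r) = leaves (p @ q @ r)"
    using leaves_app[OF assms(2)] leaves_Cons[of "app \<phi> q" r] by simp
  obtain d where d: "res (filter (\<lambda>t. t \<in> set (leaves (p @ q @ r))) (T_id X)) (leaves (p @ q @ r)) d"
      "f = trees (p @ q @ r) \<odot> d \<odot> era (set (leaves (p @ q @ r))) (T_id X)"
    using assms(1) unfolding canonical_def by blast
  have "whisk (sorts p) (opc \<phi>) (sorts r) \<odot> f =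
      trees (p @ app \<phi> q # r) \<odot> d \<odot> era (set (leaves (p @ q @ r))) (T_id X)"
    unfolding d(2) trees_app_context[OF assms(2)] using res_types[OF d(1)] assms(2)
    by (simp add: comp_assoc)
  then show ?thesis
    using d(1) unfolding canonical_def l by blast
qed

text \<open>The root operator of an output can be made the last generator of the circuit, where
  \<open>k\<close> meets it directly.\<close>

lemma canonical_redex:
  assumes "canonical X (p @ app \<phi> q # r) f" "sorts q = opr_src \<phi>" "csrc k = sorts (p @ app \<phi> q # r)"
    and "reducible (k \<odot> whisk (sorts p) (opc \<phi>) (sorts r))"
  shows "reducible (k \<odot> f)"
proof -
  obtain d where d: "res (filter (\<lambda>t. t \<in> set (leaves (p @ app \<phi> q # r))) (T_id X))
        (leaves (p @ app \<phi> q # r)) d"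
      "f = trees (p @ app \<phi> q # r) \<odot> d \<odot> era (set (leaves (p @ app \<phi> q # r))) (T_id X)"
    using assms(1) unfolding canonical_def by blast
  have l: "leaves (p @ app \<phi> q # r) = leaves (p @ q @ r)"
    using leaves_app[OF assms(2)] leaves_Cons[of "app \<phi> q" r] by simp
  have "k \<odot> f = (k \<odot> whisk (sorts p) (opc \<phi>) (sorts r)) \<odot>
      trees (p @ q @ r) \<odot> d \<odot> era (set (leaves (p @ q @ r))) (T_id X)"
    unfolding d(2) trees_app_context[OF assms(2)] l using res_types[OF d(1)] assms(2,3) l
    by (simp add: comp_assoc)
  then show ?thesis
    using res_types[OF d(1)] assms l by (auto intro!: reducible_comp_right)
qed

text \<open>On outputs \<open>q\<close> that are variables the forest is an identity, so any
  \<open>c\<close> placed under them slides up to the resource layer \<open>d\<close>. The erasers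
  are still those for the old outputs.\<close>

lemma canonical_vars:
  assumes "canonical X (p @ q @ r) f" "leaves q = q" "trees q = ide (sorts q)"
  obtains d where "res (filter (\<lambda>t. t \<in> set (leaves p @ q @ leaves r)) (T_id X)) (leaves p @ q @ leaves r) d"
    "\<And>c q'. csrc c = sorts q \<Longrightarrow> ctgt c = sorts q' \<Longrightarrow> leaves q' = q' \<Longrightarrow> trees q' = ide (sorts q') \<Longrightarrow>
      whisk (sorts p) c (sorts r) \<odot> f = trees (p @ q' @ r) \<odot>
        (whisk (sorts (leaves p)) c (sorts (leaves r)) \<odot> d) \<odot>
        era (set (leaves p @ q @ leaves r)) (T_id X)"
proof -
  obtain d where d: "res (filter (\<lambda>t. t \<in> set (leaves p @ q @ leaves r)) (T_id X)) (leaves p @ q @ leaves r) d"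
      "f = trees (p @ q @ r) \<odot> d \<odot> era (set (leaves p @ q @ leaves r)) (T_id X)"
    using assms unfolding canonical_def by auto
  note t = res_types[OF d(1)]
  show thesis
  proof (rule that[OF d(1)])
    fix c q'
    assume c: "csrc c = sorts q" "ctgt c = sorts q'" "leaves q' = q'" "trees q' = ide (sorts q')"
    have "whisk (sorts p) c (sorts r) \<odot> trees (p @ q @ r) =
        trees (p @ q' @ r) \<odot> whisk (sorts (leaves p)) c (sorts (leaves r))"
      using trees_slide[OF c(1,2), of p r] by (simp add: trees_append assms c)
    then have "whisk (sorts p) c (sorts r) \<odot> trees (p @ q @ r) \<odot> d = 
        trees (p @ q' @ r) \<odot> whisk (sorts (leaves p)) c (sorts (leaves r)) \<odot> d"
      by (rule comp_slide) (use t c assms in auto)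
    then show "whisk (sorts p) c (sorts r) \<odot> f = trees (p @ q' @ r) \<odot>
        (whisk (sorts (leaves p)) c (sorts (leaves r)) \<odot> d) \<odot>
        era (set (leaves p @ q @ leaves r)) (T_id X)"
      unfolding d(2) using t c assms by (simp add: comp_assoc_ex)
  qed
qed

lemma canonical_or_reducibleI:
  assumes "reducible d' \<or> res (filter (\<lambda>t. t \<in> set (leaves u)) (T_id X)) (leaves u) d'"
    and "f = trees u \<odot> d' \<odot> era (set (leaves u)) (T_id X)"
    and "ctgt d' = sorts (leaves u)" "csrc d' = sorts (filter (\<lambda>t. t \<in> set (leaves u)) (T_id X))"
  shows "reducible f \<or> canonical X u f"
  using assms(1)
proof
  assume r: "reducible d'"
  show ?thesis
    unfolding assms(2)
    by (rule disjI1, rule reducible_comp_left, rule reducible_comp_right) (use r assms in auto)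
qed (use assms(2) in \<open>auto simp: canonical_def\<close>)

lemma canonical_delta:
  assumes f: "canonical X (p @ t # r) f"
  shows "reducible (whisk (sorts p) (\<delta> (sort_of t)) (sorts r) \<odot> f) \<or>
    canonical X (p @ t # t # r) (whisk (sorts p) (\<delta> (sort_of t)) (sorts r) \<odot> f)"
proof (cases t rule: trm_cases)
  case var
  note v = leaves_vars[OF var]
  have l: "leaves [t, t] = [t, t]" "trees [t, t] = ide (sorts [t, t])"
    using leaves_append[of "[t]" "[t]"] trees_append[of "[t]" "[t]"] v by (simp_all add: tensor_ide)
  obtain d where d: "res (filter (\<lambda>i. i \<in> set (leaves p @ [t] @ leaves r)) (T_id X)) (leaves p @ [t] @ leaves r) d"
      "\<And>c q'. csrc c = sorts [t] \<Longrightarrow> ctgt c = sorts q' \<Longrightarrow> leaves q' = q' \<Longrightarrow> trees q' = ide (sorts q') \<Longrightarrow>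
      whisk (sorts p) c (sorts r) \<odot> f = trees (p @ q' @ r) \<odot>
        (whisk (sorts (leaves p)) c (sorts (leaves r)) \<odot> d) \<odot>
        era (set (leaves p @ [t] @ leaves r)) (T_id X)"
    using canonical_vars[of X p "[t]" r f] f v by auto
  have L: "leaves (p @ t # t # r) = leaves p @ t # t # leaves r"
    using leaves_append[of "[t, t]" r] l by simp
  have S: "set (leaves (p @ t # t # r)) = set (leaves p @ [t] @ leaves r)"
    unfolding L by auto
  show ?thesis
  proof (rule canonical_or_reducibleI)
    have d1: "res (filter (\<lambda>i. i \<in> set (leaves (p @ t # t # r))) (T_id X)) (leaves p @ t # leaves r) d"
      using d(1) unfolding S by simp
    let ?d = "whisk (sorts (leaves p)) (\<delta> (sort_of t)) (sorts (leaves r)) \<odot> d"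
    show "reducible ?d \<or> res (filter (\<lambda>i. i \<in> set (leaves (p @ t # t # r))) (T_id X))
        (leaves (p @ t # t # r)) ?d"
      using res_delta[OF d1] unfolding L .
    show "whisk (sorts p) (\<delta> (sort_of t)) (sorts r) \<odot> f = trees (p @ t # t # r) \<odot> ?d \<odot>
        era (set (leaves (p @ t # t # r))) (T_id X)"
      using d(2)[of "\<delta> (sort_of t)" "[t, t]"] l unfolding S by simp
    show "ctgt ?d = sorts (leaves (p @ t # t # r))"
      "csrc ?d = sorts (filter (\<lambda>i. i \<in> set (leaves (p @ t # t # r))) (T_id X))"
      using res_types[OF d1] unfolding L by simp_all
  qed
next
  case (app \<phi> u)
  have "reducible (whisk (sorts p) (\<delta> (opr_tgt \<phi>) \<odot> opc \<phi>) (sorts r))"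
    by (rule reducible_whisk, rule redexes)
  then have "reducible (whisk (sorts p) (\<delta> (sort_of t)) (sorts r) \<odot> f)"
    by (intro canonical_redex[OF f[unfolded app(2)] app(1)]) (simp_all add: whisk_comp app)
  then show ?thesis ..
qed

lemma canonical_eps:
  assumes f: "canonical X (p @ t # r) f"
  shows "reducible (whisk (sorts p) (\<epsilon> (sort_of t)) (sorts r) \<odot> f) \<or>
    canonical X (p @ r) (whisk (sorts p) (\<epsilon> (sort_of t)) (sorts r) \<odot> f)"
proof (cases t rule: trm_cases)
  case var
  note v = leaves_vars[OF var]
  let ?L = "filter (\<lambda>i. i \<in> set (leaves p @ [t] @ leaves r)) (T_id X)"
  obtain d where d: "res ?L (leaves p @ [t] @ leaves r) d"
      "\<And>c q'. csrc c = sorts [t] \<Longrightarrow> ctgt c = sorts q' \<Longrightarrow> leaves q' = q' \<Longrightarrow> trees q' = ide (sorts q') \<Longrightarrow>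
      whisk (sorts p) c (sorts r) \<odot> f = trees (p @ q' @ r) \<odot>
        (whisk (sorts (leaves p)) c (sorts (leaves r)) \<odot> d) \<odot>
        era (set (leaves p @ [t] @ leaves r)) (T_id X)"
    using canonical_vars[of X p "[t]" r f] f v by auto
  let ?s = "whisk (sorts (leaves p)) (\<epsilon> (sort_of t)) (sorts (leaves r)) \<odot> d"
  note t = res_types[OF d(1)]
  have eq: "whisk (sorts p) (\<epsilon> (sort_of t)) (sorts r) \<odot> f =
      trees (p @ r) \<odot> ?s \<odot> era (set (leaves p @ [t] @ leaves r)) (T_id X)"
    using d(2)[of "\<epsilon> (sort_of t)" "[]"] by simp
  from res_eps[of ?L "leaves p" t "leaves r" d] d(1)
  have "reducible ?s \<or> (\<exists>P Q d'. ?L = P @ t # Q \<and> res (P @ Q) (leaves p @ leaves r) d' \<and>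
      ?s = d' \<odot> whisk (sorts P) (\<epsilon> (sort_of t)) (sorts Q))"
    by simp
  then show ?thesis
  proof (elim disjE exE conjE)
    assume r: "reducible ?s"
    show ?thesis
      unfolding eq
      by (rule disjI1, rule reducible_comp_left, rule reducible_comp_right) (use r t in auto)
  next
    fix P Q d'
    assume a: "?L = P @ t # Q" "res (P @ Q) (leaves p @ leaves r) d'"
      "?s = d' \<odot> whisk (sorts P) (\<epsilon> (sort_of t)) (sorts Q)"
    note td = res_types[OF a(2)]
    have "distinct (P @ t # Q)" using t unfolding a(1) by simp
    then have "t \<notin> set (P @ Q)" by simp
    \<comment> \<open>\<open>t\<close> is no longer an input of \<open>d'\<close>, hence not an
      output either: the set of leaves loses exactly \<open>t\<close>, and \<open>era_remove\<close>
      absorbs the eraser.\<close>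
    then have "set (leaves p @ [t] @ leaves r) - {t} = set (leaves (p @ r))"
      using td by auto
    note era = era_remove[OF a(1) distinct_T_id, unfolded this]
    have "whisk (sorts p) (\<epsilon> (sort_of t)) (sorts r) \<odot> f =
        trees (p @ r) \<odot> d' \<odot> whisk (sorts P) (\<epsilon> (sort_of t)) (sorts Q) \<odot>
        era (set (leaves p @ [t] @ leaves r)) (T_id X)"
      unfolding eq a(3) using td a(1) by (simp add: comp_assoc)
    also have "\<dots> = trees (p @ r) \<odot> d' \<odot> era (set (leaves (p @ r))) (T_id X)"
      by (simp only: era)
    finally show ?thesis
      using a(2) era(2) unfolding canonical_def by auto
  qed
next
  case (app \<phi> u)
  have "reducible (whisk (sorts p) (\<epsilon> (opr_tgt \<phi>) \<odot> opc \<phi>) (sorts r))"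
    by (rule reducible_whisk, rule redexes)
  then have "reducible (whisk (sorts p) (\<epsilon> (sort_of t)) (sorts r) \<odot> f)"
    by (intro canonical_redex[OF f[unfolded app(2)] app(1)]) (simp_all add: whisk_comp app)
  then show ?thesis ..
qed

text \<open>An output with a root operator lets the crossing pass, by \<open>E_tau_opr\<close> on
  the left and \<open>R_tau_opr\<close> on the right; two variables are swapped in the resource
  layer by \<open>res_tau\<close>.\<close>

lemma canonical_tau:
  assumes f: "canonical X (p @ t # t' # r) f"
  shows "reducible (whisk (sorts p) (\<tau> (sort_of t) (sort_of t')) (sorts r) \<odot> f) \<or>
    canonical X (p @ t' # t # r) (whisk (sorts p) (\<tau> (sort_of t) (sort_of t')) (sorts r) \<odot> f)"
proof (cases t rule: trm_cases)
  case t: var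
  show ?thesis
  proof (cases t' rule: trm_cases)
    case t': var
    have l: "leaves [t, t'] = [t, t']" "trees [t, t'] = ide (sorts [t, t'])"
       "leaves [t', t] = [t', t]" "trees [t', t] = ide (sorts [t', t])"
      using leaves_append[of "[t]" "[t']"] trees_append[of "[t]" "[t']"] leaves_vars[OF t]
        leaves_append[of "[t']" "[t]"] trees_append[of "[t']" "[t]"] leaves_vars[OF t']
      by (simp_all add: tensor_ide)
    obtain d where d: "res (filter (\<lambda>i. i \<in> set (leaves p @ [t, t'] @ leaves r)) (T_id X))
          (leaves p @ [t, t'] @ leaves r) d"
        "\<And>c q'. csrc c = sorts [t, t'] \<Longrightarrow> ctgt c = sorts q' \<Longrightarrow> leaves q' = q' \<Longrightarrow>
        trees q' = ide (sorts q') \<Longrightarrow> whisk (sorts p) c (sorts r) \<odot> f = trees (p @ q' @ r) \<odot>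
          (whisk (sorts (leaves p)) c (sorts (leaves r)) \<odot> d) \<odot>
          era (set (leaves p @ [t, t'] @ leaves r)) (T_id X)"
      using canonical_vars[of X p "[t, t']" r f] f l by auto
    have L: "leaves (p @ t' # t # r) = leaves p @ t' # t # leaves r"
      using leaves_append[of "[t', t]" r] l by simp
    have S: "set (leaves (p @ t' # t # r)) = set (leaves p @ [t, t'] @ leaves r)"
      unfolding L by auto
    show ?thesis
    proof (rule canonical_or_reducibleI)
      have d1: "res (filter (\<lambda>i. i \<in> set (leaves (p @ t' # t # r))) (T_id X))
          (leaves p @ t # t' # leaves r) d"
        using d(1) unfolding S by simp
      let ?d = "whisk (sorts (leaves p)) (\<tau> (sort_of t) (sort_of t')) (sorts (leaves r)) \<odot> d"
      show "reducible ?d \<or> res (filter (\<lambda>i. i \<in> set (leaves (p @ t' # t # r))) (T_id X))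
          (leaves (p @ t' # t # r)) ?d"
        using res_tau[OF d1] unfolding L .
      show "whisk (sorts p) (\<tau> (sort_of t) (sort_of t')) (sorts r) \<odot> f =
          trees (p @ t' # t # r) \<odot> ?d \<odot> era (set (leaves (p @ t' # t # r))) (T_id X)"
        using d(2)[of "\<tau> (sort_of t) (sort_of t')" "[t', t]"] l unfolding S by simp
      show "ctgt ?d = sorts (leaves (p @ t' # t # r))"
        "csrc ?d = sorts (filter (\<lambda>i. i \<in> set (leaves (p @ t' # t # r))) (T_id X))"
        using res_types[OF d1] unfolding L by simp_all
    qed
  next
    case (app \<phi> u)
    have "reducible (whisk (sorts p) (\<tau> (sort_of t) (opr_tgt \<phi>) \<odot> whisk [sort_of t] (opc \<phi>) []) (sorts r))"
      by (rule reducible_whisk, rule redexes)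
    moreover have f': "canonical X ((p @ [t]) @ app \<phi> u # r) f"
      using f app(2) by simp
    ultimately have "reducible (whisk (sorts p) (\<tau> (sort_of t) (sort_of t')) (sorts r) \<odot> f)"
      by (intro canonical_redex[OF f' app(1)]) (simp_all add: whisk_comp app)
    then show ?thesis ..
  qed
next
  case (app \<phi> u)
  have "reducible (whisk (sorts p) (\<tau> (opr_tgt \<phi>) (sort_of t') \<odot> whisk [] (opc \<phi>) [sort_of t']) (sorts r))"
    by (rule reducible_whisk, rule redexes)
  then have "reducible (whisk (sorts p) (\<tau> (sort_of t) (sort_of t')) (sorts r) \<odot> f)"
    by (intro canonical_redex[OF f[unfolded app(2)] app(1)]) (simp_all add: whisk_comp app)
  then show ?thesis ..
qed

lemma canonical_gen:
  assumes "canonical X (p @ q @ r) f" "sorts q = gen_src c"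
  shows "reducible (whisk (sorts p) (cgen c) (sorts r) \<odot> f) \<or>
    canonical X (p @ T_comp (gen_proj c) q @ r) (whisk (sorts p) (cgen c) (sorts r) \<odot> f)"
proof (cases c)
  case (Opr \<phi>)
  then show ?thesis
    using canonical_opr[OF assms(1)] assms(2) by (simp add: T_comp_gen del: gen_proj.simps)
next
  case (Delta Y)
  then obtain t where "q = [t]" "sort_of t = Y" using assms(2) by auto
  then show ?thesis
    using canonical_delta[of X p t r f] assms Delta by (simp add: T_comp_gen del: gen_proj.simps)
next
  case (Eps Y)
  then obtain t where "q = [t]" "sort_of t = Y" using assms(2) by auto
  then show ?thesis
    using canonical_eps[of X p t r f] assms Eps by (simp add: T_comp_gen del: gen_proj.simps)
next
  case (Tau Y Z)
  then obtain t t' where "q = [t, t']" "sort_of t = Y" "sort_of t' = Z" using assms(2) by auto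
  then show ?thesis
    using canonical_tau[of X p t t' r f] assms Tau by (simp add: T_comp_gen del: gen_proj.simps)
qed

lemma split_sorts:
  assumes "sorts u = Y @ W @ Z"
  obtains p q r where "u = p @ q @ r" "sorts p = Y" "sorts q = W" "sorts r = Z"
proof (rule that)
  let ?v = "drop (length Y) u"
  show "u = take (length Y) u @ take (length W) ?v @ drop (length W) ?v"
    by (simp only: append_take_drop_id)
qed (use assms in \<open>simp_all add: take_map[symmetric] drop_map[symmetric]\<close>)

text \<open>A prefix of a normal form is normal, hence canonical by induction, and
  \<open>canonical_gen\<close> then leaves only its second alternative.\<close>

lemma normal_canonical: "normal_form f \<Longrightarrow> canonical (csrc f) (proj f) f"
proof (induction f rule: circuit_induct)
  case (ide X)
  then show ?case by (simp add: canonical_ide)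
next
  case (gen f Y c Z)
  have nf: "\<not> reducible (whisk Y (cgen c) Z \<odot> f)"
    using gen by (simp add: normal_form_def reducible_def)
  then have "\<not> reducible f"
    using reducible_comp_left[of f "whisk Y (cgen c) Z"] gen(2) by auto
  then have can: "canonical (csrc f) (proj f) f"
    using gen by (simp add: normal_form_def reducible_def)
  obtain p q r where pqr: "proj f = p @ q @ r" "sorts p = Y" "sorts q = gen_src c" "sorts r = Z"
    using gen(2) split_sorts[of "proj f" Y "gen_src c" Z] by auto
  then have "proj (whisk Y (cgen c) Z \<odot> f) = p @ T_comp (gen_proj c) q @ r"
    using proj_whisk[of f Y "cgen c" Z p q r] gen(2) by simp
  then show ?case
    using canonical_gen[of "csrc f" p q r f c] can pqr nf gen(2) by simp
qed

section \<open>Normal forms and congruence\<close>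

lemma E_Delta_parallel: "E_Delta f g \<Longrightarrow> csrc f = csrc g \<and> ctgt f = ctgt g"
  using R_Delta_parallel[OF R_E] .

lemmas proj_calc = T_comp_def T_tensor_def T_shift_def T_id_def

lemma E_Delta_proj: "E_Delta f g \<Longrightarrow> proj f = proj g"
proof (induction rule: E_Delta.induct)
  case (E_coassoc X)
  then show ?case by (cases X) (simp_all add: proj_calc)
next
  case (E_cocomm X)
  then show ?case by (cases X) (simp_all add: proj_calc)
next
  case (E_counit X)
  then show ?case by (cases X) (simp_all add: proj_calc)
next
  case (E_tau_tau Y X)
  then show ?case by (cases X; cases Y) (simp_all add: proj_calc)
next
  case (E_delta_tau Y X)
  then show ?case by (cases X; cases Y) (simp_all add: proj_calc)
next
  case (E_eps_tau Y X)
  then show ?case by (cases X; cases Y) (simp_all add: proj_calc)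
next
  case (E_Yang_Baxter Z X Y)
  then show ?case by (cases X; cases Y; cases Z) (simp_all add: proj_calc)
next
  case (E_tau_opr \<phi> X)
  then show ?case by (cases X; cases \<phi>) (simp_all add: proj_calc)
next
  case (E_delta_opr \<phi>)
  then show ?case by (cases \<phi>) (simp_all add: proj_calc)
next
  case (E_eps_opr \<phi>)
  then show ?case by (cases \<phi>) (simp_all add: proj_calc)
qed

lemma circuit_step_parallel:
  assumes "circuit_step P f g" "\<And>s t. P s t \<Longrightarrow> csrc s = csrc t \<and> ctgt s = ctgt t"
  shows "csrc f = csrc g \<and> ctgt f = ctgt g"
  using assms unfolding circuit_step_whisk by fastforce

lemma circuit_step_comp_left:
  assumes "circuit_step P f g" "csrc k = ctgt f" "\<And>s t. P s t \<Longrightarrow> csrc s = csrc t \<and> ctgt s = ctgt t"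
  shows "circuit_step P (k \<odot> f) (k \<odot> g)"
proof -
  obtain s t h k' Y Z where *: "P s t" "ctgt h = Y @ csrc s @ Z" "csrc k' = Y @ ctgt s @ Z"
      "f = k' \<odot> whisk Y s Z \<odot> h" "g = k' \<odot> whisk Y t Z \<odot> h"
    using assms(1) unfolding circuit_step_whisk by blast
  then have "k \<odot> f = (k \<odot> k') \<odot> whisk Y s Z \<odot> h" "k \<odot> g = (k \<odot> k') \<odot> whisk Y t Z \<odot> h"
      "csrc (k \<odot> k') = Y @ ctgt s @ Z"
    using assms(2) assms(3)[OF *(1)] by (simp_all add: comp_assoc)
  then show ?thesis
    using * unfolding circuit_step_whisk by blast
qed

lemma circuit_step_comp_right:
  assumes "circuit_step P f g" "ctgt h = csrc f" "\<And>s t. P s t \<Longrightarrow> csrc s = csrc t \<and> ctgt s = ctgt t"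
  shows "circuit_step P (f \<odot> h) (g \<odot> h)"
proof -
  obtain s t h' k Y Z where *: "P s t" "ctgt h' = Y @ csrc s @ Z" "csrc k = Y @ ctgt s @ Z"
      "f = k \<odot> whisk Y s Z \<odot> h'" "g = k \<odot> whisk Y t Z \<odot> h'"
    using assms(1) unfolding circuit_step_whisk by blast
  then have "f \<odot> h = k \<odot> whisk Y s Z \<odot> h' \<odot> h" "g \<odot> h = k \<odot> whisk Y t Z \<odot> h' \<odot> h"
      "ctgt (h' \<odot> h) = Y @ csrc s @ Z"
    using assms(2) assms(3)[OF *(1)] by (simp_all add: comp_assoc)
  then show ?thesis
    using * unfolding circuit_step_whisk by blast
qed

lemma circuit_step_whiskI:
  assumes "circuit_step P f g" "\<And>s t. P s t \<Longrightarrow> csrc s = csrc t \<and> ctgt s = ctgt t"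
  shows "circuit_step P (whisk A f B) (whisk A g B)"
proof -
  obtain s t h k Y Z where *: "P s t" "ctgt h = Y @ csrc s @ Z" "csrc k = Y @ ctgt s @ Z"
      "f = k \<odot> whisk Y s Z \<odot> h" "g = k \<odot> whisk Y t Z \<odot> h"
    using assms(1) unfolding circuit_step_whisk by blast
  then have "whisk A f B = whisk A k B \<odot> whisk (A @ Y) s (Z @ B) \<odot> whisk A h B"
      "whisk A g B = whisk A k B \<odot> whisk (A @ Y) t (Z @ B) \<odot> whisk A h B"
      "ctgt (whisk A h B) = (A @ Y) @ csrc s @ Z @ B" "csrc (whisk A k B) = (A @ Y) @ ctgt s @ Z @ B"
    using assms(2)[OF *(1)] by (simp_all add: whisk_comp)
  then show ?thesis
    using * unfolding circuit_step_whisk by blast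
qed

lemma circuit_step_root:
  assumes "P s t" "csrc s = csrc t \<and> ctgt s = ctgt t"
  shows "circuit_step P s t"
proof -
  have "s = ide (ctgt s) \<odot> whisk [] s [] \<odot> ide (csrc s)" "t = ide (ctgt s) \<odot> whisk [] t [] \<odot> ide (csrc s)"
    using assms by simp_all
  then show ?thesis
    using assms(1) unfolding circuit_step_whisk
    by (metis append_Nil append_Nil2 csrc_simps(1) ctgt_simps(1))
qed

section \<open>The congruence generated by the resource relations\<close>

definition E_sym :: "circuit \<Rightarrow> circuit \<Rightarrow> bool" where
  "E_sym f g \<longleftrightarrow> E_Delta f g \<or> E_Delta g f"

lemma E_sym_parallel: "E_sym s t \<Longrightarrow> csrc s = csrc t \<and> ctgt s = ctgt t"
  using E_Delta_parallel unfolding E_sym_def by metis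

definition econg :: "circuit \<Rightarrow> circuit \<Rightarrow> bool" where
  "econg = (circuit_step E_sym)\<^sup>*\<^sup>*"

lemma econg_refl: "econg f f"
  by (simp add: econg_def)

lemma econg_trans [trans]: "econg f g \<Longrightarrow> econg g h \<Longrightarrow> econg f h"
  by (simp add: econg_def)

lemma econg_sym: "econg f g \<Longrightarrow> econg g f"
proof -
  have "symp (circuit_step E_sym)"
  proof (rule sympI)
    fix f g
    assume "circuit_step E_sym f g"
    then obtain s t h k Y Z where *: "E_sym s t" "ctgt h = Y @ csrc s @ Z" "csrc k = Y @ ctgt s @ Z"
        "f = k \<odot> whisk Y s Z \<odot> h" "g = k \<odot> whisk Y t Z \<odot> h"
      unfolding circuit_step_whisk by blast
    moreover have "E_sym t s" using *(1) by (auto simp: E_sym_def)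
    ultimately show "circuit_step E_sym g f"
      unfolding circuit_step_whisk using E_sym_parallel[OF *(1)]
      by (intro exI[of _ t] exI[of _ s] exI[of _ h] exI[of _ k] exI[of _ Y] exI[of _ Z]) simp
  qed
  then show "econg f g \<Longrightarrow> econg g f"
    unfolding econg_def by (simp add: symp_rtranclp sympD)
qed

lemma econg_parallel: "econg f g \<Longrightarrow> csrc f = csrc g \<and> ctgt f = ctgt g"
  unfolding econg_def
  by (induction rule: rtranclp_induct) (auto dest: circuit_step_parallel E_sym_parallel)

lemma econg_comp_left: "econg f g \<Longrightarrow> csrc k = ctgt f \<Longrightarrow> econg (k \<odot> f) (k \<odot> g)"
  unfolding econg_def
proof (induction rule: rtranclp_induct)
  case (step g g')
  then have "csrc k = ctgt g" using econg_parallel[of f g] by (simp add: econg_def)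
  then show ?case
    using step circuit_step_comp_left[OF step(2) _ E_sym_parallel]
    by (auto intro: rtranclp.rtrancl_into_rtrancl)
qed auto

lemma econg_comp_right: "econg f g \<Longrightarrow> ctgt h = csrc f \<Longrightarrow> econg (f \<odot> h) (g \<odot> h)"
  unfolding econg_def
proof (induction rule: rtranclp_induct)
  case (step g g')
  then have "ctgt h = csrc g" using econg_parallel[of f g] by (simp add: econg_def)
  then show ?case
    using step circuit_step_comp_right[OF step(2) _ E_sym_parallel]
    by (auto intro: rtranclp.rtrancl_into_rtrancl)
qed auto

lemma econg_whisk: "econg f g \<Longrightarrow> econg (whisk A f B) (whisk A g B)"
  unfolding econg_def
proof (induction rule: rtranclp_induct)
  case (step g g')
  then show ?case
    using circuit_step_whiskI[OF step(2) E_sym_parallel, of A B]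
    by (auto intro: rtranclp.rtrancl_into_rtrancl)
qed auto

lemma econg_E: "E_Delta f g \<Longrightarrow> econg f g"
  unfolding econg_def
  by (rule r_into_rtranclp, rule circuit_step_root) (auto simp: E_sym_def dest: E_Delta_parallel)

lemmas econg_rules = E_Delta.intros[THEN econg_E, unfolded tensor_ide_whisk]

section \<open>The rules of \<open>R_Delta\<close> outside \<open>E_Delta\<close>, derived from
  it\<close>

lemma econg_counit: "econg (whisk [X] (\<epsilon> X) [] \<odot> \<delta> X) (ide1 X)"
proof -
  have "econg (whisk [X] (\<epsilon> X) [] \<odot> \<delta> X) (whisk [X] (\<epsilon> X) [] \<odot> \<tau> X X \<odot> \<delta> X)"
    by (rule econg_comp_left[OF econg_sym[OF econg_rules(2)]]) simp
  also have "\<dots> = (whisk [X] (\<epsilon> X) [] \<odot> \<tau> X X) \<odot> \<delta> X"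
    by (simp add: comp_assoc)
  also have "econg \<dots> (whisk [] (\<epsilon> X) [X] \<odot> \<delta> X)"
    by (rule econg_comp_right[OF econg_rules(6)]) simp
  also have "econg \<dots> (ide1 X)"
    by (rule econg_rules(3))
  finally show ?thesis .
qed

lemma econg_tau_tau: "econg (\<tau> Y X \<odot> \<tau> X Y) (ide [X, Y])"
  using econg_rules(4)[of Y X] by simp

lemma econg_eps_tau: "econg (whisk [] (\<epsilon> Y) [X] \<odot> \<tau> X Y) (whisk [X] (\<epsilon> Y) [])"
proof -
  have "econg (whisk [] (\<epsilon> Y) [X] \<odot> \<tau> X Y) ((whisk [X] (\<epsilon> Y) [] \<odot> \<tau> Y X) \<odot> \<tau> X Y)"
    by (rule econg_comp_right[OF econg_sym[OF econg_rules(6)]]) simp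
  also have "\<dots> = whisk [X] (\<epsilon> Y) [] \<odot> \<tau> Y X \<odot> \<tau> X Y"
    by (simp add: comp_assoc)
  also have "econg \<dots> (whisk [X] (\<epsilon> Y) [] \<odot> ide [X, Y])"
    by (rule econg_comp_left[OF econg_tau_tau]) simp
  finally show ?thesis by simp
qed

lemma econg_cocomm:
  "econg (whisk [X] (\<tau> X X) [] \<odot> whisk [] (\<delta> X) [X] \<odot> \<delta> X) (whisk [] (\<delta> X) [X] \<odot> \<delta> X)"
proof -
  have "econg (whisk [X] (\<tau> X X) [] \<odot> whisk [] (\<delta> X) [X] \<odot> \<delta> X)
      (whisk [X] (\<tau> X X) [] \<odot> whisk [X] (\<delta> X) [] \<odot> \<delta> X)"
    by (rule econg_comp_left[OF econg_sym[OF econg_rules(1)]]) simp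
  also have "\<dots> = whisk [X] (\<tau> X X \<odot> \<delta> X) [] \<odot> \<delta> X"
    by (simp add: comp_assoc whisk_comp)
  also have "econg \<dots> (whisk [X] (\<delta> X) [] \<odot> \<delta> X)"
    by (rule econg_comp_right[OF econg_whisk[OF econg_rules(2)]]) simp
  also have "econg \<dots> (whisk [] (\<delta> X) [X] \<odot> \<delta> X)"
    by (rule econg_rules(1))
  finally show ?thesis .
qed

lemma econg_tau_tau_comp:
  "ctgt f = Y @ [A, B] @ Z \<Longrightarrow> econg (whisk Y (\<tau> B A) Z \<odot> whisk Y (\<tau> A B) Z \<odot> f) f"
  using econg_comp_right[OF econg_whisk[OF econg_tau_tau[of B A], of Y Z], of f]
  by (simp add: whisk_comp comp_assoc)

text \<open>Insert \<open>\<tau> Y X \<odot> \<tau> X Y\<close> above \<delta>, let \<delta> pass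
  the lower of these crossings by \<open>E_delta_tau\<close>, and cancel the two crossings it leaves
  against the two below.\<close>

lemma econg_delta_tau:
  "econg (whisk [Y] (\<tau> X Y) [] \<odot> whisk [] (\<tau> X Y) [Y] \<odot> whisk [X] (\<delta> Y) [])
    (whisk [] (\<delta> Y) [X] \<odot> \<tau> X Y)"
proof -
  let ?a = "whisk [Y] (\<tau> X Y) []" and ?b = "whisk [] (\<tau> X Y) [Y]"
  have "econg (?a \<odot> ?b \<odot> whisk [X] (\<delta> Y) [] \<odot> ide [X, Y])
      (?a \<odot> ?b \<odot> whisk [X] (\<delta> Y) [] \<odot> \<tau> Y X \<odot> \<tau> X Y)"
    by (intro econg_comp_left econg_sym[OF econg_tau_tau]) simp_all
  also have "\<dots> = ?a \<odot> ?b \<odot> (whisk [X] (\<delta> Y) [] \<odot> \<tau> Y X) \<odot> \<tau> X Y"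
    by (simp add: comp_assoc)
  also have "econg \<dots> (?a \<odot> ?b \<odot> (whisk [] (\<tau> Y X) [Y] \<odot> whisk [Y] (\<tau> Y X) [] \<odot>
      whisk [] (\<delta> Y) [X]) \<odot> \<tau> X Y)"
    by (intro econg_comp_left econg_comp_right econg_rules(5)) simp_all
  also have "\<dots> = ?a \<odot> ?b \<odot> whisk [] (\<tau> Y X) [Y] \<odot> whisk [Y] (\<tau> Y X) [] \<odot>
      whisk [] (\<delta> Y) [X] \<odot> \<tau> X Y"
    by (simp add: comp_assoc)
  also have "econg \<dots> (?a \<odot> whisk [Y] (\<tau> Y X) [] \<odot> whisk [] (\<delta> Y) [X] \<odot> \<tau> X Y)"
    by (intro econg_comp_left econg_tau_tau_comp) simp_all
  also have "econg \<dots> (whisk [] (\<delta> Y) [X] \<odot> \<tau> X Y)"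
    by (rule econg_tau_tau_comp) simp
  finally show ?thesis by simp
qed

lemma econg_tau_delta_tau:
  "econg (whisk [Y] (\<tau> Y X) [] \<odot> whisk [] (\<delta> Y) [X] \<odot> \<tau> X Y)
    (whisk [] (\<tau> X Y) [Y] \<odot> whisk [X] (\<delta> Y) [])"
proof -
  have "econg (whisk [Y] (\<tau> Y X) [] \<odot> whisk [] (\<delta> Y) [X] \<odot> \<tau> X Y)
      (whisk [Y] (\<tau> Y X) [] \<odot> whisk [Y] (\<tau> X Y) [] \<odot> whisk [] (\<tau> X Y) [Y] \<odot> whisk [X] (\<delta> Y) [])"
    by (intro econg_comp_left econg_sym[OF econg_delta_tau]) simp
  also have "econg \<dots> (whisk [] (\<tau> X Y) [Y] \<odot> whisk [X] (\<delta> Y) [])"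
    by (rule econg_tau_tau_comp) simp
  finally show ?thesis .
qed

lemma tau_left_types: "csrc (tau_left W X) = W @ [X] \<and> ctgt (tau_left W X) = X # W"
  by (induction W X rule: tau_left.induct) auto

lemma tau_right_types: "csrc (tau_right X W) = X # W \<and> ctgt (tau_right X W) = W @ [X]"
  by (induction X W rule: tau_right.induct) auto

lemma econg_tau_word: "econg (tau_left (opr_src \<phi>) X \<odot> tau_right X (opr_src \<phi>)) (ide (X # opr_src \<phi>))"
proof -
  have "econg ((whisk [] (\<tau> Y X) [Z] \<odot> whisk [Y] (\<tau> Z X) []) \<odot> whisk [Y] (\<tau> X Z) [] \<odot> whisk [] (\<tau> X Y) [Z])
      (ide [X, Y, Z])" for Y Z
  proof -
    have "econg (whisk [] (\<tau> Y X) [Z] \<odot> whisk [Y] (\<tau> Z X) [] \<odot> whisk [Y] (\<tau> X Z) [] \<odot> whisk [] (\<tau> X Y) [Z])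
        (whisk [] (\<tau> Y X) [Z] \<odot> whisk [] (\<tau> X Y) [Z])"
      by (intro econg_comp_left econg_tau_tau_comp) simp_all
    also have "econg \<dots> (ide [X, Y, Z])"
      using econg_tau_tau_comp[of "ide [X, Y, Z]" "[]" X Y "[Z]"] by simp
    finally show ?thesis by (simp add: comp_assoc)
  qed
  then show ?thesis
    by (cases \<phi>) (simp_all add: econg_refl econg_tau_tau tensor_ide_whisk)
qed

text \<open>Insert \<open>tau_left\<close> after \<open>tau_right\<close>, an identity by
  \<open>econg_tau_word\<close>, above the operator; \<open>E_tau_opr\<close> read backwards then
  produces a crossing that cancels the one below.\<close>

lemma econg_tau_opr:
  "econg (\<tau> X (opr_tgt \<phi>) \<odot> whisk [X] (opc \<phi>) []) (whisk [] (opc \<phi>) [X] \<odot> tau_right X (opr_src \<phi>))"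
proof -
  let ?l = "tau_left (opr_src \<phi>) X" and ?r = "tau_right X (opr_src \<phi>)" and ?s = "opr_tgt \<phi>"
  note t = tau_left_types tau_right_types
  have "econg (\<tau> X ?s \<odot> whisk [X] (opc \<phi>) [] \<odot> ide (X # opr_src \<phi>))
      (\<tau> X ?s \<odot> whisk [X] (opc \<phi>) [] \<odot> ?l \<odot> ?r)"
    by (intro econg_comp_left econg_sym[OF econg_tau_word]) simp_all
  also have "\<dots> = \<tau> X ?s \<odot> (whisk [X] (opc \<phi>) [] \<odot> ?l) \<odot> ?r"
    by (simp add: comp_assoc t)
  also have "econg \<dots> (\<tau> X ?s \<odot> (\<tau> ?s X \<odot> whisk [] (opc \<phi>) [X]) \<odot> ?r)"
    by (intro econg_comp_left econg_comp_right econg_sym[OF econg_rules(8)]) (simp_all add: t)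
  also have "\<dots> = whisk [] (\<tau> X ?s) [] \<odot> whisk [] (\<tau> ?s X) [] \<odot> whisk [] (opc \<phi>) [X] \<odot> ?r"
    by (simp add: comp_assoc t)
  also have "econg \<dots> (whisk [] (opc \<phi>) [X] \<odot> ?r)"
    by (rule econg_tau_tau_comp) (simp add: t)
  finally show ?thesis by simp
qed

text \<open>Reductions to normal form use \<open>R_Delta\<close>, whereas only the relations of
  \<open>E_Delta\<close> are 3-cells of the polygraph.\<close>

lemma econg_R_Delta: "R_Delta f g \<Longrightarrow> econg f g"
proof (induction rule: R_Delta.induct)
  case (R_E f g)
  then show ?case by (rule econg_E)
qed (simp_all only: tensor_ide_whisk econg_cocomm econg_counit econg_delta_tau
    econg_tau_delta_tau econg_eps_tau econg_tau_opr)

lemma econg_R_step: "circuit_step R_Delta f g \<Longrightarrow> econg f g"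
  unfolding circuit_step_whisk
proof (elim exE conjE)
  fix s t h k Y Z
  assume *: "R_Delta s t" "ctgt h = Y @ csrc s @ Z" "csrc k = Y @ ctgt s @ Z"
    "f = k \<odot> whisk Y s Z \<odot> h" "g = k \<odot> whisk Y t Z \<odot> h"
  show "econg f g"
    unfolding *(4,5)
    by (intro econg_comp_left econg_comp_right econg_whisk econg_R_Delta[OF *(1)]) (simp_all add: *)
qed

lemma E_sym_step_proj: "circuit_step E_sym f g \<Longrightarrow> proj f = proj g"
  unfolding circuit_step_whisk
proof (elim exE conjE)
  fix s t h k Y Z
  assume *: "E_sym s t" "ctgt h = Y @ csrc s @ Z" "csrc k = Y @ ctgt s @ Z"
    "f = k \<odot> whisk Y s Z \<odot> h" "g = k \<odot> whisk Y t Z \<odot> h"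
  have "proj s = proj t" using *(1) E_Delta_proj unfolding E_sym_def by metis
  then show "proj f = proj g"
    unfolding *(4,5) whisk_def using E_sym_parallel[OF *(1)] *(2,3) by simp
qed

lemma econg_proj: "econg f g \<Longrightarrow> proj f = proj g"
  unfolding econg_def by (induction rule: rtranclp_induct) (auto dest: E_sym_step_proj)

lemma econg_normal_form: "\<exists>g. econg f g \<and> normal_form g"
proof -
  obtain g where g: "(circuit_step R_Delta)\<^sup>*\<^sup>* f g" "normal_form g"
    using normal_form_exists by blast
  have "econg f g"
    using g(1) by (induction rule: rtranclp_induct) (auto intro: econg_refl econg_trans econg_R_step)
  then show ?thesis using g(2) by blast
qed

section \<open>Every family over \<open>X\<close> is the projection of a circuit\<close>

definition reach :: "word \<Rightarrow> family \<Rightarrow> bool" where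
  "reach X u \<longleftrightarrow> (\<exists>f. csrc f = X \<and> proj f = u)"

lemma reach_T_id: "reach X (T_id X)"
  unfolding reach_def by (rule exI[of _ "ide X"]) simp

lemma reach_gen:
  assumes "reach X (p @ q @ r)" "sorts q = gen_src c"
  shows "reach X (p @ T_comp (gen_proj c) q @ r)"
proof -
  obtain f where f: "csrc f = X" "proj f = p @ q @ r"
    using assms(1) unfolding reach_def by blast
  then have "ctgt f = sorts p @ gen_src c @ sorts r"
    using sorts_proj[of f] assms(2) by (simp del: sorts_proj)
  then show ?thesis
    using f assms(2) proj_whisk[of f "sorts p" "cgen c" "sorts r" p q r] unfolding reach_def
    by (intro exI[of _ "whisk (sorts p) (cgen c) (sorts r) \<odot> f"]) simp
qed

lemma reach_swap: "reach X (p @ t # t' # r) \<Longrightarrow> reach X (p @ t' # t # r)"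
  using reach_gen[of X p "[t, t']" r "Tau (sort_of t) (sort_of t')"]
  by (simp add: T_comp_gen del: gen_proj.simps)

lemma reach_dup: "reach X (p @ t # r) \<Longrightarrow> reach X (p @ t # t # r)"
  using reach_gen[of X p "[t]" r "Delta (sort_of t)"]
  by (simp add: T_comp_gen del: gen_proj.simps)

lemma reach_drop: "reach X (t # r) \<Longrightarrow> reach X r"
  using reach_gen[of X "[]" "[t]" r "Eps (sort_of t)"]
  by (simp add: T_comp_gen del: gen_proj.simps)

lemma reach_suffix: "reach X (w @ r) \<Longrightarrow> reach X r"
  by (induction w) (auto dest: reach_drop)

lemma reach_app: "reach X (p @ q) \<Longrightarrow> sorts q = opr_src \<phi> \<Longrightarrow> reach X (p @ [app \<phi> q])"
  using reach_gen[of X p q "[]" "Opr \<phi>"]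
  by (simp add: T_comp_gen del: gen_proj.simps)

lemma reach_move: "reach X (p @ t # r) \<Longrightarrow> reach X (p @ r @ [t])"
proof (induction r arbitrary: p)
  case (Cons t' r)
  then have "reach X ((p @ [t']) @ t # r)" by (simp add: reach_swap)
  then show ?case using Cons.IH[of "p @ [t']"] by simp
qed simp

lemma reach_copy: "reach X u \<Longrightarrow> t \<in> set u \<Longrightarrow> reach X (u @ [t])"
  by (metis append.assoc append_Cons reach_dup reach_move split_list)

definition bounded :: "word \<Rightarrow> trm \<Rightarrow> bool" where
  "bounded X t \<longleftrightarrow> (\<forall>k\<in>avars t. k < count_list X At) \<and> (\<forall>k\<in>fvars t. k < count_list X Fm)"

lemma sharp_le_bounded: "sharp u \<le> word_sharp X \<longleftrightarrow> (\<forall>t\<in>set u. bounded X t)"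
  by (simp add: word_sharp_def sharp_le_iff bounded_def)

lemma nth_T_id:
  "k < count_list X At \<Longrightarrow> atoms_of (T_id X) ! k = AVar k"
  "k < count_list X Fm \<Longrightarrow> formulas_of (T_id X) ! k = FVar k"
  by (simp_all add: T_id_def atoms_of_T_id formulas_of_T_id)

lemma length_T_id [simp]:
  "length (atoms_of (T_id X)) = count_list X At" "length (formulas_of (T_id X)) = count_list X Fm"
  by (simp_all add: T_id_def atoms_of_T_id formulas_of_T_id)

lemma var_in_T_id:
  "k < count_list X At \<Longrightarrow> TA (AVar k) \<in> set (T_id X)"
  "k < count_list X Fm \<Longrightarrow> TF (FVar k) \<in> set (T_id X)"
  by (metis length_T_id nth_T_id nth_mem set_atoms_of set_formulas_of)+

lemma reach_aterm: "reach X (T_id X @ v) \<Longrightarrow> bounded X (TA a) \<Longrightarrow> reach X (T_id X @ v @ [TA a])"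
proof (induction a)
  case (AVar k)
  then show ?case
    using reach_copy[of X "T_id X @ v" "TA (AVar k)"] var_in_T_id by (simp add: bounded_def)
next
  case (ANu a)
  then have "reach X (T_id X @ v @ [TA a])" by (simp add: bounded_def)
  then show ?case using reach_app[of X "T_id X @ v" "[TA a]" ONu] by simp
qed

lemma reach_fterm: "reach X (T_id X @ v) \<Longrightarrow> bounded X (TF x) \<Longrightarrow> reach X (T_id X @ v @ [TF x])"
proof (induction x arbitrary: v)
  case (FVar k)
  then show ?case
    using reach_copy[of X "T_id X @ v" "TF (FVar k)"] var_in_T_id by (simp add: bounded_def)
next
  case (FIota a)
  then have "reach X (T_id X @ v @ [TA a])" by (intro reach_aterm) (simp_all add: bounded_def)
  then show ?case using reach_app[of X "T_id X @ v" "[TA a]" OIota] by simp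
next
  case FTop
  then show ?case using reach_app[of X "T_id X @ v" "[]" OTop] by simp
next
  case FBot
  then show ?case using reach_app[of X "T_id X @ v" "[]" OBot] by simp
next
  case (FAnd x y)
  then have "reach X (T_id X @ v @ [TF x])" by (simp add: bounded_def)
  then have "reach X (T_id X @ (v @ [TF x]) @ [TF y])"
    using FAnd.prems(2) by (intro FAnd.IH(2)) (simp_all add: bounded_def)
  then show ?case using reach_app[of X "T_id X @ v" "[TF x, TF y]" OAnd] by simp
next
  case (FOr x y)
  then have "reach X (T_id X @ v @ [TF x])" by (simp add: bounded_def)
  then have "reach X (T_id X @ (v @ [TF x]) @ [TF y])"
    using FOr.prems(2) by (intro FOr.IH(2)) (simp_all add: bounded_def)
  then show ?case using reach_app[of X "T_id X @ v" "[TF x, TF y]" OOr] by simp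
qed

text \<open>The inputs are kept on the left as a supply. Terms are built on the right in postfix
  order from variables copied out of the supply, which is erased at the end.\<close>

lemma circuit_exists:
  assumes "\<forall>t\<in>set u. bounded X t"
  obtains f where "csrc f = X" "ctgt f = sorts u" "proj f = u"
proof -
  have "reach X (T_id X @ u)"
    using assms
  proof (induction u rule: rev_induct)
    case Nil
    then show ?case by (simp add: reach_T_id)
  next
    case (snoc t u)
    then show ?case using reach_aterm reach_fterm by (cases t) auto
  qed
  then have "reach X u" by (rule reach_suffix)
  then show thesis using that sorts_proj unfolding reach_def by metis
qed

text \<open>Two normal forms with the same source and projection are canonical for the same family,
  hence equal; so the definite description in \<open>Phi\<close> is proper.\<close>

lemma Phi_unique:
  assumes "normal_form f"
  shows "Phi (csrc f) (proj f) = f"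
  unfolding Phi_def
proof (rule the_equality)
  fix g
  assume "csrc g = csrc f \<and> ctgt g = sorts (proj f) \<and> normal_form g \<and> proj g = proj f"
  then show "g = f"
    using normal_canonical[of g] normal_canonical[OF assms] canonical_unique by metis
qed (use assms in simp)

lemma econg_Phi: "econg f (Phi (csrc f) (proj f))"
proof -
  obtain g where "econg f g" "normal_form g"
    using econg_normal_form by blast
  then show ?thesis
    using Phi_unique[of g] econg_parallel[of f g] econg_proj[of f g] by simp
qed

lemma Phi_spec:
  assumes "\<forall>t\<in>set u. bounded X t"
  shows "csrc (Phi X u) = X" "ctgt (Phi X u) = sorts u" "proj (Phi X u) = u"
proof -
  obtain f where "csrc f = X" "proj f = u" "ctgt f = sorts u"
    using circuit_exists[OF assms] by blast
  then show "csrc (Phi X u) = X" "ctgt (Phi X u) = sorts u" "proj (Phi X u) = u"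
    using econg_parallel[OF econg_Phi[of f]] econg_proj[OF econg_Phi[of f]] by auto
qed

section \<open>From circuit proofs to SKS proofs\<close>

lemma SKS_rules_sorts: "\<alpha> \<in> SKS_rules \<Longrightarrow> sort_of (fst \<alpha>) = sort_of (snd \<alpha>)"
  by (auto simp: SKS_rules_def S_bar_rules_def S_rules_def R_rules_def)

lemma count_list_replicate: "count_list (replicate n a) b = (if a = b then n else 0)"
  by (induction n) auto

lemma bounded_rule: "bounded (rule_word \<alpha>) (fst \<alpha>)" "bounded (rule_word \<alpha>) (snd \<alpha>)"
proof -
  have "word_sharp (rule_word \<alpha>) = sup (sharp [fst \<alpha>]) (sharp [snd \<alpha>])"
    by (cases "sup (sharp [fst \<alpha>]) (sharp [snd \<alpha>])")
      (simp add: rule_word_def word_sharp_def count_list_replicate)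
  then have "sharp [fst \<alpha>] \<le> word_sharp (rule_word \<alpha>)" "sharp [snd \<alpha>] \<le> word_sharp (rule_word \<alpha>)"
    by simp_all
  then show "bounded (rule_word \<alpha>) (fst \<alpha>)" "bounded (rule_word \<alpha>) (snd \<alpha>)"
    by (simp_all add: sharp_le_bounded)
qed

lemma Phi_rule:
  "csrc (Phi (rule_word \<alpha>) [fst \<alpha>]) = rule_word \<alpha>" "ctgt (Phi (rule_word \<alpha>) [fst \<alpha>]) = [sort_of (fst \<alpha>)]"
  "proj (Phi (rule_word \<alpha>) [fst \<alpha>]) = [fst \<alpha>]"
  "csrc (Phi (rule_word \<alpha>) [snd \<alpha>]) = rule_word \<alpha>" "ctgt (Phi (rule_word \<alpha>) [snd \<alpha>]) = [sort_of (snd \<alpha>)]"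
  "proj (Phi (rule_word \<alpha>) [snd \<alpha>]) = [snd \<alpha>]"
  using Phi_spec[of "[fst \<alpha>]"] Phi_spec[of "[snd \<alpha>]"] bounded_rule by simp_all

lemma SKS_rules_eq: "S_bar_rules \<union> R_rules = SKS_rules"
  by (auto simp: SKS_rules_def)

lemma K_cell_parallel: "K_cell s t \<Longrightarrow> csrc s = csrc t \<and> ctgt s = ctgt t"
proof (induction rule: K_cell.induct)
  case (K_rule \<alpha>)
  then show ?case using SKS_rules_sorts by (simp add: Phi_rule SKS_rules_eq)
qed (auto dest: E_Delta_parallel)

definition sks_step :: "trm \<Rightarrow> trm \<Rightarrow> bool" where
  "sks_step s t \<longleftrightarrow> (\<exists>\<alpha>\<in>SKS_rules. term_step \<alpha> s t)"

lemma term_step_sort: "term_step \<alpha> s t \<Longrightarrow> sort_of (fst \<alpha>) = sort_of (snd \<alpha>) \<Longrightarrow> sort_of s = sort_of t"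
  by (induction rule: term_step.induct) auto

lemma sks_step_sort: "sks_step\<^sup>*\<^sup>* s t \<Longrightarrow> sort_of s = sort_of t"
  by (induction rule: rtranclp_induct)
    (auto simp: sks_step_def dest: term_step_sort SKS_rules_sorts)

lemma sks_map:
  assumes "\<And>\<alpha> s t. term_step \<alpha> s t \<Longrightarrow> sort_of s = S \<Longrightarrow> sort_of t = S \<Longrightarrow> term_step \<alpha> (C s) (C t)"
    and "sks_step\<^sup>*\<^sup>* s t" "sort_of s = S"
  shows "sks_step\<^sup>*\<^sup>* (C s) (C t)"
  using assms(2)
proof (induction rule: rtranclp_induct)
  case (step t t')
  have "sort_of t = S" using sks_step_sort[OF step(1)] assms(3) by simp
  moreover have "sort_of t' = S" using calculation sks_step_sort[OF r_into_rtranclp[of sks_step, OF step(2)]] by simp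
  ultimately have "sks_step (C t) (C t')"
    using step(2) assms(1) unfolding sks_step_def by blast
  then show ?case using step.IH by (rule rtranclp.rtrancl_into_rtrancl[rotated])
qed simp

lemma sks_map_At:
  assumes "\<And>\<alpha> a b. term_step \<alpha> (TA a) (TA b) \<Longrightarrow> term_step \<alpha> (C a) (C b)"
    and "sks_step\<^sup>*\<^sup>* (TA a) (TA b)"
  shows "sks_step\<^sup>*\<^sup>* (C a) (C b)"
proof -
  \<comment> \<open>Steps preserve sorts, so the branch \<open>undefined\<close> is never reached
    along the proof.\<close>
  let ?C = "\<lambda>t. C (case t of TA a \<Rightarrow> a | TF x \<Rightarrow> undefined)"
  have "sks_step\<^sup>*\<^sup>* (?C (TA a)) (?C (TA b))"
    by (rule sks_map[OF _ assms(2), of At]) (auto simp: sort_of_iff assms(1))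
  then show ?thesis by simp
qed

lemma sks_map_Fm:
  assumes "\<And>\<alpha> x y. term_step \<alpha> (TF x) (TF y) \<Longrightarrow> term_step \<alpha> (C x) (C y)"
    and "sks_step\<^sup>*\<^sup>* (TF x) (TF y)"
  shows "sks_step\<^sup>*\<^sup>* (C x) (C y)"
proof -
  let ?C = "\<lambda>t. C (case t of TF x \<Rightarrow> x | TA a \<Rightarrow> undefined)"
  have "sks_step\<^sup>*\<^sup>* (?C (TF x)) (?C (TF y))"
    by (rule sks_map[OF _ assms(2), of Fm]) (auto simp: sort_of_iff assms(1))
  then show ?thesis by simp
qed

lemma sks_nu: "sks_step\<^sup>*\<^sup>* (TA a) (TA b) \<Longrightarrow> sks_step\<^sup>*\<^sup>* (TA (ANu a)) (TA (ANu b))"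
  by (rule sks_map_At[where C = "\<lambda>a. TA (ANu a)"]) (rule term_step.nu)

lemma sks_iota: "sks_step\<^sup>*\<^sup>* (TA a) (TA b) \<Longrightarrow> sks_step\<^sup>*\<^sup>* (TF (FIota a)) (TF (FIota b))"
  by (rule sks_map_At[where C = "\<lambda>a. TF (FIota a)"]) (rule term_step.iota)

lemma sks_and:
  assumes "sks_step\<^sup>*\<^sup>* (TF x) (TF x')" "sks_step\<^sup>*\<^sup>* (TF y) (TF y')"
  shows "sks_step\<^sup>*\<^sup>* (TF (x \<^bold>\<and> y)) (TF (x' \<^bold>\<and> y'))"
  using sks_map_Fm[where C = "\<lambda>x. TF (x \<^bold>\<and> y)", OF term_step.and_left assms(1)]
    sks_map_Fm[where C = "\<lambda>y. TF (x' \<^bold>\<and> y)", OF term_step.and_right assms(2)]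
  by simp

lemma sks_or:
  assumes "sks_step\<^sup>*\<^sup>* (TF x) (TF x')" "sks_step\<^sup>*\<^sup>* (TF y) (TF y')"
  shows "sks_step\<^sup>*\<^sup>* (TF (x \<^bold>\<or> y)) (TF (x' \<^bold>\<or> y'))"
  using sks_map_Fm[where C = "\<lambda>x. TF (x \<^bold>\<or> y)", OF term_step.or_left assms(1)]
    sks_map_Fm[where C = "\<lambda>y. TF (x' \<^bold>\<or> y)", OF term_step.or_right assms(2)]
  by simp

lemma sks_asubst:
  "(\<And>k. k \<in> avars_a a \<Longrightarrow> sks_step\<^sup>*\<^sup>* (TA (\<sigma> k)) (TA (\<sigma>' k))) \<Longrightarrow>
    sks_step\<^sup>*\<^sup>* (TA (asubst \<sigma> a)) (TA (asubst \<sigma>' a))"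
  by (induction a) (auto intro: sks_nu)

lemma sks_fsubst:
  "(\<And>k. k \<in> avars_f x \<Longrightarrow> sks_step\<^sup>*\<^sup>* (TA (\<sigma> k)) (TA (\<sigma>' k))) \<Longrightarrow>
   (\<And>k. k \<in> fvars_f x \<Longrightarrow> sks_step\<^sup>*\<^sup>* (TF (\<rho> k)) (TF (\<rho>' k))) \<Longrightarrow>
    sks_step\<^sup>*\<^sup>* (TF (fsubst \<sigma> \<rho> x)) (TF (fsubst \<sigma>' \<rho>' x))"
  by (induction x) (auto intro!: sks_iota sks_asubst sks_and sks_or)

lemma sks_tsubst:
  "(\<And>k. k \<in> avars t \<Longrightarrow> sks_step\<^sup>*\<^sup>* (TA (\<sigma> k)) (TA (\<sigma>' k))) \<Longrightarrow>
   (\<And>k. k \<in> fvars t \<Longrightarrow> sks_step\<^sup>*\<^sup>* (TF (\<rho> k)) (TF (\<rho>' k))) \<Longrightarrow>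
    sks_step\<^sup>*\<^sup>* (tsubst \<sigma> \<rho> t) (tsubst \<sigma>' \<rho>' t)"
  by (cases t) (auto intro: sks_asubst sks_fsubst)

lemma sks_atoms_of:
  "list_all2 sks_step\<^sup>*\<^sup>* u v \<Longrightarrow> list_all2 (\<lambda>a b. sks_step\<^sup>*\<^sup>* (TA a) (TA b)) (atoms_of u) (atoms_of v)"
proof (induction rule: list_all2_induct)
  case (Cons s u t v)
  then show ?case using sks_step_sort[OF Cons(1)] by (cases s; cases t) auto
qed simp

lemma sks_formulas_of:
  "list_all2 sks_step\<^sup>*\<^sup>* u v \<Longrightarrow>
    list_all2 (\<lambda>x y. sks_step\<^sup>*\<^sup>* (TF x) (TF y)) (formulas_of u) (formulas_of v)"
proof (induction rule: list_all2_induct)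
  case (Cons s u t v)
  then show ?case using sks_step_sort[OF Cons(1)] by (cases s; cases t) auto
qed simp

text \<open>A component of \<open>u\<close> may be used in \<open>w\<close> any number of times, or
  never; this is why closures of steps are compared and not single steps.\<close>

lemma sks_T_comp:
  assumes "list_all2 sks_step\<^sup>*\<^sup>* u v" "\<forall>t\<in>set w. bounded (sorts u) t"
  shows "list_all2 sks_step\<^sup>*\<^sup>* (T_comp w u) (T_comp w v)"
proof -
  have "sks_step\<^sup>*\<^sup>* (TA (atoms_of u ! k)) (TA (atoms_of v ! k))" if "k < count_list (sorts u) At" for k
    using that list_all2_nthD[OF sks_atoms_of[OF assms(1)]] by (simp add: length_atoms_of)
  moreover have "sks_step\<^sup>*\<^sup>* (TF (formulas_of u ! k)) (TF (formulas_of v ! k))"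
    if "k < count_list (sorts u) Fm" for k
    using that list_all2_nthD[OF sks_formulas_of[OF assms(1)]] by (simp add: length_formulas_of)
  ultimately show ?thesis
    using assms(2)
    by (auto simp: T_comp_def list_all2_map1 list_all2_map2 list_all2_same bounded_def intro!: sks_tsubst)
qed

lemma sks_proof_component:
  "sks_step\<^sup>*\<^sup>* s t \<Longrightarrow> sks_proof (p @ [s] @ q) (p @ [t] @ q)"
  unfolding sks_proof_def
proof (induction rule: rtranclp_induct)
  case (step t t')
  then have "\<exists>\<alpha>\<in>SKS_rules. family_step \<alpha> (p @ [t] @ q) (p @ [t'] @ q)"
    unfolding sks_step_def family_step_def by blast
  then show ?case using step.IH by (rule rtranclp.rtrancl_into_rtrancl[rotated])
qed simp

lemma sks_proof_trans: "sks_proof u v \<Longrightarrow> sks_proof v w \<Longrightarrow> sks_proof u w"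
  by (simp add: sks_proof_def)

lemma sks_proof_family: "list_all2 sks_step\<^sup>*\<^sup>* u v \<Longrightarrow> sks_proof (p @ u) (p @ v)"
proof (induction arbitrary: p rule: list_all2_induct)
  case Nil
  then show ?case by (simp add: sks_proof_def)
next
  case (Cons s u t v)
  have "sks_proof (p @ [s] @ u) (p @ [t] @ u)"
    using Cons(1) by (rule sks_proof_component)
  moreover have "sks_proof ((p @ [t]) @ u) ((p @ [t]) @ v)"
    by (rule Cons.IH)
  ultimately show ?case using sks_proof_trans by simp
qed

lemma K_step_sks:
  assumes "circuit_step K_cell f g"
  shows "sks_proof (proj f) (proj g)"
proof -
  obtain s t h k Y Z where *: "K_cell s t" "ctgt h = Y @ csrc s @ Z" "csrc k = Y @ ctgt s @ Z"
      "f = k \<odot> whisk Y s Z \<odot> h" "g = k \<odot> whisk Y t Z \<odot> h"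
    using assms unfolding circuit_step_whisk by blast
  note par = K_cell_parallel[OF *(1)]
  obtain p q r where pqr: "proj h = p @ q @ r" "sorts p = Y" "sorts q = csrc s" "sorts r = Z"
    using *(2) split_sorts[of "proj h" Y "csrc s" Z] by auto
  have st: "proj f = T_comp (proj k) (p @ T_comp (proj s) q @ r)"
      "proj g = T_comp (proj k) (p @ T_comp (proj t) q @ r)"
    using * pqr par proj_whisk[of h Y s Z p q r] proj_whisk[of h Y t Z p q r] by simp_all
  have "list_all2 sks_step\<^sup>*\<^sup>* (T_comp (proj s) q) (T_comp (proj t) q)"
    using *(1)
  proof (cases rule: K_cell.cases)
    case K_E
    then show ?thesis using E_Delta_proj by (simp add: list_all2_refl)
  next
    case K_E_inv
    then show ?thesis using E_Delta_proj[of t s] by (simp add: list_all2_refl)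
  next
    case (K_rule \<alpha>)
    \<comment> \<open>\<open>T_comp (proj s) q\<close> is an instance of one side of the rule, with
      the substitution read off from \<open>q\<close>.\<close>
    have "sks_step (tsubst \<sigma> \<rho> (fst \<alpha>)) (tsubst \<sigma> \<rho> (snd \<alpha>))" for \<sigma> \<rho>
      unfolding sks_step_def using K_rule(3) SKS_rules_eq term_step.root by blast
    then show ?thesis using K_rule by (auto simp: Phi_rule T_comp_def)
  qed
  then have "list_all2 sks_step\<^sup>*\<^sup>* (p @ T_comp (proj s) q @ r) (p @ T_comp (proj t) q @ r)"
    by (intro list_all2_appendI) (simp_all add: list_all2_refl)
  moreover have "sorts (p @ T_comp (proj s) q @ r) = csrc k"
    using pqr *(3) sorts_proj[of s] by (simp add: T_comp_def comp_def)
  moreover have "\<forall>t\<in>set (proj k). bounded (csrc k) t"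
    using is_T_arrow_proj[of k] by (simp add: is_T_arrow_iff bounded_def)
  ultimately show ?thesis
    unfolding st using sks_proof_family[of _ _ "[]"] sks_T_comp by simp
qed

lemma K_proof_sks: "K_proof f g \<Longrightarrow> sks_proof (proj f) (proj g)"
  unfolding K_proof_def
proof (induction rule: rtranclp_induct)
  case base
  then show ?case by (simp add: sks_proof_def)
next
  case (step g g')
  then show ?case using K_step_sks sks_proof_trans by blast
qed

section \<open>From SKS proofs to circuit proofs\<close>

lemma econg_K_proof: "econg f g \<Longrightarrow> K_proof f g"
proof -
  have "circuit_step E_sym f g \<Longrightarrow> circuit_step K_cell f g" for f g
    unfolding circuit_step_whisk E_sym_def by (blast intro: K_E K_E_inv)
  then show "econg f g \<Longrightarrow> K_proof f g"
    unfolding econg_def K_proof_def by (metis mono_rtranclp)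
qed

text \<open>
  The variable number 0 of its sort stands for the hole of a context over the word \<open>S # X\<close>.
\<close>

definition plug :: "word \<Rightarrow> trm \<Rightarrow> trm \<Rightarrow> trm" where
  "plug X z = tsubst ((!) (atoms_of (z # T_id X))) ((!) (formulas_of (z # T_id X)))"

text \<open>Only the indices of sort \<open>S\<close> move, to free index 0 for the hole.\<close>

definition shift1 :: "tsort \<Rightarrow> trm \<Rightarrow> trm" where
  "shift1 S = tsubst (\<lambda>k. AVar (count_list [S] At + k)) (\<lambda>k. FVar (count_list [S] Fm + k))"

lemma plug_shift1: "bounded X t \<Longrightarrow> plug X z (shift1 (sort_of z) t) = t"
  unfolding plug_def shift1_def tsubst_tsubst
  by (subst (4) tsubst_Var[symmetric], rule tsubst_cong)
    (cases z; auto simp: bounded_def nth_T_id)+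

lemma bounded_shift1: "bounded X t \<Longrightarrow> bounded (S # X) (shift1 S t)"
  by (auto simp: bounded_def shift1_def vars_tsubst)

text \<open>The context of a step as one term \<open>C\<close> shared by both sides. Boundedness is
  asked of the two instances and not of \<sigma> and \<rho>, which are arbitrary outside the
  variables of the rule.\<close>

definition plugged :: "word \<Rightarrow> tsort \<Rightarrow> rule \<Rightarrow> trm \<Rightarrow> trm \<Rightarrow> bool" where
  "plugged X S \<alpha> s t \<longleftrightarrow> (\<exists>\<sigma> \<rho> C. bounded X (tsubst \<sigma> \<rho> (fst \<alpha>)) \<and> bounded X (tsubst \<sigma> \<rho> (snd \<alpha>)) \<and>
    bounded (S # X) C \<and> s = plug X (tsubst \<sigma> \<rho> (fst \<alpha>)) C \<and> t = plug X (tsubst \<sigma> \<rho> (snd \<alpha>)) C)"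

lemma plugged_map_At:
  assumes "plugged X S \<alpha> (TA a) (TA b)"
    and "\<And>c. bounded (S # X) (TA c) \<Longrightarrow> bounded (S # X) (G c)"
    and "\<And>w c e. plug X w (TA c) = TA e \<Longrightarrow> plug X w (G c) = H e"
  shows "plugged X S \<alpha> (H a) (H b)"
proof -
  obtain \<sigma> \<rho> C where *: "bounded X (tsubst \<sigma> \<rho> (fst \<alpha>))" "bounded X (tsubst \<sigma> \<rho> (snd \<alpha>))"
      "bounded (S # X) C" "TA a = plug X (tsubst \<sigma> \<rho> (fst \<alpha>)) C" "TA b = plug X (tsubst \<sigma> \<rho> (snd \<alpha>)) C"
    using assms(1) unfolding plugged_def by blast
  then obtain c where "C = TA c" by (cases C) (auto simp: plug_def)
  then show ?thesis using * assms(2,3) unfolding plugged_def by metis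
qed

text \<open>Unlike \<nu> and \<iota>, a binary connective adds a sibling to the context. The sibling
  is renamed by \<open>shift1 S\<close>, and \<open>plug\<close> undoes this for fillers of sort
  \<open>S\<close>.\<close>

lemma plugged_map_Fm:
  assumes "plugged X S \<alpha> (TF x) (TF y)" "sort_of (fst \<alpha>) = S" "sort_of (snd \<alpha>) = S"
    and "\<And>c. bounded (S # X) (TF c) \<Longrightarrow> bounded (S # X) (G c)"
    and "\<And>w c e. sort_of w = S \<Longrightarrow> plug X w (TF c) = TF e \<Longrightarrow> plug X w (G c) = H e"
  shows "plugged X S \<alpha> (H x) (H y)"
proof -
  obtain \<sigma> \<rho> C where *: "bounded X (tsubst \<sigma> \<rho> (fst \<alpha>))" "bounded X (tsubst \<sigma> \<rho> (snd \<alpha>))"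
      "bounded (S # X) C" "TF x = plug X (tsubst \<sigma> \<rho> (fst \<alpha>)) C" "TF y = plug X (tsubst \<sigma> \<rho> (snd \<alpha>)) C"
    using assms(1) unfolding plugged_def by blast
  then obtain c where "C = TF c" by (cases C) (auto simp: plug_def)
  then show ?thesis using * assms(2-5) unfolding plugged_def by (metis sort_of_tsubst)
qed

lemma term_step_plugged:
  assumes "term_step \<alpha> s t" "bounded X s" "bounded X t"
    and S: "sort_of (fst \<alpha>) = S" "sort_of (snd \<alpha>) = S"
  shows "plugged X S \<alpha> s t"
  using assms(1-3)
proof (induction rule: term_step.induct)
  case (root \<sigma> \<rho>)
  then show ?case
    using S unfolding plugged_def
    \<comment> \<open>At the root the context is the hole alone.\<close>
    by (intro exI[of _ \<sigma>] exI[of _ \<rho>] exI[of _ "case S of At \<Rightarrow> TA (AVar 0) | Fm \<Rightarrow> TF (FVar 0)"])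
      (cases S; auto simp: plug_def bounded_def sort_of_iff)
next
  case (nu a b)
  show ?case
    by (rule plugged_map_At[where G = "\<lambda>c. TA (ANu c)" and H = "\<lambda>a. TA (ANu a)"])
      (use nu in \<open>auto simp: plug_def bounded_def\<close>)
next
  case (iota a b)
  show ?case
    by (rule plugged_map_At[where G = "\<lambda>c. TF (FIota c)" and H = "\<lambda>a. TF (FIota a)"])
      (use iota in \<open>auto simp: plug_def bounded_def\<close>)
next
  case (and_left x y z)
  then have z: "bounded X (TF z)" by (simp add: bounded_def)
  obtain d where d: "shift1 S (TF z) = TF d" by (simp add: shift1_def)
  then have "sort_of w = S \<Longrightarrow> plug X w (TF d) = TF z" for w
    using plug_shift1[OF z, of w] by auto
  moreover have "bounded (S # X) (TF d)" using bounded_shift1[OF z, of S] d by simp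
  ultimately show ?case
    by (intro plugged_map_Fm[where G = "\<lambda>c. TF (c \<^bold>\<and> d)" and H = "\<lambda>e. TF (e \<^bold>\<and> z)", OF _ S])
      (use and_left in \<open>auto simp: plug_def bounded_def\<close>)
next
  case (and_right x y z)
  then have z: "bounded X (TF z)" by (simp add: bounded_def)
  obtain d where d: "shift1 S (TF z) = TF d" by (simp add: shift1_def)
  then have "sort_of w = S \<Longrightarrow> plug X w (TF d) = TF z" for w
    using plug_shift1[OF z, of w] by auto
  moreover have "bounded (S # X) (TF d)" using bounded_shift1[OF z, of S] d by simp
  ultimately show ?case
    by (intro plugged_map_Fm[where G = "\<lambda>c. TF (d \<^bold>\<and> c)" and H = "\<lambda>e. TF (z \<^bold>\<and> e)", OF _ S])
      (use and_right in \<open>auto simp: plug_def bounded_def\<close>)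
next
  case (or_left x y z)
  then have z: "bounded X (TF z)" by (simp add: bounded_def)
  obtain d where d: "shift1 S (TF z) = TF d" by (simp add: shift1_def)
  then have "sort_of w = S \<Longrightarrow> plug X w (TF d) = TF z" for w
    using plug_shift1[OF z, of w] by auto
  moreover have "bounded (S # X) (TF d)" using bounded_shift1[OF z, of S] d by simp
  ultimately show ?case
    by (intro plugged_map_Fm[where G = "\<lambda>c. TF (c \<^bold>\<or> d)" and H = "\<lambda>e. TF (e \<^bold>\<or> z)", OF _ S])
      (use or_left in \<open>auto simp: plug_def bounded_def\<close>)
next
  case (or_right x y z)
  then have z: "bounded X (TF z)" by (simp add: bounded_def)
  obtain d where d: "shift1 S (TF z) = TF d" by (simp add: shift1_def)
  then have "sort_of w = S \<Longrightarrow> plug X w (TF d) = TF z" for w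
    using plug_shift1[OF z, of w] by auto
  moreover have "bounded (S # X) (TF d)" using bounded_shift1[OF z, of S] d by simp
  ultimately show ?case
    by (intro plugged_map_Fm[where G = "\<lambda>c. TF (d \<^bold>\<or> c)" and H = "\<lambda>e. TF (z \<^bold>\<or> e)", OF _ S])
      (use or_right in \<open>auto simp: plug_def bounded_def\<close>)
qed

text \<open>Checked on each rule: no index is skipped. Boundedness of both instances therefore
  bounds the values of all variables of \<open>rule_word \<alpha>\<close>, and a circuit over
  \<open>X\<close> can compute them.\<close>

lemma rule_vars:
  assumes "\<alpha> \<in> SKS_rules"
  shows "k < count_list (rule_word \<alpha>) At \<Longrightarrow> k \<in> avars (fst \<alpha>) \<union> avars (snd \<alpha>)"
    and "k < count_list (rule_word \<alpha>) Fm \<Longrightarrow> k \<in> fvars (fst \<alpha>) \<union> fvars (snd \<alpha>)"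
  using assms
  unfolding SKS_rules_def S_bar_rules_def S_rules_def R_rules_def
  by (auto simp: rule_word_def sharp_def count_list_replicate less_Suc_eq numeral_eq_Suc sup_nat_def)

definition instance_family :: "rule \<Rightarrow> (nat \<Rightarrow> aterm) \<Rightarrow> (nat \<Rightarrow> fterm) \<Rightarrow> family" where
  "instance_family \<alpha> \<sigma> \<rho> = map (TA \<circ> \<sigma>) [0..<count_list (rule_word \<alpha>) At] @
    map (TF \<circ> \<rho>) [0..<count_list (rule_word \<alpha>) Fm]"

lemma instance_family:
  "sorts (instance_family \<alpha> \<sigma> \<rho>) = rule_word \<alpha>"
  "bounded (rule_word \<alpha>) t \<Longrightarrow> T_comp [t] (instance_family \<alpha> \<sigma> \<rho>) = [tsubst \<sigma> \<rho> t]"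
proof -
  have a: "atoms_of (map (TA \<circ> f) l) = map f l" "formulas_of (map (TA \<circ> f) l) = []" for f :: "nat \<Rightarrow> _" and l
    by (induction l) auto
  have b: "formulas_of (map (TF \<circ> f) l) = map f l" "atoms_of (map (TF \<circ> f) l) = []" for f :: "nat \<Rightarrow> _" and l
    by (induction l) auto
  obtain p q where pq: "rule_word \<alpha> = replicate p At @ replicate q Fm"
    by (metis (no_types, lifting) case_prod_conv rule_word_def surj_pair)
  have c: "map (\<lambda>_. x) [0..<n] = replicate n x" for x :: tsort and n
    by (induction n) (auto simp: replicate_append_same)
  show "sorts (instance_family \<alpha> \<sigma> \<rho>) = rule_word \<alpha>"
    by (simp add: instance_family_def pq comp_def count_list_replicate c)
  show "T_comp [t] (instance_family \<alpha> \<sigma> \<rho>) = [tsubst \<sigma> \<rho> t]" if "bounded (rule_word \<alpha>) t"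
    using that by (auto simp: T_comp_def instance_family_def a b bounded_def intro!: tsubst_cong)
qed

lemma family_step_K_proof:
  assumes "family_step \<alpha> u v" "\<alpha> \<in> SKS_rules"
    and u: "\<forall>t\<in>set u. bounded X t" and v: "\<forall>t\<in>set v. bounded X t"
  shows "K_proof (Phi X u) (Phi X v)"
proof -
  obtain p q s t where pq: "u = p @ [s] @ q" "v = p @ [t] @ q" "term_step \<alpha> s t"
    using assms(1) unfolding family_step_def by blast
  define S where "S = sort_of (fst \<alpha>)"
  have S: "sort_of (snd \<alpha>) = S" using SKS_rules_sorts[OF assms(2)] by (simp add: S_def)
  obtain \<sigma> \<rho> C where C: "bounded X (tsubst \<sigma> \<rho> (fst \<alpha>))" "bounded X (tsubst \<sigma> \<rho> (snd \<alpha>))"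
      "bounded (S # X) C" "s = plug X (tsubst \<sigma> \<rho> (fst \<alpha>)) C" "t = plug X (tsubst \<sigma> \<rho> (snd \<alpha>)) C"
    using term_step_plugged[OF pq(3), of X S] u v S pq(1,2) by (auto simp: S_def plugged_def)
  let ?I = "instance_family \<alpha> \<sigma> \<rho>" and ?W = "rule_word \<alpha>"
  have "bounded X w" if "w \<in> set ?I" for w
  proof -
    have "bounded X (TA (\<sigma> k))" if "k < count_list ?W At" for k
      using rule_vars(1)[OF assms(2) that] C(1,2) by (fastforce simp: bounded_def vars_tsubst)
    moreover have "bounded X (TF (\<rho> k))" if "k < count_list ?W Fm" for k
      using rule_vars(2)[OF assms(2) that] C(1,2) by (fastforce simp: bounded_def vars_tsubst)
    ultimately show ?thesis using that by (auto simp: instance_family_def)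
  qed
  moreover have "bounded X w" if "w \<in> set (T_id X)" for w
    using that is_T_arrow_id[of X] by (simp add: is_T_arrow_iff bounded_def)
  ultimately have "\<forall>w\<in>set (?I @ T_id X). bounded X w" by auto
  \<comment> \<open>\<open>h\<close> computes the values of the variables of the rule and keeps all
    inputs for the context.\<close>
  then obtain h where h: "csrc h = X" "ctgt h = sorts (?I @ T_id X)" "proj h = ?I @ T_id X"
    by (rule circuit_exists)
  have "\<forall>w\<in>set (map (shift1 S) p @ [C] @ map (shift1 S) q). bounded (S # X) w"
    using u C(3) pq(1) by (auto intro: bounded_shift1)
  then obtain k where k: "csrc k = S # X" "proj k = map (shift1 S) p @ [C] @ map (shift1 S) q"
    by (rule circuit_exists)
  \<comment> \<open>The two circuits differ only in the side of the rule between \<open>h\<close>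
    and the context \<open>k\<close>; the output of that side enters the hole.\<close>
  define f where "f r = k \<odot> whisk [] (Phi ?W [r]) X \<odot> h" for r
  have step: "circuit_step K_cell (f (fst \<alpha>)) (f (snd \<alpha>))"
    unfolding circuit_step_whisk f_def
    by (intro exI[of _ "Phi ?W [fst \<alpha>]"] exI[of _ "Phi ?W [snd \<alpha>]"] exI[of _ h] exI[of _ k]
        exI[of _ "[]"] exI[of _ X])
      (use K_rule[of \<alpha>] assms(2) h k in \<open>simp add: Phi_rule SKS_rules_eq instance_family S_def\<close>)
  have f: "csrc (f r) = X \<and> proj (f r) = map (plug X (tsubst \<sigma> \<rho> r)) (proj k)"
    if r: "r = fst \<alpha> \<or> r = snd \<alpha>" for r
  proof -
    have "csrc (Phi ?W [r]) = ?W" "ctgt (Phi ?W [r]) = [S]" "proj (Phi ?W [r]) = [r]" "bounded ?W r"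
      using r Phi_rule[of \<alpha>] bounded_rule[of \<alpha>] S by (auto simp: S_def)
    then show ?thesis
      using h k instance_family[of \<alpha>] proj_whisk[of h "[]" "Phi ?W [r]" X "[]" ?I "T_id X"]
      by (simp add: f_def T_comp_def plug_def)
  qed
  have sh: "map (plug X (tsubst \<sigma> \<rho> r)) (map (shift1 S) w) = w"
    if "\<forall>t\<in>set w. bounded X t" "r = fst \<alpha> \<or> r = snd \<alpha>" for r w
    using that S plug_shift1[of X _ "tsubst \<sigma> \<rho> r"] by (auto simp: S_def intro!: map_idI)
  have fu: "csrc (f (fst \<alpha>)) = X" "proj (f (fst \<alpha>)) = u"
    using f[of "fst \<alpha>"] sh[of p "fst \<alpha>"] sh[of q "fst \<alpha>"] u pq(1) C(4) by (auto simp: k(2))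
  have fv: "csrc (f (snd \<alpha>)) = X" "proj (f (snd \<alpha>)) = v"
    using f[of "snd \<alpha>"] sh[of p "snd \<alpha>"] sh[of q "snd \<alpha>"] u pq(1,2) C(5) by (auto simp: k(2))
  \<comment> \<open>By coherence the circuits \<open>f (fst \<alpha>)\<close> and
    \<open>f (snd \<alpha>)\<close> may be replaced by the normal ones.\<close>
  have "K_proof (Phi X u) (f (fst \<alpha>))"
    using econg_Phi[of "f (fst \<alpha>)"] fu by (auto intro: econg_K_proof econg_sym)
  moreover have "K_proof (f (fst \<alpha>)) (f (snd \<alpha>))"
    using step by (simp add: K_proof_def)
  moreover have "K_proof (f (snd \<alpha>)) (Phi X v)"
    using econg_Phi[of "f (snd \<alpha>)"] fv by (auto intro: econg_K_proof)
  ultimately show ?thesis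
    unfolding K_proof_def by (meson rtranclp_trans)
qed

text \<open>
  The terms occurring in an SKS proof from \<open>u\<close> to \<open>v\<close> may have variables that are not in \<open>X\<close>. They are
  replaced by an atom of \<open>X\<close> and by \<open>\<top>\<close>; if \<open>X\<close> has no atom, then \<open>\<iota>(\<nu>\<^sup>n(a))\<close> is replaced by \<open>\<top>\<close> for even
  \<open>n\<close> and by \<open>\<bottom>\<close> for odd \<open>n\<close>, and the proof is repaired using the proof of \<open>\<top>\<close> from \<open>\<bottom>\<close> that
  the medial rule provides.
\<close>

definition bounded_step :: "word \<Rightarrow> trm \<Rightarrow> trm \<Rightarrow> bool" where
  "bounded_step X s t \<longleftrightarrow> sks_step s t \<and> bounded X s \<and> bounded X t"

definition bounded_family_step :: "word \<Rightarrow> family \<Rightarrow> family \<Rightarrow> bool" where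
  "bounded_family_step X u v \<longleftrightarrow> (\<exists>\<alpha>\<in>SKS_rules. family_step \<alpha> u v) \<and>
    (\<forall>t\<in>set u. bounded X t) \<and> (\<forall>t\<in>set v. bounded X t)"

lemma bounded_family_steps_K_proof:
  "(bounded_family_step X)\<^sup>*\<^sup>* u v \<Longrightarrow> K_proof (Phi X u) (Phi X v)"
proof (induction rule: rtranclp_induct)
  case base
  then show ?case by (simp add: K_proof_def)
next
  case (step v w)
  then have "K_proof (Phi X v) (Phi X w)"
    using family_step_K_proof unfolding bounded_family_step_def by blast
  then show ?case using step.IH unfolding K_proof_def by (meson rtranclp_trans)
qed

lemma bounded_steps_component:
  assumes "(bounded_step X)\<^sup>*\<^sup>* s t" "\<forall>t\<in>set (p @ q). bounded X t"
  shows "(bounded_family_step X)\<^sup>*\<^sup>* (p @ [s] @ q) (p @ [t] @ q)"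
  using assms(1)
proof (induction rule: rtranclp_induct)
  case (step t t')
  then obtain \<alpha> where "\<alpha> \<in> SKS_rules" "term_step \<alpha> t t'" "bounded X t" "bounded X t'"
    by (auto simp: bounded_step_def sks_step_def)
  moreover from this have "family_step \<alpha> (p @ [t] @ q) (p @ [t'] @ q)"
    unfolding family_step_def by blast
  ultimately have "bounded_family_step X (p @ [t] @ q) (p @ [t'] @ q)"
    using assms(2) unfolding bounded_family_step_def by auto
  then show ?case using step.IH by (rule rtranclp.rtrancl_into_rtrancl[rotated])
qed simp

text \<open>\<open>P\<close> is an invariant of the terms met along the proof: nothing if
  \<open>X\<close> has an atom, being a formula otherwise.\<close>

lemma sks_proof_image:
  assumes "sks_proof u v"
    and G: "\<And>s t. sks_step s t \<Longrightarrow> P s \<Longrightarrow> P t \<and> (bounded_step X)\<^sup>*\<^sup>* (G s) (G t)"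
    and "\<And>t. P t \<Longrightarrow> bounded X (G t)" "\<forall>t\<in>set u. P t"
  shows "(bounded_family_step X)\<^sup>*\<^sup>* (map G u) (map G v) \<and> (\<forall>t\<in>set v. P t)"
  using assms(1) unfolding sks_proof_def
proof (induction rule: rtranclp_induct)
  case base
  then show ?case using assms(4) by simp
next
  case (step v w)
  then obtain p q s t where *: "v = p @ [s] @ q" "w = p @ [t] @ q" "sks_step s t"
    unfolding family_step_def sks_step_def by blast
  then have "(bounded_family_step X)\<^sup>*\<^sup>* (map G p @ [G s] @ map G q) (map G p @ [G t] @ map G q)"
    using step.IH G assms(3) by (intro bounded_steps_component) auto
  then show ?case using step.IH G[OF *(3)] * by auto
qed

lemma sks_step_tsubst: "sks_step s t \<Longrightarrow> sks_step (tsubst \<sigma> \<rho> s) (tsubst \<sigma> \<rho> t)"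
proof -
  have "term_step \<alpha> s t \<Longrightarrow> term_step \<alpha> (tsubst \<sigma> \<rho> s) (tsubst \<sigma> \<rho> t)" for \<alpha>
  proof (induction rule: term_step.induct)
    case (root \<sigma>' \<rho>')
    then show ?case unfolding tsubst_tsubst by (rule term_step.root)
  qed (auto intro: term_step.intros)
  then show "sks_step s t \<Longrightarrow> sks_step (tsubst \<sigma> \<rho> s) (tsubst \<sigma> \<rho> t)"
    unfolding sks_step_def by blast
qed

lemma sks_proof_bounded_with_atom:
  assumes "sks_proof u v" "\<forall>t\<in>set u. bounded X t" "\<forall>t\<in>set v. bounded X t" "At \<in> set X"
  shows "(bounded_family_step X)\<^sup>*\<^sup>* u v"
proof -
  define m n where "m = count_list X At" and "n = count_list X Fm"
  define G where "G = tsubst (\<lambda>k. AVar (if k < m then k else 0)) (\<lambda>k. if k < n then FVar k else FTop)"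
  \<comment> \<open>An atom in \<open>X\<close> makes index 0 an admissible default.\<close>
  have "m > 0"
    using assms(4) by (simp add: m_def count_list_0_iff flip: neq0_conv)
  then have G: "bounded X (G t)" for t
    by (auto simp: G_def bounded_def vars_tsubst m_def n_def split: if_splits)
  have id: "map G w = w" if "\<forall>t\<in>set w. bounded X t" for w
  proof (rule map_idI)
    fix t
    assume "t \<in> set w"
    with that have "G t = tsubst AVar FVar t"
      unfolding G_def by (intro tsubst_cong) (auto simp: bounded_def m_def n_def)
    then show "G t = t" by simp
  qed
  have "(bounded_family_step X)\<^sup>*\<^sup>* (map G u) (map G v) \<and> (\<forall>t\<in>set v. True)"
    using assms(1)
  proof (rule sks_proof_image)
    fix s t
    assume "sks_step s t"
    then have "bounded_step X (G s) (G t)"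
      using G sks_step_tsubst by (simp add: bounded_step_def G_def)
    then show "True \<and> (bounded_step X)\<^sup>*\<^sup>* (G s) (G t)" by simp
  qed (use G in auto)
  then show ?thesis using id assms by simp
qed

section \<open>Eliminating atoms over a word that has none\<close>

fun parity :: "aterm \<Rightarrow> bool" where
  "parity (AVar k) = True"
| "parity (ANu a) = (\<not> parity a)"

text \<open>Parity is needed for \<iota>(a) \<and> \<iota>(\<nu>(a)) \<rightarrow> \<bottom>: with
  \<top> for every atom this would become \<top> \<and> \<top> \<rightarrow> \<bottom>, which sound
  rules cannot prove. Steps inside an atom add or remove two \<nu> and keep the parity.\<close>

fun ground :: "nat \<Rightarrow> fterm \<Rightarrow> fterm" where
  "ground n (FVar k) = (if k < n then FVar k else FTop)"
| "ground n (FIota a) = (if parity a then FTop else FBot)"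
| "ground n FTop = FTop"
| "ground n FBot = FBot"
| "ground n (x \<^bold>\<and> y) = ground n x \<^bold>\<and> ground n y"
| "ground n (x \<^bold>\<or> y) = ground n x \<^bold>\<or> ground n y"

definition ground_steps :: "word \<Rightarrow> fterm \<Rightarrow> fterm \<Rightarrow> bool" where
  "ground_steps X x y \<longleftrightarrow> (bounded_step X)\<^sup>*\<^sup>* (TF x) (TF y)"

lemma bounded_ground: "bounded X (TF (ground (count_list X Fm) x))"
  by (induction x) (auto simp: bounded_def)

lemma ground_steps_refl: "ground_steps X x x"
  by (simp add: ground_steps_def)

lemma ground_steps_trans [trans]: "ground_steps X x y \<Longrightarrow> ground_steps X y z \<Longrightarrow> ground_steps X x z"
  by (simp add: ground_steps_def)

lemma ground_steps_map:
  assumes "ground_steps X x y"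
    and C: "\<And>x y. sks_step (TF x) (TF y) \<Longrightarrow> sks_step (TF (C x)) (TF (C y))"
      "\<And>x. bounded X (TF x) \<Longrightarrow> bounded X (TF (C x))"
  shows "ground_steps X (C x) (C y)"
proof -
  have "t = TF z \<Longrightarrow> (bounded_step X)\<^sup>*\<^sup>* (TF (C x)) (TF (C z))" if "(bounded_step X)\<^sup>*\<^sup>* (TF x) t" for t z
    using that
  proof (induction arbitrary: z rule: rtranclp_induct)
    case base
    then show ?case by simp
  next
    case (step t t')
    then have "sks_step t t'" "bounded X t" "bounded X t'"
      by (simp_all add: bounded_step_def)
    then have "sort_of t = sort_of t'"
      using sks_step_sort[OF r_into_rtranclp[of sks_step]] by blast
    then obtain z' where z': "t = TF z'" using step.prems by (cases t) auto
    then have "bounded_step X (TF (C z')) (TF (C z))"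
      using step.hyps(2) step.prems C by (simp add: bounded_step_def)
    then show ?case using step.IH[OF z'] by (rule rtranclp.rtrancl_into_rtrancl[rotated])
  qed
  then show ?thesis using assms(1) unfolding ground_steps_def by blast
qed

lemma ground_steps_and:
  assumes "ground_steps X x x'" "ground_steps X y y'" "bounded X (TF x')" "bounded X (TF y)"
  shows "ground_steps X (x \<^bold>\<and> y) (x' \<^bold>\<and> y')"
proof -
  have "ground_steps X (x \<^bold>\<and> y) (x' \<^bold>\<and> y)"
    by (rule ground_steps_map[OF assms(1)])
      (use assms(4) in \<open>auto simp: sks_step_def bounded_def intro: term_step.and_left\<close>)
  also have "ground_steps X (x' \<^bold>\<and> y) (x' \<^bold>\<and> y')"
    by (rule ground_steps_map[OF assms(2)])
      (use assms(3) in \<open>auto simp: sks_step_def bounded_def intro: term_step.and_right\<close>)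
  finally show ?thesis .
qed

lemma ground_steps_or:
  assumes "ground_steps X x x'" "ground_steps X y y'" "bounded X (TF x')" "bounded X (TF y)"
  shows "ground_steps X (x \<^bold>\<or> y) (x' \<^bold>\<or> y')"
proof -
  have "ground_steps X (x \<^bold>\<or> y) (x' \<^bold>\<or> y)"
    by (rule ground_steps_map[OF assms(1)])
      (use assms(4) in \<open>auto simp: sks_step_def bounded_def intro: term_step.or_left\<close>)
  also have "ground_steps X (x' \<^bold>\<or> y) (x' \<^bold>\<or> y')"
    by (rule ground_steps_map[OF assms(2)])
      (use assms(3) in \<open>auto simp: sks_step_def bounded_def intro: term_step.or_right\<close>)
  finally show ?thesis .
qed

lemma ground_steps_rule:
  assumes "(TF l, TF r) \<in> SKS_rules"
    and "bounded X (TF (fsubst AVar \<rho> l))" "bounded X (TF (fsubst AVar \<rho> r))"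
  shows "ground_steps X (fsubst AVar \<rho> l) (fsubst AVar \<rho> r)"
  using assms term_step.root[of "(TF l, TF r)" AVar \<rho>]
  unfolding ground_steps_def by (intro r_into_rtranclp) (auto simp: bounded_step_def sks_step_def)

lemmas SKS_defs = SKS_rules_def S_bar_rules_def S_rules_def R_rules_def

lemma ground_steps_units:
  "ground_steps X (FTop \<^bold>\<and> FTop) FTop" "ground_steps X FTop (FTop \<^bold>\<and> FTop)"
  "ground_steps X (FTop \<^bold>\<and> FBot) FBot" "ground_steps X FBot (FTop \<^bold>\<and> FBot)"
  "ground_steps X (FBot \<^bold>\<or> FBot) FBot" "ground_steps X FBot (FBot \<^bold>\<or> FBot)"
  "ground_steps X (FBot \<^bold>\<or> FTop) FTop" "ground_steps X FTop (FBot \<^bold>\<or> FTop)"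
  "ground_steps X (FTop \<^bold>\<or> FTop) FTop" "ground_steps X FBot (FBot \<^bold>\<and> FBot)"
  "ground_steps X (FTop \<^bold>\<or> FBot) (FBot \<^bold>\<or> FTop)" "ground_steps X (FBot \<^bold>\<or> FTop) (FTop \<^bold>\<or> FBot)"
  "ground_steps X (FTop \<^bold>\<and> FBot) (FBot \<^bold>\<and> FTop)" "ground_steps X (FBot \<^bold>\<and> FTop) (FTop \<^bold>\<and> FBot)"
  "ground_steps X ((FTop \<^bold>\<and> FBot) \<^bold>\<or> (FBot \<^bold>\<and> FTop)) ((FTop \<^bold>\<or> FBot) \<^bold>\<and> (FBot \<^bold>\<or> FTop))"
  using ground_steps_rule[of "FTop \<^bold>\<and> FVar 0" "FVar 0" X "\<lambda>_. FTop"]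
    ground_steps_rule[of "FVar 0" "FTop \<^bold>\<and> FVar 0" X "\<lambda>_. FTop"]
    ground_steps_rule[of "FTop \<^bold>\<and> FVar 0" "FVar 0" X "\<lambda>_. FBot"]
    ground_steps_rule[of "FVar 0" "FTop \<^bold>\<and> FVar 0" X "\<lambda>_. FBot"]
    ground_steps_rule[of "FBot \<^bold>\<or> FVar 0" "FVar 0" X "\<lambda>_. FBot"]
    ground_steps_rule[of "FVar 0" "FBot \<^bold>\<or> FVar 0" X "\<lambda>_. FBot"]
    ground_steps_rule[of "FBot \<^bold>\<or> FVar 0" "FVar 0" X "\<lambda>_. FTop"]
    ground_steps_rule[of "FVar 0" "FBot \<^bold>\<or> FVar 0" X "\<lambda>_. FTop"]
    ground_steps_rule[of "FTop \<^bold>\<or> FTop" "FTop" X "\<lambda>_. FTop"]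
    ground_steps_rule[of "FBot" "FBot \<^bold>\<and> FBot" X "\<lambda>_. FTop"]
    ground_steps_rule[of "FVar 0 \<^bold>\<or> FVar 1" "FVar 1 \<^bold>\<or> FVar 0" X "\<lambda>k. if k = 0 then FTop else FBot"]
    ground_steps_rule[of "FVar 0 \<^bold>\<or> FVar 1" "FVar 1 \<^bold>\<or> FVar 0" X "\<lambda>k. if k = 0 then FBot else FTop"]
    ground_steps_rule[of "FVar 0 \<^bold>\<and> FVar 1" "FVar 1 \<^bold>\<and> FVar 0" X "\<lambda>k. if k = 0 then FTop else FBot"]
    ground_steps_rule[of "FVar 0 \<^bold>\<and> FVar 1" "FVar 1 \<^bold>\<and> FVar 0" X "\<lambda>k. if k = 0 then FBot else FTop"]
    ground_steps_rule[of "(FVar 0 \<^bold>\<and> FVar 1) \<^bold>\<or> (FVar 2 \<^bold>\<and> FVar 3)"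
      "(FVar 0 \<^bold>\<or> FVar 2) \<^bold>\<and> (FVar 1 \<^bold>\<or> FVar 3)" X "\<lambda>k. if k = 0 \<or> k = 3 then FTop else FBot"]
  by (simp_all add: SKS_defs bounded_def)

lemma bounded_const: "bounded X (TF FTop)" "bounded X (TF FBot)"
    "bounded X (TF (x \<^bold>\<and> y)) \<longleftrightarrow> bounded X (TF x) \<and> bounded X (TF y)"
    "bounded X (TF (x \<^bold>\<or> y)) \<longleftrightarrow> bounded X (TF x) \<and> bounded X (TF y)"
  by (auto simp: bounded_def)

text \<open>\<bottom> is doubled and written once as \<top> \<and> \<bottom> and once as \<bottom>
  \<and> \<top>; medial then puts a \<top> into each of two disjunctions.\<close>

lemma ground_steps_bot_top: "ground_steps X FBot FTop"
proof -
  note [simp] = bounded_const ground_steps_units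
  have 1: "ground_steps X FBot (FBot \<^bold>\<and> FTop)"
    using ground_steps_units(4,13) by (rule ground_steps_trans)
  have "ground_steps X FBot (FBot \<^bold>\<or> FBot)" by simp
  also have "ground_steps X (FBot \<^bold>\<or> FBot) ((FTop \<^bold>\<and> FBot) \<^bold>\<or> (FBot \<^bold>\<and> FTop))"
    using 1 by (intro ground_steps_or) simp_all
  also have "ground_steps X \<dots> ((FTop \<^bold>\<or> FBot) \<^bold>\<and> (FBot \<^bold>\<or> FTop))" by simp
  also have "ground_steps X \<dots> ((FBot \<^bold>\<or> FTop) \<^bold>\<and> FTop)"
    by (intro ground_steps_and) simp_all
  also have "ground_steps X \<dots> (FTop \<^bold>\<and> FTop)"
    by (intro ground_steps_and ground_steps_refl) simp_all
  also have "ground_steps X \<dots> FTop" by simp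
  finally show ?thesis .
qed

lemma avars_a_nonempty [simp]: "avars_a a \<noteq> {}"
  by (induction a) auto

lemma ground_fsubst: "avars_f l = {} \<Longrightarrow> ground n (fsubst \<sigma> \<rho> l) = fsubst AVar (\<lambda>k. ground n (\<rho> k)) l"
  by (induction l) auto

text \<open>Grounding commutes with the instances of a rule without atoms. In the other rules only
  constants remain, chosen by the parity of \<open>\<sigma> 0\<close>. Interaction and contraction
  become facts about units, up to commutativity; the step from \<bottom> to \<top> is needed for
  \<bottom> \<rightarrow> \<iota>(a) with even parity and for \<iota>(a) \<rightarrow> \<top> with
  odd parity.\<close>

lemma ground_steps_root:
  assumes "(TF l, TF r) \<in> SKS_rules"
  shows "ground_steps X (ground (count_list X Fm) (fsubst \<sigma> \<rho> l)) (ground (count_list X Fm) (fsubst \<sigma> \<rho> r))"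
proof (cases "avars_f l = {} \<and> avars_f r = {}")
  case True
  let ?g = "\<lambda>x. ground (count_list X Fm) (fsubst \<sigma> \<rho> x)"
  have *: "?g l = fsubst AVar (\<lambda>k. ground (count_list X Fm) (\<rho> k)) l"
      "?g r = fsubst AVar (\<lambda>k. ground (count_list X Fm) (\<rho> k)) r"
    using True ground_fsubst by auto
  show ?thesis
    using bounded_ground[of X "fsubst \<sigma> \<rho> l"] bounded_ground[of X "fsubst \<sigma> \<rho> r"] assms
    unfolding * by (intro ground_steps_rule)
next
  case False
  note u = ground_steps_units
  show ?thesis
    using assms False
    by (cases "parity (\<sigma> 0)") (auto simp: SKS_defs ground_steps_refl ground_steps_bot_top u
        ground_steps_trans[OF u(8,12)] ground_steps_trans[OF u(14,3)])
qed

lemma ground_step: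
  assumes "\<alpha> \<in> SKS_rules" "term_step \<alpha> s t"
  shows "(\<forall>x y. s = TF x \<longrightarrow> t = TF y \<longrightarrow>
      ground_steps X (ground (count_list X Fm) x) (ground (count_list X Fm) y)) \<and>
    (\<forall>a b. s = TA a \<longrightarrow> t = TA b \<longrightarrow> parity a = parity b)"
  using assms(2,1)
proof (induction rule: term_step.induct)
  case (root \<sigma> \<rho>)
  note sorts = SKS_rules_sorts[OF root]
  show ?case
  proof (cases "fst \<alpha>")
    case (TF l)
    then obtain r where r: "snd \<alpha> = TF r" using sorts by (cases "snd \<alpha>") auto
    then have "(TF l, TF r) \<in> SKS_rules" using root TF by (metis prod.collapse)
    from ground_steps_root[OF this, of X \<sigma> \<rho>] show ?thesis using TF r by simp
  next
    case (TA a)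
    then obtain b where b: "snd \<alpha> = TA b" using sorts by (cases "snd \<alpha>") auto
    have "parity (asubst \<sigma> a) = parity (asubst \<sigma> b)"
      using root TA b by (auto simp: SKS_defs)
    then show ?thesis using TA b by simp
  qed
next
  case (iota a b)
  then show ?case by (auto simp: ground_steps_refl)
qed (auto intro!: ground_steps_and ground_steps_or ground_steps_refl bounded_ground)

lemma sks_proof_bounded_without_atom:
  assumes "sks_proof u v" "\<forall>t\<in>set u. bounded X t" "\<forall>t\<in>set v. bounded X t" "At \<notin> set X"
  shows "(bounded_family_step X)\<^sup>*\<^sup>* u v"
proof -
  define n where "n = count_list X Fm"
  define G where "G t = (case t of TA a \<Rightarrow> TA a | TF x \<Rightarrow> TF (ground n x))" for t
  have no_atom: "count_list X At = 0" using assms(4) by (simp add: count_list_0_iff)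
  \<comment> \<open>Every term of sort \<open>At\<close> contains a variable, so over a word without
    \<open>At\<close> only formulas free of \<iota> are bounded, and \<open>ground\<close> fixes
    them.\<close>
  have Fm: "sort_of t = Fm" if "bounded X t" for t
    using that avars_a_nonempty no_atom by (cases t) (auto simp: bounded_def)
  have "ground n x = x" if "bounded X (TF x)" for x
    using that avars_a_nonempty no_atom by (induction x) (auto simp: bounded_def n_def)
  then have id: "map G w = w" if "\<forall>t\<in>set w. bounded X t" for w
    using that Fm by (intro map_idI) (auto simp: G_def sort_of_iff split: trm.splits)
  have "(bounded_family_step X)\<^sup>*\<^sup>* (map G u) (map G v) \<and> (\<forall>t\<in>set v. sort_of t = Fm)"
    using assms(1)
  proof (rule sks_proof_image)
    fix s t
    assume st: "sks_step s t" "sort_of s = Fm"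
    then have "sort_of t = Fm"
      using sks_step_sort[OF r_into_rtranclp[of sks_step, OF st(1)]] by simp
    then show "sort_of t = Fm \<and> (bounded_step X)\<^sup>*\<^sup>* (G s) (G t)"
      using st ground_step[of _ s t X] unfolding sks_step_def
      by (auto simp: sort_of_iff G_def ground_steps_def n_def)
  next
    fix t
    assume "sort_of t = Fm"
    then show "bounded X (G t)" by (auto simp: sort_of_iff G_def n_def bounded_ground)
  next
    show "\<forall>t\<in>set u. sort_of t = Fm" using assms(2) Fm by blast
  qed
  then show ?thesis using id assms by simp
qed

lemma sks_proof_K_proof:
  assumes "sks_proof u v" "\<forall>t\<in>set u. bounded X t" "\<forall>t\<in>set v. bounded X t"
  shows "K_proof (Phi X u) (Phi X v)"
  using assms sks_proof_bounded_with_atom sks_proof_bounded_without_atom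
    bounded_family_steps_K_proof by blast

lemma eps_word_types: "csrc (eps_word X) = X \<and> ctgt (eps_word X) = [] \<and> proj (eps_word X) = []"
  by (induction X) (auto simp: T_id_def T_tensor_def T_shift_def)

lemma proj_top: "proj (opc OTop \<odot> eps_word X) = [TF FTop]" "csrc (opc OTop \<odot> eps_word X) = X"
  by (simp_all add: eps_word_types T_comp_def)

theorem theorem2p4p3:
  shows "(\<forall>u v :: family. sks_proof u v \<longrightarrow>
           (\<forall>X :: word. sharp u \<le> word_sharp X \<and> sharp v \<le> word_sharp X \<longrightarrow>
             K_proof (Phi X u) (Phi X v))) \<and>
         (\<forall>u :: family. complete_sks_proof u \<longrightarrow>
           (\<forall>X :: word. sharp u \<le> word_sharp X \<longrightarrow> complete_K_proof (Phi X u))) \<and>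
         (\<forall>f g :: circuit. ctgt f \<in> {[Fm], [At]} \<and> ctgt g \<in> {[Fm], [At]} \<and> K_proof f g \<longrightarrow>
           sks_proof (proj f) (proj g)) \<and>
         (\<forall>f :: circuit. ctgt f \<in> {[At], [Fm]} \<and> complete_K_proof f \<longrightarrow>
           complete_sks_proof (proj f))"
proof (intro conjI allI impI)
  fix u v X
  assume "sks_proof u v" "sharp u \<le> word_sharp X \<and> sharp v \<le> word_sharp X"
  then show "K_proof (Phi X u) (Phi X v)"
    by (simp add: sharp_le_bounded sks_proof_K_proof)
next
  fix u X
  assume u: "complete_sks_proof u" "sharp u \<le> word_sharp X"
  \<comment> \<open>Both circuits have source \<open>X\<close> and project to \<top>, so coherence
    relates them.\<close>
  have "K_proof (opc OTop \<odot> eps_word X) (Phi X [TF FTop])"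
    using econg_Phi[of "opc OTop \<odot> eps_word X"] by (simp only: proj_top econg_K_proof)
  moreover have "K_proof (Phi X [TF FTop]) (Phi X u)"
    using u by (intro sks_proof_K_proof)
      (simp_all add: complete_sks_proof_def sharp_le_bounded bounded_const)
  moreover have "csrc (Phi X u) = X"
    using u by (simp add: Phi_spec sharp_le_bounded)
  ultimately show "complete_K_proof (Phi X u)"
    unfolding complete_K_proof_def K_proof_def by (metis rtranclp_trans)
next
  fix f g
  assume "ctgt f \<in> {[Fm], [At]} \<and> ctgt g \<in> {[Fm], [At]} \<and> K_proof f g"
  then show "sks_proof (proj f) (proj g)" by (blast intro: K_proof_sks)
next
  fix f
  assume "ctgt f \<in> {[At], [Fm]} \<and> complete_K_proof f"
  then show "complete_sks_proof (proj f)"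
    using K_proof_sks[of "opc OTop \<odot> eps_word (csrc f)" f]
    by (simp add: complete_K_proof_def complete_sks_proof_def proj_top)
qed

end
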